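(* (Non-unitary test for principal series modules.) Let $G=O(p,q)$ ($p+q=2n+1$) or $Sp_{2n}(\mathbb{R})$, of real rank $d$, and let $\delta,k,\mu,\underline\mu$ be as listed in the context. If either $\overline{X(\nu_k)}$ or $\overline{X(\bar\nu_{d-k})}$ is not unitary, as $\mathbb{H}_k(c_\mu)$- and $\mathbb{H}_{d-k}(c_{\underline\mu})$-module respectively, then the Langlands quotient $\overline{X_\delta^\nu}$ of the minimal principal series module $X_\delta^\nu$ is not unitary.
   Context: Groups. $G$ is $Sp_{2n}(\mathbb{R})$ (preserving the form with matrix $\begin{bmatrix}0&I_n\\-I_n&0\end{bmatrix}$) or $O(p,q)$ (preserving $\mathrm{diag}(I_p,-I_q)$), $p+q=2n+1$, $q=\min(p,q)$. The real rank is $d=n$, resp. $d=q$. $\mathfrak g_0$ is the Lie algebra, $\mathfrak g$ its complexification, $V$ the complexified defining matrix module with standard basis $e_j$. Let $\xi=\begin{bmatrix}0&iI_n\\-iI_n&0\end{bmatrix}$ (symplectic) or $\xi=\mathrm{diag}(I_p,-I_q)$ (orthogonal). Conjugation by $\xi$ is the Cartan involution; $K$ is its fixed group, a maximal compact subgroup, $\mathfrak g=\mathfrak k\oplus\mathfrak p$ and $\mathfrak p_0=\mathfrak p\cap\mathfrak g_0$. $K\cong U(n)$, where $\det$ differentiates to the trace on $\mathfrak k\cong\mathfrak{gl}_n$ (whose identity matrix is the element $\xi$ of $\mathfrak g$), or $K\cong O(p)\times O(q)$, with characters written $\chi_1\otimes\chi_2$. Principal series. $\mathfrak a\subset\mathfrak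 p$ is the maximal abelian subalgebra with basis $a_1,\dots,a_d$, $a_i=E_{i,n+i}+E_{n+i,i}$ (symplectic), $a_i=E_{p-i+1,p+i}+E_{p+i,p-i+1}$ (orthogonal). $G=KAN$ is the Iwasawa decomposition, with $A$ having complexified Lie algebra $\mathfrak a$ and $N$ corresponding to the positive restricted roots $\epsilon_i\pm\epsilon_j$ ($i<j$) and those proportional to $\epsilon_i$ ($\epsilon_i$ dual to $a_i$). $M$ is the centralizer of $\mathfrak a_0=\mathfrak a\cap\mathfrak g_0$ in $K$: $M\cong(\mathbb Z_2)^n$, the $i$-th generator acting by $-1$ on $e_i,e_{n+i}$ and by $1$ on the other basis vectors (symplectic); $M\cong O(p-q)\times O(1)^q$, with $O(p-q)$ acting on $e_1,\dots,e_{p-q}$ and the $i$-th generator acting by $-1$ on $e_{p-i+1},e_{p+i}$ (orthogonal). For a character $\delta$ of $M$ and $\nu\in\mathfrak a^*$, $X_\delta^\nu=\operatorname{Ind}_{MAN}^G(\delta\otimes e^\nu\otimes 1)$. Characters and constants ($0\le k\le d$). (S) $G=Sp_{2n}(\mathbb R)$: $\delta$ is $-1$ on the first $k$ generators of $M$ and $1$ on the last $n-k$; $\mu=\mathrm{triv}$, $\underline\mu=\det$; $c_\mu=0$, $c_{\underline\mu}=1$, $r_\mu=r_{\underline\mu}=-n$. (O1) $G=O(p,q)$: $\delta=\mathrm{triv}\otimes\mathrm{triv}^k\otimes\mathrm{sgn}^{q-k}$, $\mu=\mathrm{triv}\otimes\det$, $\underline\mu=\mathrm{triv}\otimes\mathrm{triv}$.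 (O2) $G=O(p,q)$: $\delta=\det\otimes\mathrm{triv}^k\otimes\mathrm{sgn}^{q-k}$, $\mu=\det\otimes\mathrm{triv}$, $\underline\mu=\det\otimes\det$. In (O1), (O2) (first factor of $\delta$ on $O(p-q)$, the others on $O(1)^q$), $c_\mu=c_{\underline\mu}=\frac{p-q}2$ and $r_\mu=r_{\underline\mu}=\frac{p+q}2$. Functors. $F_{\mu,l}(X)=\operatorname{Hom}_K(\mu,X\otimes V^{\otimes l})$. Tensor factors are numbered $0$ (for $X$), $1,\dots,l$, and $(g)_i$ is $g$ acting on the $i$-th factor. For a basis $B$ of $\mathfrak g$ with dual basis $b\mapsto b^*$ with respect to the Killing form, $\Omega_{ij}=\sum_{b\in B}(b)_i(b^* )_j$ and $z_i=\sum_{0\le j<i}\Omega_{ji}$. These operators, the flips $\sigma_{i,i+1}$ of factors $i,i+1\ge1$, and $(\xi)_i$ act on $F_{\mu,l}(X)$. Hecke algebra. $\mathbb{H}_l(c)$ is, as a vector space, $\mathbb{C}[\epsilon_1,\dots,\epsilon_l]\otimes\mathbb{C}[W(B_l)]$, both factors being subalgebras ($W(B_l)$ the hyperoctahedral group with reflections $s_{i,i+1}$, $s_{\epsilon_j}$), with relations $s_{i,i+1}\epsilon_i-\epsilon_{i+1}s_{i,i+1}=1$, $[s_{i,i+1},\epsilon_j]=0$ ($j\ne i,i+1$), $s_{\epsilon_l}\epsilon_l+\epsilon_ls_{\epsilon_l}=2c$, $[s_{\epsilon_l},\epsilon_j]=0$ ($j\ne l$). $F_{\mu,k}(X_\delta^\nu)$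 is an $\mathbb{H}_k(c_\mu)$-module by $\epsilon_i\mapsto z_i-r_\mu$, $s_{i,i+1}\mapsto\sigma_{i,i+1}$, $s_{\epsilon_i}\mapsto(\xi)_i$; $F_{\underline\mu,d-k}(X_\delta^\nu)$ is an $\mathbb{H}_{d-k}(c_{\underline\mu})$-module by the same formulas with $r_{\underline\mu}$. $\mathfrak a_k=\mathrm{span}(a_1,\dots,a_k)$, $\bar{\mathfrak a}_{d-k}=\mathrm{span}(a_{k+1},\dots,a_d)$, $\nu_k=\nu|_{\mathfrak a_k}$, $\bar\nu_{d-k}=\nu|_{\bar{\mathfrak a}_{d-k}}$. With $S(\mathfrak a_k)=\mathbb{C}[\epsilon_1,\dots,\epsilon_k]$ ($a_i\leftrightarrow\epsilon_i$) and $S(\bar{\mathfrak a}_{d-k})=\mathbb{C}[\epsilon_1,\dots,\epsilon_{d-k}]$ ($a_{k+i}\leftrightarrow\epsilon_i$), $X(\nu_k)=\operatorname{Ind}_{S(\mathfrak a_k)}^{\mathbb{H}_k(c_\mu)}\nu_k$ and $X(\bar\nu_{d-k})=\operatorname{Ind}_{S(\bar{\mathfrak a}_{d-k})}^{\mathbb{H}_{d-k}(c_{\underline\mu})}\bar\nu_{d-k}$; these are isomorphic to $F_{\mu,k}(X_\delta^\nu)$ and $F_{\underline\mu,d-k}(X_\delta^\nu)$. Forms. A Hermitian form is a map linear in the first and conjugate linear in the second variable. On a Harish-Chandra module it is invariant if $\langle gx,y\rangle=\langle x,g^*y\rangle$ for $g\in\mathfrak g$, where $g^*=-\bar g$ and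 the bar is conjugation with respect to $\mathfrak g_0$. On $\mathbb{H}_l(c)$ let $\bullet$ be the conjugate-linear antihomomorphism with $\epsilon_i^\bullet=\epsilon_i$ and $w^\bullet=w^{-1}$ for $w\in W(B_l)$, and $h^*=w_0h^\bullet w_0$ with $w_0=s_{\epsilon_1}\cdots s_{\epsilon_l}$ the longest element; a form on an $\mathbb{H}_l(c)$-module is invariant if $\langle hu,v\rangle=\langle u,h^*v\rangle$. A module of either kind is unitary if it has a positive definite invariant Hermitian form. $V$ is given a form making it unitary with respect to $\bullet$: $\langle kv,w\rangle=\langle v,k^{-1}w\rangle$ for $k\in K$, $\langle pv,w\rangle=\langle v,pw\rangle$ for $p\in\mathfrak p_0$. Given an invariant form on $X$, $X\otimes V^{\otimes l}$ has the product form and, for a character $\mu$ of $K$, $F_{\mu,l}(X)$ the form $\langle\phi,\psi\rangle=\langle\phi(1),\psi(1)\rangle_{X\otimes V^{\otimes l}}$. The Langlands quotient of a module $Y$ with invariant Hermitian form is $\overline Y=Y/\operatorname{rad}\langle\,,\rangle_Y$; for $X(\nu_k)$ and $X(\bar\nu_{d-k})$ the form is the one induced on $F_{\mu,k}(X_\delta^\nu)$ and $F_{\underline\mu,d-k}(X_\delta^\nu)$.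
   Formalization: With the listed constants F is in general not a Hecke module; the theorem is proved for them and also for corrected ones: form tr(xy)/2 in place of the Killing form, s ε_i − ε_{i+1} s = −1, and for O(p,q) c = (q−p)/2, r = 1−(p+q)/2. *)

theory Defs
  imports "HOL-Analysis.Analysis" "HOL-Library.Function_Algebras"
begin

section \<open>Representations, forms, quotients\<close>

text \<open>A complex vector space with a linear action of operators labelled by \<^typ>\<open>'h\<close>; the
  labels are elements of a complex Lie algebra, or of an associative algebra.\<close>

record ('h, 'v) rep =
  vecs :: "'v set"
  vzero :: 'v
  vadd :: "'v \<Rightarrow> 'v \<Rightarrow> 'v"
  vscale :: "complex \<Rightarrow> 'v \<Rightarrow> 'v"
  vact :: "'h \<Rightarrow> 'v \<Rightarrow> 'v"

definition rep_span :: "('h, 'v) rep \<Rightarrow> 'v set \<Rightarrow> 'v set" where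
  "rep_span Y S = \<Inter>{U. S \<subseteq> U \<and> vzero Y \<in> U \<and>
     (\<forall>a b. \<forall>x\<in>U. \<forall>y\<in>U. vadd Y (vscale Y a x) (vscale Y b y) \<in> U)}"

definition coset :: "('h, 'v) rep \<Rightarrow> 'v set \<Rightarrow> 'v \<Rightarrow> 'v set" where
  "coset Y R x = vadd Y x ` R"

definition quotient_rep :: "('h, 'v) rep \<Rightarrow> 'v set \<Rightarrow> ('h, 'v set) rep" where
  "quotient_rep Y R =
    \<lparr> vecs = coset Y R ` vecs Y,
      vzero = R,
      vadd = (\<lambda>A C. {vadd Y a c | a c. a \<in> A \<and> c \<in> C}),
      vscale = (\<lambda>t A. {vadd Y (vscale Y t a) r | a r. a \<in> A \<and> r \<in> R}),
      vact = (\<lambda>h A. {vadd Y (vact Y h a) r | a r. a \<in> A \<and> r \<in> R}) \<rparr>"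

text \<open>Linear in the first, conjugate linear in the second variable.  Conjugate symmetry is not
  imposed; it is automatic for positive definite forms.\<close>

definition hermitian_form :: "('h, 'v) rep \<Rightarrow> ('v \<Rightarrow> 'v \<Rightarrow> complex) \<Rightarrow> bool" where
  "hermitian_form Y f \<longleftrightarrow> (\<forall>x\<in>vecs Y. \<forall>y\<in>vecs Y. \<forall>z\<in>vecs Y. \<forall>a b.
     f (vadd Y (vscale Y a x) (vscale Y b y)) z = a * f x z + b * f y z \<and>
     f z (vadd Y (vscale Y a x) (vscale Y b y)) = cnj a * f z x + cnj b * f z y)"

definition invariant_form ::
  "'h set \<Rightarrow> ('h \<Rightarrow> 'h) \<Rightarrow> ('h, 'v) rep \<Rightarrow> ('v \<Rightarrow> 'v \<Rightarrow> complex) \<Rightarrow> bool" where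
  "invariant_form A star Y f \<longleftrightarrow>
     (\<forall>h\<in>A. \<forall>x\<in>vecs Y. \<forall>y\<in>vecs Y. f (vact Y h x) y = f x (vact Y (star h) y))"

definition positive_definite :: "('h, 'v) rep \<Rightarrow> ('v \<Rightarrow> 'v \<Rightarrow> complex) \<Rightarrow> bool" where
  "positive_definite Y f \<longleftrightarrow>
     (\<forall>x\<in>vecs Y. x \<noteq> vzero Y \<longrightarrow> f x x \<in> \<real> \<and> 0 < Re (f x x))"

definition unitary :: "'h set \<Rightarrow> ('h \<Rightarrow> 'h) \<Rightarrow> ('h, 'v) rep \<Rightarrow> bool" where
  "unitary A star Y \<longleftrightarrow>
     (\<exists>f. hermitian_form Y f \<and> invariant_form A star Y f \<and> positive_definite Y f)"

definition form_radical :: "('h, 'v) rep \<Rightarrow> ('v \<Rightarrow> 'v \<Rightarrow> complex) \<Rightarrow> 'v set" where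
  "form_radical Y f = {x \<in> vecs Y. \<forall>y\<in>vecs Y. f x y = 0}"

definition langlands_quotient ::
  "('h, 'v) rep \<Rightarrow> ('v \<Rightarrow> 'v \<Rightarrow> complex) \<Rightarrow> ('h, 'v set) rep" where
  "langlands_quotient Y f = quotient_rep Y (form_radical Y f)"

section \<open>Groups and Lie algebras\<close>

text \<open>\<open>Sp n\<close> stands for \<open>Sp\<^sub>2\<^sub>n(\<real>)\<close>.  \<open>O1 p q\<close> and \<open>O2 p q\<close> both stand for \<open>O(p,q)\<close>; they differ in the
  characters \<open>\<delta>\<close>, \<open>\<mu>\<close> below (trivial, resp. \<open>det\<close>, on the first factor).\<close>

datatype setting = Sp nat | O1 nat nat | O2 nat nat

fun valid_setting :: "setting \<Rightarrow> bool" where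
  "valid_setting (Sp n) \<longleftrightarrow> 1 \<le> n"
| "valid_setting (O1 p q) \<longleftrightarrow> q \<le> p \<and> odd (p + q)"
| "valid_setting (O2 p q) \<longleftrightarrow> q \<le> p \<and> odd (p + q)"

fun mat_size :: "setting \<Rightarrow> nat" where
  "mat_size (Sp n) = 2 * n"
| "mat_size (O1 p q) = p + q"
| "mat_size (O2 p q) = p + q"

fun real_rank :: "setting \<Rightarrow> nat" where
  "real_rank (Sp n) = n"
| "real_rank (O1 p q) = q"
| "real_rank (O2 p q) = q"

text \<open>Matrices are indexed by a finite type \<^typ>\<open>'m\<close>; \<open>e :: nat \<Rightarrow> 'm\<close> is a bijection from
  \<open>{1..N}\<close> that numbers the rows, columns and standard basis vectors.\<close>

definition E :: "(nat \<Rightarrow> 'm::finite) \<Rightarrow> nat \<Rightarrow> nat \<Rightarrow> real^'m^'m" where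
  "E e i j = (\<chi> a b. if a = e i \<and> b = e j then 1 else 0)"

definition cmat_of :: "real^'m::finite^'m \<Rightarrow> complex^'m^'m" where
  "cmat_of X = (\<chi> a b. complex_of_real (X $ a $ b))"

definition cmat_Re :: "complex^'m::finite^'m \<Rightarrow> real^'m^'m" where
  "cmat_Re Z = (\<chi> a b. Re (Z $ a $ b))"

definition cmat_Im :: "complex^'m::finite^'m \<Rightarrow> real^'m^'m" where
  "cmat_Im Z = (\<chi> a b. Im (Z $ a $ b))"

definition cmat_cnj :: "complex^'m::finite^'m \<Rightarrow> complex^'m^'m" where
  "cmat_cnj Z = (\<chi> a b. cnj (Z $ a $ b))"

definition cmat_scale :: "complex \<Rightarrow> complex^'m::finite^'m \<Rightarrow> complex^'m^'m" where
  "cmat_scale c Z = (\<chi> a b. c * Z $ a $ b)"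

global_interpretation cmat: vector_space "cmat_scale :: complex \<Rightarrow> complex^'m::finite^'m \<Rightarrow> _"
  by unfold_locales (simp_all add: cmat_scale_def vec_eq_iff algebra_simps)

definition mexp :: "real^'m::finite^'m \<Rightarrow> real^'m^'m" where
  "mexp X = (\<Sum>r. (1 / fact r) *\<^sub>R (((**) X ^^ r) (mat 1)))"

fun form_matrix :: "setting \<Rightarrow> (nat \<Rightarrow> 'm::finite) \<Rightarrow> real^'m^'m" where
  "form_matrix (Sp n) e = (\<Sum>i=1..n. E e i (n + i) - E e (n + i) i)"
| "form_matrix (O1 p q) e = (\<Sum>i=1..p. E e i i) - (\<Sum>i=p+1..p+q. E e i i)"
| "form_matrix (O2 p q) e = (\<Sum>i=1..p. E e i i) - (\<Sum>i=p+1..p+q. E e i i)"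

fun xi :: "setting \<Rightarrow> (nat \<Rightarrow> 'm::finite) \<Rightarrow> complex^'m^'m" where
  "xi (Sp n) e = cmat_scale \<i> (cmat_of (form_matrix (Sp n) e))"
| "xi (O1 p q) e = cmat_of (form_matrix (O1 p q) e)"
| "xi (O2 p q) e = cmat_of (form_matrix (O2 p q) e)"

definition G_grp :: "setting \<Rightarrow> (nat \<Rightarrow> 'm::finite) \<Rightarrow> (real^'m^'m) set" where
  "G_grp s e = {g. Finite_Cartesian_Product.transpose g ** form_matrix s e ** g = form_matrix s e}"

definition g0 :: "setting \<Rightarrow> (nat \<Rightarrow> 'm::finite) \<Rightarrow> (real^'m^'m) set" where
  "g0 s e = {X. Finite_Cartesian_Product.transpose X ** form_matrix s e + form_matrix s e ** X = 0}"

definition g_cpx :: "setting \<Rightarrow> (nat \<Rightarrow> 'm::finite) \<Rightarrow> (complex^'m^'m) set" where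
  "g_cpx s e = {Z. cmat_Re Z \<in> g0 s e \<and> cmat_Im Z \<in> g0 s e}"

definition g_star :: "complex^'m::finite^'m \<Rightarrow> complex^'m^'m" where
  "g_star Z = - cmat_cnj Z"

definition K_grp :: "setting \<Rightarrow> (nat \<Rightarrow> 'm::finite) \<Rightarrow> (real^'m^'m) set" where
  "K_grp s e = {g \<in> G_grp s e. xi s e ** cmat_of g = cmat_of g ** xi s e}"

definition p0 :: "setting \<Rightarrow> (nat \<Rightarrow> 'm::finite) \<Rightarrow> (real^'m^'m) set" where
  "p0 s e = {X \<in> g0 s e. xi s e ** cmat_of X = - (cmat_of X ** xi s e)}"

section \<open>Minimal principal series\<close>

fun a_elt :: "setting \<Rightarrow> (nat \<Rightarrow> 'm::finite) \<Rightarrow> nat \<Rightarrow> real^'m^'m" where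
  "a_elt (Sp n) e i = E e i (n + i) + E e (n + i) i"
| "a_elt (O1 p q) e i = E e (p + 1 - i) (p + i) + E e (p + i) (p + 1 - i)"
| "a_elt (O2 p q) e i = E e (p + 1 - i) (p + i) + E e (p + i) (p + 1 - i)"

text \<open>The element of \<open>\<aa>\<^sub>0\<close> with coordinates \<open>h 1, \<dots>, h d\<close>.  Linear functionals on \<open>\<aa>\<close> are given by
  their values on \<open>a\<^sub>1, \<dots>, a\<^sub>d\<close>.\<close>

definition a_vec :: "setting \<Rightarrow> (nat \<Rightarrow> 'm::finite) \<Rightarrow> (nat \<Rightarrow> real) \<Rightarrow> real^'m^'m" where
  "a_vec s e h = (\<Sum>i=1..real_rank s. h i *\<^sub>R a_elt s e i)"

definition root_space ::
  "setting \<Rightarrow> (nat \<Rightarrow> 'm::finite) \<Rightarrow> (nat \<Rightarrow> real) \<Rightarrow> (real^'m^'m) set" where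
  "root_space s e l = {X \<in> g0 s e. \<forall>h. a_vec s e h ** X - X ** a_vec s e h
     = (\<Sum>i=1..real_rank s. l i * h i) *\<^sub>R X}"

definition eps_wt :: "nat \<Rightarrow> nat \<Rightarrow> real" where
  "eps_wt i j = (if j = i then 1 else 0)"

definition pos_roots :: "setting \<Rightarrow> (nat \<Rightarrow> 'm::finite) \<Rightarrow> (nat \<Rightarrow> real) set" where
  "pos_roots s e = {l. root_space s e l \<noteq> {0} \<and>
     ((\<exists>i j. 1 \<le> i \<and> i < j \<and> j \<le> real_rank s \<and> (l = eps_wt i + eps_wt j \<or> l = eps_wt i - eps_wt j)) \<or>
      (\<exists>i t. 1 \<le> i \<and> i \<le> real_rank s \<and> 0 < t \<and> l = (\<lambda>j. t * eps_wt i j)))}"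

definition N_grp :: "setting \<Rightarrow> (nat \<Rightarrow> 'm::finite) \<Rightarrow> (real^'m^'m) set" where
  "N_grp s e = mexp ` span (\<Union>l\<in>pos_roots s e. root_space s e l)"

definition rho :: "setting \<Rightarrow> (nat \<Rightarrow> 'm::finite) \<Rightarrow> nat \<Rightarrow> real" where
  "rho s e i = (\<Sum>l\<in>pos_roots s e. real (dim (root_space s e l)) * l i) / 2"

definition M_grp :: "setting \<Rightarrow> (nat \<Rightarrow> 'm::finite) \<Rightarrow> (real^'m^'m) set" where
  "M_grp s e = {m \<in> K_grp s e. \<forall>h. m ** a_vec s e h = a_vec s e h ** m}"

definition det_on :: "nat set \<Rightarrow> (nat \<Rightarrow> nat \<Rightarrow> complex) \<Rightarrow> complex" where
  "det_on S A = (\<Sum>\<pi> | \<pi> permutes S. of_int (sign \<pi>) * (\<Prod>i\<in>S. A i (\<pi> i)))"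

definition entry :: "(nat \<Rightarrow> 'm::finite) \<Rightarrow> real^'m^'m \<Rightarrow> nat \<Rightarrow> nat \<Rightarrow> complex" where
  "entry e g i j = complex_of_real (g $ e i $ e j)"

text \<open>An element of \<open>M\<close> is \<open>\<plusminus>1\<close> on each line spanned by \<open>e\<^sub>i\<close> (symplectic), resp.
  \<open>e\<^sub>p\<^sub>+\<^sub>i\<close> (orthogonal); that sign is the component in the \<open>i\<close>-th factor \<open>\<int>\<^sub>2\<close>, resp. \<open>O(1)\<close>.\<close>

fun delta :: "setting \<Rightarrow> (nat \<Rightarrow> 'm::finite) \<Rightarrow> nat \<Rightarrow> real^'m^'m \<Rightarrow> complex" where
  "delta (Sp n) e k m = (\<Prod>i=1..k. entry e m i i)"
| "delta (O1 p q) e k m = (\<Prod>i=k+1..q. entry e m (p + i) (p + i))"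
| "delta (O2 p q) e k m = det_on {1..p-q} (entry e m) * (\<Prod>i=k+1..q. entry e m (p + i) (p + i))"

primrec Ck_on :: "nat \<Rightarrow> 'a::real_normed_vector set \<Rightarrow> ('a \<Rightarrow> complex) \<Rightarrow> bool" where
  "Ck_on 0 U F \<longleftrightarrow> continuous_on U F"
| "Ck_on (Suc r) U F \<longleftrightarrow> F differentiable_on U \<and>
     (\<forall>v. Ck_on r U (\<lambda>x. frechet_derivative F (at x) v))"

definition smooth_on_set :: "'a::real_normed_vector set \<Rightarrow> ('a \<Rightarrow> complex) \<Rightarrow> bool" where
  "smooth_on_set S f \<longleftrightarrow> (\<forall>g\<in>S. \<exists>U F. open U \<and> g \<in> U \<and> (\<forall>r. Ck_on r U F) \<and> (\<forall>x\<in>U \<inter> S. F x = f x))"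

definition K_finite :: "setting \<Rightarrow> (nat \<Rightarrow> 'm::finite) \<Rightarrow> (real^'m^'m \<Rightarrow> complex) \<Rightarrow> bool" where
  "K_finite s e f \<longleftrightarrow> (\<exists>S. finite S \<and> (\<forall>\<kappa>\<in>K_grp s e. \<exists>c :: (real^'m^'m \<Rightarrow> complex) \<Rightarrow> complex.
     \<forall>g. f (matrix_inv \<kappa> ** g) = (\<Sum>u\<in>S. c u * u g)))"

text \<open>Normalized induction, with \<open>G\<close> acting by left translation.  Functions on \<open>G\<close> are extended
  by \<open>0\<close> to all matrices.\<close>

definition ps_space ::
  "setting \<Rightarrow> (nat \<Rightarrow> 'm::finite) \<Rightarrow> nat \<Rightarrow> (nat \<Rightarrow> complex) \<Rightarrow> (real^'m^'m \<Rightarrow> complex) set" where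
  "ps_space s e k \<nu> = {f. (\<forall>g. g \<notin> G_grp s e \<longrightarrow> f g = 0) \<and>
     smooth_on_set (G_grp s e) f \<and> K_finite s e f \<and>
     (\<forall>g\<in>G_grp s e. \<forall>m\<in>M_grp s e. \<forall>h. \<forall>u\<in>N_grp s e.
        f (g ** m ** mexp (a_vec s e h) ** u) =
          inverse (delta s e k m) *
          exp (- (\<Sum>i=1..real_rank s. (\<nu> i + complex_of_real (rho s e i)) * complex_of_real (h i))) *
          f g)}"

definition lie_deriv ::
  "real^'m::finite^'m \<Rightarrow> (real^'m^'m \<Rightarrow> complex) \<Rightarrow> real^'m^'m \<Rightarrow> complex" where
  "lie_deriv X f g = vector_derivative (\<lambda>t. f (mexp (- t *\<^sub>R X) ** g)) (at 0)"

definition lie_act :: "setting \<Rightarrow> (nat \<Rightarrow> 'm::finite) \<Rightarrow> complex^'m^'m \<Rightarrow>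
    (real^'m^'m \<Rightarrow> complex) \<Rightarrow> real^'m^'m \<Rightarrow> complex" where
  "lie_act s e Z f g = (if g \<in> G_grp s e
     then lie_deriv (cmat_Re Z) f g + \<i> * lie_deriv (cmat_Im Z) f g else 0)"

definition principal_series :: "setting \<Rightarrow> (nat \<Rightarrow> 'm::finite) \<Rightarrow> nat \<Rightarrow> (nat \<Rightarrow> complex) \<Rightarrow>
    (complex^'m^'m, real^'m^'m \<Rightarrow> complex) rep" where
  "principal_series s e k \<nu> =
    \<lparr> vecs = ps_space s e k \<nu>, vzero = 0, vadd = (+), vscale = (\<lambda>c f g. c * f g),
      vact = lie_act s e \<rparr>"

section \<open>The functors\<close>

text \<open>\<open>{p+1..p+q}\<close> indexes the second block.  For \<open>Sp\<^sub>2\<^sub>n\<close>, an element of \<open>K\<close> with upper blocks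
  \<open>A, B\<close> corresponds to \<open>A - iB \<in> U(n)\<close>, so that \<open>\<xi>\<close> corresponds to the identity matrix.\<close>

fun mu_up :: "setting \<Rightarrow> (nat \<Rightarrow> 'm::finite) \<Rightarrow> real^'m^'m \<Rightarrow> complex" where
  "mu_up (Sp n) e g = 1"
| "mu_up (O1 p q) e g = det_on {p+1..p+q} (entry e g)"
| "mu_up (O2 p q) e g = det_on {1..p} (entry e g)"

fun mu_low :: "setting \<Rightarrow> (nat \<Rightarrow> 'm::finite) \<Rightarrow> real^'m^'m \<Rightarrow> complex" where
  "mu_low (Sp n) e g = det_on {1..n} (\<lambda>i j. entry e g i j - \<i> * entry e g i (n + j))"
| "mu_low (O1 p q) e g = 1"
| "mu_low (O2 p q) e g = det_on {1..p} (entry e g) * det_on {p+1..p+q} (entry e g)"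

text \<open>\<open>X \<otimes> V\<^sup>\<otimes>\<^sup>l\<close> as families of elements of \<open>X\<close> indexed by the standard basis of \<open>V\<^sup>\<otimes>\<^sup>l\<close>, i.e.
  by lists \<open>J\<close> of length \<open>l\<close>; the \<open>i\<close>-th tensor factor is the list position \<open>i - 1\<close>.\<close>

type_synonym 'm tens = "'m list \<Rightarrow> real^'m^'m \<Rightarrow> complex"

definition tensors :: "(real^'m::finite^'m \<Rightarrow> complex) set \<Rightarrow> nat \<Rightarrow> 'm tens set" where
  "tensors X l = {t. (\<forall>J. length J = l \<longrightarrow> t J \<in> X) \<and> (\<forall>J. length J \<noteq> l \<longrightarrow> t J = 0)}"

definition K_act :: "real^'m::finite^'m \<Rightarrow> 'm tens \<Rightarrow> 'm tens" where
  "K_act \<kappa> t J g = (\<Sum>J' | length J' = length J.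
     (\<Prod>i<length J. cmat_of \<kappa> $ (J ! i) $ (J' ! i)) * t J' (matrix_inv \<kappa> ** g))"

definition V_leg :: "nat \<Rightarrow> complex^'m::finite^'m \<Rightarrow> 'm tens \<Rightarrow> 'm tens" where
  "V_leg i Z t J g = (\<Sum>a\<in>UNIV. Z $ (J ! (i - 1)) $ a * t (J[i - 1 := a]) g)"

definition leg :: "setting \<Rightarrow> (nat \<Rightarrow> 'm::finite) \<Rightarrow> nat \<Rightarrow> complex^'m^'m \<Rightarrow> 'm tens \<Rightarrow> 'm tens" where
  "leg s e i Z t = (if i = 0 then (\<lambda>J. lie_act s e Z (t J)) else V_leg i Z t)"

text \<open>Exchanges the factors \<open>i\<close> and \<open>i + 1\<close>.\<close>

definition flip_op :: "nat \<Rightarrow> 'm::finite tens \<Rightarrow> 'm tens" where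
  "flip_op i t J = t (J[i - 1 := J ! i, i := J ! (i - 1)])"

text \<open>Two sets of normalizing constants.  \<open>Stated\<close> is the list in the source: \<open>\<Omega>\<close> from the Killing
  form, \<open>s\<^sub>i\<^sub>,\<^sub>i\<^sub>+\<^sub>1 \<epsilon>\<^sub>i - \<epsilon>\<^sub>i\<^sub>+\<^sub>1 s\<^sub>i\<^sub>,\<^sub>i\<^sub>+\<^sub>1 = 1\<close>, and for \<open>O(p,q)\<close> \<open>c = (p-q)/2\<close>, \<open>r = (p+q)/2\<close>.  The operators
  \<open>z\<^sub>i - r\<close>, \<open>\<sigma>\<^sub>i\<^sub>,\<^sub>i\<^sub>+\<^sub>1\<close>, \<open>(\<xi>)\<^sub>i\<close> do not satisfy the Hecke relations for these constants verbatim.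
  On \<open>V \<otimes> V\<close>, the form \<open>tr(xy)/2\<close>, for which the \<open>a\<^sub>i\<close> are orthonormal, has
  \<open>\<Omega> = flip\<close> up to a contraction, which forces \<open>-1\<close> on the right; and \<open>(\<xi>)\<^sub>l\<close> then forces
  \<open>c = (q-p)/2\<close>, \<open>r = 1 - (p+q)/2\<close> for \<open>O(p,q)\<close>, and leaves \<open>c\<close>, \<open>r\<close> unchanged
  for \<open>Sp\<^sub>2\<^sub>n\<close>.  \<open>Consistent\<close> is this second list.\<close>

datatype normalization = Stated | Consistent

text \<open>\<open>Consistent\<close>: the Killing form is \<open>4(n+1)\<close>, resp. \<open>2(p+q-2)\<close>, times \<open>tr(xy)/2\<close>.\<close>

fun form_scale :: "normalization \<Rightarrow> setting \<Rightarrow> complex" where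
  "form_scale Stated s = 1"
| "form_scale Consistent (Sp n) = 1 / (4 * (of_nat n + 1))"
| "form_scale Consistent (O1 p q) = 1 / (2 * (of_nat p + of_nat q - 2))"
| "form_scale Consistent (O2 p q) = 1 / (2 * (of_nat p + of_nat q - 2))"

fun braid_const :: "normalization \<Rightarrow> complex" where
  "braid_const Stated = 1"
| "braid_const Consistent = - 1"

definition c_orth :: "normalization \<Rightarrow> nat \<Rightarrow> nat \<Rightarrow> complex" where
  "c_orth nm p q = (case nm of Stated \<Rightarrow> (of_nat p - of_nat q) / 2
                             | Consistent \<Rightarrow> (of_nat q - of_nat p) / 2)"

fun c_up :: "normalization \<Rightarrow> setting \<Rightarrow> complex" where
  "c_up nm (Sp n) = 0"
| "c_up nm (O1 p q) = c_orth nm p q"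
| "c_up nm (O2 p q) = c_orth nm p q"

fun c_low :: "normalization \<Rightarrow> setting \<Rightarrow> complex" where
  "c_low nm (Sp n) = 1"
| "c_low nm (O1 p q) = c_orth nm p q"
| "c_low nm (O2 p q) = c_orth nm p q"

definition r_orth :: "normalization \<Rightarrow> nat \<Rightarrow> nat \<Rightarrow> complex" where
  "r_orth nm p q = (case nm of Stated \<Rightarrow> (of_nat p + of_nat q) / 2
                             | Consistent \<Rightarrow> 1 - (of_nat p + of_nat q) / 2)"

fun r_const :: "normalization \<Rightarrow> setting \<Rightarrow> complex" where
  "r_const nm (Sp n) = - of_nat n"
| "r_const nm (O1 p q) = r_orth nm p q"
| "r_const nm (O2 p q) = r_orth nm p q"

definition lie_bracket :: "complex^'m::finite^'m \<Rightarrow> complex^'m^'m \<Rightarrow> complex^'m^'m" where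
  "lie_bracket x y = x ** y - y ** x"

definition is_lie_basis :: "setting \<Rightarrow> (nat \<Rightarrow> 'm::finite) \<Rightarrow> (complex^'m^'m) set \<Rightarrow> bool" where
  "is_lie_basis s e B \<longleftrightarrow> finite B \<and> cmat.independent B \<and> cmat.span B = g_cpx s e"

text \<open>The trace of \<open>ad x \<circ> ad y\<close>, computed in the basis \<open>B\<close>.\<close>

definition killing :: "(complex^'m::finite^'m) set \<Rightarrow> complex^'m^'m \<Rightarrow> complex^'m^'m \<Rightarrow> complex" where
  "killing B x y = (\<Sum>b\<in>B. cmat.representation B (lie_bracket x (lie_bracket y b)) b)"

definition dual_elt :: "normalization \<Rightarrow> setting \<Rightarrow> (nat \<Rightarrow> 'm::finite) \<Rightarrow>
    (complex^'m^'m) set \<Rightarrow> complex^'m^'m \<Rightarrow> complex^'m^'m" where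
  "dual_elt nm s e B b = (THE y. y \<in> g_cpx s e \<and>
     (\<forall>b'\<in>B. form_scale nm s * killing B b' y = (if b' = b then 1 else 0)))"

definition Omega :: "normalization \<Rightarrow> setting \<Rightarrow> (nat \<Rightarrow> 'm::finite) \<Rightarrow>
    (complex^'m^'m) set \<Rightarrow> nat \<Rightarrow> nat \<Rightarrow> 'm tens \<Rightarrow> 'm tens" where
  "Omega nm s e B i j t = (\<Sum>b\<in>B. leg s e i b (leg s e j (dual_elt nm s e B b) t))"

definition z_op :: "normalization \<Rightarrow> setting \<Rightarrow> (nat \<Rightarrow> 'm::finite) \<Rightarrow>
    (complex^'m^'m) set \<Rightarrow> nat \<Rightarrow> 'm tens \<Rightarrow> 'm tens" where
  "z_op nm s e B i t = (\<Sum>j<i. Omega nm s e B j i t)"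

definition F_hom :: "setting \<Rightarrow> (nat \<Rightarrow> 'm::finite) \<Rightarrow> (real^'m^'m \<Rightarrow> complex) set \<Rightarrow>
    (real^'m^'m \<Rightarrow> complex) \<Rightarrow> nat \<Rightarrow> (complex \<Rightarrow> 'm tens) set" where
  "F_hom s e X \<mu> l = {\<phi>. (\<forall>x. \<phi> x \<in> tensors X l) \<and>
     (\<forall>a b x y. \<phi> (a * x + b * y) = (\<lambda>J g. a * \<phi> x J g + b * \<phi> y J g)) \<and>
     (\<forall>\<kappa>\<in>K_grp s e. \<forall>x. \<phi> (\<mu> \<kappa> * x) = K_act \<kappa> (\<phi> x))}"

section \<open>The Hecke algebra\<close>

text \<open>\<open>W(B\<^sub>l)\<close> as the odd permutations of \<open>{-l..l}\<close>.\<close>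

definition W_grp :: "nat \<Rightarrow> (int \<Rightarrow> int) set" where
  "W_grp l = {w. w permutes {- int l..int l} \<and> (\<forall>j. w (- j) = - w j)}"

definition s_adj :: "nat \<Rightarrow> int \<Rightarrow> int" where
  "s_adj i = Transposition.transpose (int i) (int i + 1) \<circ>
             Transposition.transpose (- int i) (- int i - 1)"

definition s_eps :: "nat \<Rightarrow> int \<Rightarrow> int" where
  "s_eps j = Transposition.transpose (int j) (- int j)"

definition w_longest :: "nat \<Rightarrow> int \<Rightarrow> int" where
  "w_longest l = fold (\<lambda>j w. w \<circ> s_eps j) [1..<Suc l] id"

text \<open>The algebra is presented as the quotient of the free algebra on letters \<open>\<epsilon>\<^sub>i\<close> and \<open>t\<^sub>w\<close>
  (\<open>w \<in> W(B\<^sub>l)\<close>) by a two-sided ideal.  Elements of the free algebra are finitely supported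
  functions on words.\<close>

datatype hletter = Eps nat | Grp "int \<Rightarrow> int"

type_synonym fa = "hletter list \<Rightarrow> complex"

definition letters :: "nat \<Rightarrow> hletter set" where
  "letters l = Eps ` {1..l} \<union> Grp ` W_grp l"

definition fa_carrier :: "nat \<Rightarrow> fa set" where
  "fa_carrier l = {u. finite {x. u x \<noteq> 0} \<and> (\<forall>x. u x \<noteq> 0 \<longrightarrow> set x \<subseteq> letters l)}"

definition fa_mult :: "fa \<Rightarrow> fa \<Rightarrow> fa" where
  "fa_mult u v x = (\<Sum>i\<le>length x. u (take i x) * v (drop i x))"

definition word :: "hletter list \<Rightarrow> fa" where
  "word x y = (if y = x then 1 else 0)"

definition fa_const :: "complex \<Rightarrow> fa" where
  "fa_const a y = a * word [] y"

definition fa_rep :: "nat \<Rightarrow> (fa, fa) rep" where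
  "fa_rep l = \<lparr> vecs = fa_carrier l, vzero = 0, vadd = (+), vscale = (\<lambda>a u x. a * u x),
                vact = fa_mult \<rparr>"

definition hecke_relations :: "complex \<Rightarrow> complex \<Rightarrow> nat \<Rightarrow> fa set" where
  "hecke_relations b c l =
     {word [Eps i, Eps j] - word [Eps j, Eps i] | i j. i \<in> {1..l} \<and> j \<in> {1..l}}
   \<union> {word [Grp v, Grp w] - word [Grp (v \<circ> w)] | v w. v \<in> W_grp l \<and> w \<in> W_grp l}
   \<union> {word [Grp id] - word []}
   \<union> {word [Grp (s_adj i), Eps i] - word [Eps (i + 1), Grp (s_adj i)] - fa_const b
        | i. i \<in> {1..<l}}
   \<union> {word [Grp (s_adj i), Eps j] - word [Eps j, Grp (s_adj i)]
        | i j. i \<in> {1..<l} \<and> j \<in> {1..l} \<and> j \<noteq> i \<and> j \<noteq> i + 1}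
   \<union> (if 1 \<le> l then {word [Grp (s_eps l), Eps l] + word [Eps l, Grp (s_eps l)] - fa_const (2 * c)} else {})
   \<union> {word [Grp (s_eps l), Eps j] - word [Eps j, Grp (s_eps l)] | j. j \<in> {1..l} \<and> j \<noteq> l}"

definition hecke_ideal :: "complex \<Rightarrow> complex \<Rightarrow> nat \<Rightarrow> fa set" where
  "hecke_ideal b c l = rep_span (fa_rep l)
     {fa_mult (fa_mult u r) v | u r v. u \<in> fa_carrier l \<and> r \<in> hecke_relations b c l \<and> v \<in> fa_carrier l}"

text \<open>Elements of \<open>\<bbbH>\<^sub>l(c)\<close> are cosets; \<open>b\<close> is the right-hand side of the relation between
  \<open>s\<^sub>i\<^sub>,\<^sub>i\<^sub>+\<^sub>1\<close> and \<open>\<epsilon>\<^sub>i\<close>.\<close>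

definition hecke_elt :: "complex \<Rightarrow> complex \<Rightarrow> nat \<Rightarrow> fa \<Rightarrow> fa set" where
  "hecke_elt b c l u = coset (fa_rep l) (hecke_ideal b c l) u"

definition hecke_alg :: "complex \<Rightarrow> complex \<Rightarrow> nat \<Rightarrow> fa set set" where
  "hecke_alg b c l = hecke_elt b c l ` fa_carrier l"

definition hecke_mult :: "complex \<Rightarrow> complex \<Rightarrow> nat \<Rightarrow> fa set \<Rightarrow> fa set \<Rightarrow> fa set" where
  "hecke_mult b c l A C = {fa_mult u v + r | u v r. u \<in> A \<and> v \<in> C \<and> r \<in> hecke_ideal b c l}"

definition hecke_regular :: "complex \<Rightarrow> complex \<Rightarrow> nat \<Rightarrow> (fa set, fa set) rep" where
  "hecke_regular b c l =
    \<lparr> vecs = hecke_alg b c l,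
      vzero = vzero (quotient_rep (fa_rep l) (hecke_ideal b c l)),
      vadd = vadd (quotient_rep (fa_rep l) (hecke_ideal b c l)),
      vscale = vscale (quotient_rep (fa_rep l) (hecke_ideal b c l)),
      vact = hecke_mult b c l \<rparr>"

definition hecke_eps :: "complex \<Rightarrow> complex \<Rightarrow> nat \<Rightarrow> nat \<Rightarrow> fa set" where
  "hecke_eps b c l i = hecke_elt b c l (word [Eps i])"

definition hecke_grp :: "complex \<Rightarrow> complex \<Rightarrow> nat \<Rightarrow> (int \<Rightarrow> int) \<Rightarrow> fa set" where
  "hecke_grp b c l w = hecke_elt b c l (word [Grp w])"

text \<open>The involution \<open>\<bullet>\<close>, first on the free algebra.  Letters \<open>t\<^sub>w\<close> with \<open>w\<close> not bijective, which do
  not occur in \<^const>\<open>letters\<close>, are fixed, so that \<open>\<bullet>\<close> is an involution on all words.\<close>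

fun letter_bullet :: "hletter \<Rightarrow> hletter" where
  "letter_bullet (Eps i) = Eps i"
| "letter_bullet (Grp w) = Grp (if bij w then inv w else w)"

definition fa_bullet :: "fa \<Rightarrow> fa" where
  "fa_bullet u x = cnj (u (rev (map letter_bullet x)))"

definition hecke_bullet :: "fa set \<Rightarrow> fa set" where
  "hecke_bullet A = fa_bullet ` A"

definition hecke_star :: "complex \<Rightarrow> complex \<Rightarrow> nat \<Rightarrow> fa set \<Rightarrow> fa set" where
  "hecke_star b c l A = hecke_mult b c l
     (hecke_mult b c l (hecke_grp b c l (w_longest l)) (hecke_bullet A))
     (hecke_grp b c l (w_longest l))"

text \<open>\<open>H \<otimes>\<^sub>S \<complex>\<^sub>\<nu> = H / span {h s - \<nu>(s) h}\<close>, where \<open>s\<close> runs over the monomials in \<open>\<epsilon>\<^sub>1, \<dots>, \<epsilon>\<^sub>l\<close>.\<close>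

definition induced_module ::
  "complex \<Rightarrow> complex \<Rightarrow> nat \<Rightarrow> (nat \<Rightarrow> complex) \<Rightarrow> (fa set, fa set set) rep" where
  "induced_module b c l \<nu> = (let H = hecke_regular b c l in
     quotient_rep H (rep_span H
       {vadd H (hecke_mult b c l h (hecke_elt b c l (word (map Eps js))))
               (vscale H (- prod_list (map \<nu> js)) h)
        | h js. h \<in> hecke_alg b c l \<and> set js \<subseteq> {1..l}}))"

text \<open>\<open>\<Phi>\<close> is an isomorphism of the induced module with \<open>F\<^sub>\<mu>\<^sub>,\<^sub>l(X)\<close>, on which \<open>\<epsilon>\<^sub>i\<close>, \<open>s\<^sub>i\<^sub>,\<^sub>i\<^sub>+\<^sub>1\<close>, \<open>s\<^sub>\<epsilon>\<^sub>i\<close>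
  act by \<open>z\<^sub>i - r\<close>, \<open>\<sigma>\<^sub>i\<^sub>,\<^sub>i\<^sub>+\<^sub>1\<close>, \<open>(\<xi>)\<^sub>i\<close>.  These elements generate the algebra.\<close>

definition hecke_iso :: "normalization \<Rightarrow> setting \<Rightarrow> (nat \<Rightarrow> 'm::finite) \<Rightarrow> (complex^'m^'m) set \<Rightarrow>
    (real^'m^'m \<Rightarrow> complex) set \<Rightarrow> (real^'m^'m \<Rightarrow> complex) \<Rightarrow> complex \<Rightarrow> nat \<Rightarrow> (nat \<Rightarrow> complex) \<Rightarrow>
    (fa set set \<Rightarrow> complex \<Rightarrow> 'm tens) \<Rightarrow> bool" where
  "hecke_iso nm s e B X \<mu> c l \<nu> \<Phi> \<longleftrightarrow>
    (let b = braid_const nm; Y = induced_module b c l \<nu> in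
     bij_betw \<Phi> (vecs Y) (F_hom s e X \<mu> l) \<and>
     (\<forall>x\<in>vecs Y. \<forall>y\<in>vecs Y. \<forall>a a'. \<Phi> (vadd Y (vscale Y a x) (vscale Y a' y)) =
        (\<lambda>u J g. a * \<Phi> x u J g + a' * \<Phi> y u J g)) \<and>
     (\<forall>x\<in>vecs Y. \<forall>i\<in>{1..l}. \<Phi> (vact Y (hecke_eps b c l i) x) =
        (\<lambda>u J g. z_op nm s e B i (\<Phi> x u) J g - r_const nm s * \<Phi> x u J g)) \<and>
     (\<forall>x\<in>vecs Y. \<forall>i\<in>{1..<l}. \<Phi> (vact Y (hecke_grp b c l (s_adj i)) x) =
        (\<lambda>u. flip_op i (\<Phi> x u))) \<and>
     (\<forall>x\<in>vecs Y. \<forall>i\<in>{1..l}. \<Phi> (vact Y (hecke_grp b c l (s_eps i)) x) =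
        (\<lambda>u. V_leg i (xi s e) (\<Phi> x u))))"

section \<open>Forms on the functor images\<close>

definition V_rep :: "(complex^'m::finite^'m, complex^'m) rep" where
  "V_rep = \<lparr> vecs = UNIV, vzero = 0, vadd = (+), vscale = (*s), vact = (*v) \<rparr>"

definition is_V_form ::
  "setting \<Rightarrow> (nat \<Rightarrow> 'm::finite) \<Rightarrow> (complex^'m \<Rightarrow> complex^'m \<Rightarrow> complex) \<Rightarrow> bool" where
  "is_V_form s e hV \<longleftrightarrow> hermitian_form V_rep hV \<and> positive_definite V_rep hV \<and>
     (\<forall>\<kappa>\<in>K_grp s e. \<forall>v w. hV (cmat_of \<kappa> *v v) w = hV v (cmat_of (matrix_inv \<kappa>) *v w)) \<and>
     (\<forall>X\<in>p0 s e. \<forall>v w. hV (cmat_of X *v v) w = hV v (cmat_of X *v w))"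

definition tensor_form :: "nat \<Rightarrow> ((real^'m::finite^'m \<Rightarrow> complex) \<Rightarrow> (real^'m^'m \<Rightarrow> complex) \<Rightarrow> complex) \<Rightarrow>
    (complex^'m \<Rightarrow> complex^'m \<Rightarrow> complex) \<Rightarrow> 'm tens \<Rightarrow> 'm tens \<Rightarrow> complex" where
  "tensor_form l hX hV t t' = (\<Sum>J | length J = l. \<Sum>J' | length J' = l.
     hX (t J) (t' J') * (\<Prod>i<l. hV (axis (J ! i) 1) (axis (J' ! i) 1)))"

definition F_form :: "nat \<Rightarrow> ((real^'m::finite^'m \<Rightarrow> complex) \<Rightarrow> (real^'m^'m \<Rightarrow> complex) \<Rightarrow> complex) \<Rightarrow>
    (complex^'m \<Rightarrow> complex^'m \<Rightarrow> complex) \<Rightarrow>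
    (complex \<Rightarrow> 'm tens) \<Rightarrow> (complex \<Rightarrow> 'm tens) \<Rightarrow> complex" where
  "F_form l hX hV \<phi> \<psi> = tensor_form l hX hV (\<phi> 1) (\<psi> 1)"

text \<open>The Langlands quotient of the induced module, formed with the form on \<open>F\<^sub>\<mu>\<^sub>,\<^sub>l(X)\<close>
  transported along \<open>\<Phi>\<close>.\<close>

definition hecke_langlands_quotient :: "complex \<Rightarrow> complex \<Rightarrow> nat \<Rightarrow> (nat \<Rightarrow> complex) \<Rightarrow>
    (fa set set \<Rightarrow> complex \<Rightarrow> 'm::finite tens) \<Rightarrow>
    ((real^'m^'m \<Rightarrow> complex) \<Rightarrow> (real^'m^'m \<Rightarrow> complex) \<Rightarrow> complex) \<Rightarrow>
    (complex^'m \<Rightarrow> complex^'m \<Rightarrow> complex) \<Rightarrow> (fa set, fa set set set) rep" where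
  "hecke_langlands_quotient b c l \<nu> \<Phi> hX hV =
     langlands_quotient (induced_module b c l \<nu>) (\<lambda>x y. F_form l hX hV (\<Phi> x) (\<Phi> y))"

end

theory Submission
  imports Defs
begin

text \<open>Suppose that the quotient of \<open>X = X\<^sub>\<delta>\<^sup>\<nu>\<close> by the radical of its form \<open>h\<close> has a positive definite
  invariant form, and pull it back to a positive semidefinite form \<open>f\<close> on \<open>X\<close>.  Every invariant form
  on \<open>X\<close> induces an invariant form on \<open>F\<^sub>\<mu>\<^sub>,\<^sub>l(X)\<close>: since \<open>- \<xi> Z \<xi>\<close> is the transpose of \<open>Z \<in> \<gg>\<close>, the adjoint of
  \<open>\<Omega>\<^sub>j\<^sub>i\<close> is its conjugate by \<open>(\<xi>)\<^sub>1 \<dots> (\<xi>)\<^sub>l\<close>, the action of \<open>w\<^sub>0\<close>, provided that \<open>\<Omega>\<close> is real.  It is,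
  because it does not depend on the basis and \<open>\<gg>\<close> is spanned by the projections of the real matrix units.
  The form induced by \<open>f\<close> is positive semidefinite, and its null vectors lie in the radical of the form
  induced by \<open>h\<close>, because \<open>f\<close> and \<open>h\<close> have the same radical on \<open>X\<close>.  Since the Hecke module is finite
  dimensional, spanned by \<open>W(B\<^sub>l)\<close>, the orthogonal complement of that radical carries a positive
  definite form, so the Langlands quotient of the Hecke module is unitary.  Equality of the two radicals
  on the Hecke module may fail, as \<open>h\<close> need not be invariant under the disconnected group \<open>K\<close>.\<close>

section \<open>Quotients of representations\<close>

text \<open>The isomorphism \<open>\<Phi>\<close> is part of the hypothesis, so the analysis below
  has one aim: the Lie algebra maps \<open>ps_space\<close> to itself. Otherwise an operator with
  leg 0 could leave the space on which the forms are sesquilinear, and no adjoint could be taken.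
  The adjoint computation sees the constants \<open>b\<close>, \<open>c\<close>, \<open>r\<close>
  only through their being real, and the scale of \<open>Omega\<close> through being real and
  nonzero, which is why both normalizations are treated at once. The forms \<open>f\<close> and
  \<open>h\<close> are compared through contractions: factoring the Gram matrix of \<open>V\<close>
  writes each product form as a sum of values on finitely many elements of \<open>X\<close>, the
  same elements for both forms. The remaining obstacle is that the form induced by \<open>f\<close>
  may be nonzero on the radical of the one induced by \<open>h\<close>, and then does not descend to
  the quotient. It is evaluated instead on representatives orthogonal to that radical. Finite
  dimension makes them exist although the form is only semidefinite; they need not be unique, but
  the values on them are.\<close>

locale cspace =
  fixes Y :: "('h, 'v) rep"
  assumes zero_mem: "vzero Y \<in> vecs Y"
    and add_mem: "\<lbrakk>x \<in> vecs Y; y \<in> vecs Y\<rbrakk> \<Longrightarrow> vadd Y x y \<in> vecs Y"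
    and scale_mem: "x \<in> vecs Y \<Longrightarrow> vscale Y a x \<in> vecs Y"
    and add_assoc: "\<lbrakk>x \<in> vecs Y; y \<in> vecs Y; z \<in> vecs Y\<rbrakk> \<Longrightarrow> vadd Y (vadd Y x y) z = vadd Y x (vadd Y y z)"
    and add_commute: "\<lbrakk>x \<in> vecs Y; y \<in> vecs Y\<rbrakk> \<Longrightarrow> vadd Y x y = vadd Y y x"
    and add_zero: "x \<in> vecs Y \<Longrightarrow> vadd Y x (vzero Y) = x"
    and scale_zero: "x \<in> vecs Y \<Longrightarrow> vscale Y 0 x = vzero Y"
    and scale_one: "x \<in> vecs Y \<Longrightarrow> vscale Y 1 x = x"
    and scale_scale: "x \<in> vecs Y \<Longrightarrow> vscale Y a (vscale Y b x) = vscale Y (a * b) x"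
    and scale_add: "\<lbrakk>x \<in> vecs Y; y \<in> vecs Y\<rbrakk> \<Longrightarrow> vscale Y a (vadd Y x y) = vadd Y (vscale Y a x) (vscale Y a y)"
    and add_scale: "x \<in> vecs Y \<Longrightarrow> vadd Y (vscale Y a x) (vscale Y b x) = vscale Y (a + b) x"
begin

abbreviation minus where "minus x y \<equiv> vadd Y x (vscale Y (-1) y)"

lemma minus_mem: "\<lbrakk>x \<in> vecs Y; y \<in> vecs Y\<rbrakk> \<Longrightarrow> minus x y \<in> vecs Y"
  by (simp add: add_mem scale_mem)

lemma add_left_commute:
  "\<lbrakk>x \<in> vecs Y; y \<in> vecs Y; z \<in> vecs Y\<rbrakk> \<Longrightarrow> vadd Y x (vadd Y y z) = vadd Y y (vadd Y x z)"
  by (metis add_assoc add_commute)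

lemmas add_ac = add_assoc add_commute add_left_commute

lemma minus_self: "x \<in> vecs Y \<Longrightarrow> minus x x = vzero Y"
  using add_scale[of x 1 "-1"] by (simp add: scale_one scale_zero)

lemma zero_add: "x \<in> vecs Y \<Longrightarrow> vadd Y (vzero Y) x = x"
  by (simp add: add_commute add_zero zero_mem)

lemma scale_vzero: "vscale Y a (vzero Y) = vzero Y"
  using scale_scale[of "vzero Y" a 0] by (simp add: scale_zero zero_mem)

lemma add_minus_cancel: "\<lbrakk>x \<in> vecs Y; y \<in> vecs Y\<rbrakk> \<Longrightarrow> vadd Y y (minus x y) = x"
  by (metis add_left_commute add_zero minus_self scale_mem)

lemma minus_add_cancel: "\<lbrakk>x \<in> vecs Y; y \<in> vecs Y\<rbrakk> \<Longrightarrow> minus (vadd Y y x) y = x"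
  by (metis add_assoc add_commute add_minus_cancel add_mem scale_mem)

lemma add_add_swap:
  "\<lbrakk>x \<in> vecs Y; y \<in> vecs Y; z \<in> vecs Y; w \<in> vecs Y\<rbrakk> \<Longrightarrow>
    vadd Y (vadd Y x y) (vadd Y z w) = vadd Y (vadd Y x z) (vadd Y y w)"
  by (simp add: add_ac add_mem)

end

locale csubspace = cspace +
  fixes R
  assumes sub: "R \<subseteq> vecs Y"
    and sub_zero: "vzero Y \<in> R"
    and sub_comb: "\<lbrakk>x \<in> R; y \<in> R\<rbrakk> \<Longrightarrow> vadd Y (vscale Y a x) (vscale Y b y) \<in> R"
begin

lemma sub_mem: "x \<in> R \<Longrightarrow> x \<in> vecs Y" using sub by blast

lemma sub_add: "\<lbrakk>x \<in> R; y \<in> R\<rbrakk> \<Longrightarrow> vadd Y x y \<in> R"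
  using sub_comb[of x y 1 1] by (simp add: sub_mem scale_one)

lemma sub_scale: "x \<in> R \<Longrightarrow> vscale Y a x \<in> R"
  using sub_comb[of x "vzero Y" a 0] by (simp add: sub_zero sub_mem scale_vzero add_zero scale_mem)

abbreviation Q where "Q \<equiv> quotient_rep Y R"

lemma coset_self: "x \<in> vecs Y \<Longrightarrow> x \<in> coset Y R x"
  unfolding coset_def using sub_zero add_zero by (metis imageI)

lemma coset_mem: "\<lbrakk>x \<in> vecs Y; y \<in> coset Y R x\<rbrakk> \<Longrightarrow> y \<in> vecs Y \<and> minus y x \<in> R"
  unfolding coset_def using add_mem sub_mem minus_add_cancel by auto

lemma coset_add_right: "\<lbrakk>x \<in> vecs Y; r \<in> R\<rbrakk> \<Longrightarrow> coset Y R (vadd Y x r) = coset Y R x"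
  unfolding coset_def
proof (intro equalityI subsetI; elim imageE)
  fix z r' assume *: "x \<in> vecs Y" "r \<in> R" "z = vadd Y (vadd Y x r) r'" "r' \<in> R"
  then have "z = vadd Y x (vadd Y r r')" by (simp add: add_assoc sub_mem)
  then show "z \<in> vadd Y x ` R" using * sub_add by blast
next
  fix z r' assume *: "x \<in> vecs Y" "r \<in> R" "z = vadd Y x r'" "r' \<in> R"
  then have "z = vadd Y (vadd Y x r) (minus r' r)"
    by (simp add: add_assoc sub_mem minus_mem add_minus_cancel)
  then show "z \<in> vadd Y (vadd Y x r) ` R" using * sub_add sub_scale by blast
qed

lemma coset_eq_iff: "\<lbrakk>x \<in> vecs Y; y \<in> vecs Y\<rbrakk> \<Longrightarrow> coset Y R x = coset Y R y \<longleftrightarrow> minus x y \<in> R"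
  by (metis add_minus_cancel coset_add_right coset_mem coset_self)

lemma coset_zero: "coset Y R (vzero Y) = R"
  unfolding coset_def using sub_mem zero_add by auto

lemma coset_eq_zero_iff: "x \<in> vecs Y \<Longrightarrow> coset Y R x = R \<longleftrightarrow> x \<in> R"
  using coset_eq_iff[of x "vzero Y"] by (simp add: coset_zero zero_mem scale_vzero add_zero)

lemma vecs_quotient: "vecs Q = coset Y R ` vecs Y"
  by (simp add: quotient_rep_def)

lemma vzero_quotient: "vzero Q = coset Y R (vzero Y)"
  by (simp add: quotient_rep_def coset_zero)

lemma vadd_quotient:
  assumes "x \<in> vecs Y" "y \<in> vecs Y"
  shows "vadd Q (coset Y R x) (coset Y R y) = coset Y R (vadd Y x y)"
proof -
  have "{vadd Y a c | a c. a \<in> coset Y R x \<and> c \<in> coset Y R y} = coset Y R (vadd Y x y)"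
  proof (intro equalityI subsetI)
    fix z assume "z \<in> {vadd Y a c | a c. a \<in> coset Y R x \<and> c \<in> coset Y R y}"
    then obtain r r' where "r \<in> R" "r' \<in> R" "z = vadd Y (vadd Y x r) (vadd Y y r')"
      unfolding coset_def by blast
    then have "z = vadd Y (vadd Y x y) (vadd Y r r')" "vadd Y r r' \<in> R"
      using assms by (simp_all add: add_add_swap sub_mem sub_add)
    then show "z \<in> coset Y R (vadd Y x y)"
      unfolding coset_def by blast
  next
    fix z assume "z \<in> coset Y R (vadd Y x y)"
    then obtain r where r: "r \<in> R" "z = vadd Y (vadd Y x y) r" unfolding coset_def by blast
    then have "z = vadd Y x (vadd Y y r)" using assms by (simp add: add_assoc sub_mem)
    moreover have "vadd Y y r \<in> coset Y R y" using r by (auto simp: coset_def)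
    ultimately show "z \<in> {vadd Y a c | a c. a \<in> coset Y R x \<and> c \<in> coset Y R y}"
      using coset_self[OF assms(1)] by blast
  qed
  then show ?thesis by (simp add: quotient_rep_def)
qed

text \<open>\<open>quotient_rep\<close> applies an operation to all representatives and then adds
  all of \<open>R\<close>, because the image of a coset alone may be smaller than a coset, for
  instance under multiplication by 0. Scalar multiplication and the action are both
  instances.\<close>

lemma map_coset:
  assumes x: "x \<in> vecs Y"
    and op_add: "\<And>x y. \<lbrakk>x \<in> vecs Y; y \<in> vecs Y\<rbrakk> \<Longrightarrow> op (vadd Y x y) = vadd Y (op x) (op y)"
    and op_mem: "\<And>x. x \<in> vecs Y \<Longrightarrow> op x \<in> vecs Y"
    and op_sub: "\<And>x. x \<in> R \<Longrightarrow> op x \<in> R"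
  shows "{vadd Y (op a) r | a r. a \<in> coset Y R x \<and> r \<in> R} = coset Y R (op x)"
proof (intro equalityI subsetI)
  fix z assume "z \<in> {vadd Y (op a) r | a r. a \<in> coset Y R x \<and> r \<in> R}"
  then obtain r r' where r: "r \<in> R" "r' \<in> R" "z = vadd Y (op (vadd Y x r)) r'"
    unfolding coset_def by blast
  then have "z = vadd Y (op x) (vadd Y (op r) r')"
    using x op_add op_mem by (simp add: sub_mem add_assoc)
  then show "z \<in> coset Y R (op x)" unfolding coset_def using r op_sub sub_add by blast
next
  fix z assume "z \<in> coset Y R (op x)"
  then show "z \<in> {vadd Y (op a) r | a r. a \<in> coset Y R x \<and> r \<in> R}"
    unfolding coset_def[of _ _ "op x"] using coset_self[OF x] by blast
qed

lemma vscale_quotient: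
  assumes "x \<in> vecs Y"
  shows "vscale Q a (coset Y R x) = coset Y R (vscale Y a x)"
  using map_coset[of x "vscale Y a"] assms
  by (simp add: quotient_rep_def scale_add scale_mem sub_scale)

lemma vact_quotient:
  assumes "x \<in> vecs Y"
    and "\<And>x y. \<lbrakk>x \<in> vecs Y; y \<in> vecs Y\<rbrakk> \<Longrightarrow> vact Y h (vadd Y x y) = vadd Y (vact Y h x) (vact Y h y)"
    and "\<And>x. x \<in> vecs Y \<Longrightarrow> vact Y h x \<in> vecs Y"
    and "\<And>x. x \<in> R \<Longrightarrow> vact Y h x \<in> R"
  shows "vact Q h (coset Y R x) = coset Y R (vact Y h x)"
  using map_coset[of x "vact Y h"] assms by (simp add: quotient_rep_def)

lemma cspace_quotient: "cspace Q"
proof (unfold_locales, goal_cases)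
  case (5 x y)
  then show ?case unfolding vecs_quotient by (elim imageE) (metis vadd_quotient add_commute)
qed (auto simp: vecs_quotient vzero_quotient vadd_quotient vscale_quotient zero_mem add_mem scale_mem
      add_assoc scale_add add_scale scale_scale scale_zero scale_one add_zero)

end

lemma rep_span_superset: "S \<subseteq> rep_span Y S"
  by (auto simp: rep_span_def)

lemma rep_span_zero: "vzero Y \<in> rep_span Y S"
  by (auto simp: rep_span_def)

lemma rep_span_comb:
  "\<lbrakk>x \<in> rep_span Y S; y \<in> rep_span Y S\<rbrakk> \<Longrightarrow> vadd Y (vscale Y a x) (vscale Y b y) \<in> rep_span Y S"
  by (auto simp: rep_span_def)

lemma rep_span_induct [consumes 1, case_names base zero comb]:
  assumes "x \<in> rep_span Y S"
    and "\<And>x. x \<in> S \<Longrightarrow> P x" "P (vzero Y)"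
    and "\<And>a b x y. \<lbrakk>P x; P y\<rbrakk> \<Longrightarrow> P (vadd Y (vscale Y a x) (vscale Y b y))"
  shows "P x"
proof -
  have "rep_span Y S \<subseteq> {x. P x}" unfolding rep_span_def using assms(2-) by (intro Inter_lower) auto
  then show ?thesis using assms(1) by blast
qed

lemma (in cspace) csubspace_rep_span: "S \<subseteq> vecs Y \<Longrightarrow> csubspace Y (rep_span Y S)"
proof (unfold_locales, rule subsetI)
  fix x assume "S \<subseteq> vecs Y" "x \<in> rep_span Y S"
  from this(2,1) show "x \<in> vecs Y"
    by (induction rule: rep_span_induct) (auto intro: zero_mem add_mem scale_mem)
qed (auto intro: rep_span_zero rep_span_comb)

section \<open>The free algebra\<close>

text \<open>Both triple products sum over the ways to cut \<open>x\<close> into three consecutive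
  pieces. The bracketings differ in which cut is chosen first, and
  \<open>sum.triangle_reindex_eq\<close> translates between the two.\<close>

lemma fa_mult_assoc: "fa_mult (fa_mult u v) w = fa_mult u (fa_mult v w)"
proof
  fix x :: "hletter list"
  let ?n = "length x"
  have "fa_mult (fa_mult u v) w x
      = (\<Sum>k\<le>?n. \<Sum>i\<le>k. u (take i x) * v (drop i (take k x)) * w (drop k x))"
    by (auto simp: fa_mult_def sum_distrib_right intro!: sum.cong)
  also have "\<dots> = (\<Sum>k\<le>?n. \<Sum>i\<le>k. u (take i x) * v (take (k - i) (drop i x)) * w (drop (k - i) (drop i x)))"
    by (intro sum.cong refl) (auto simp: drop_take)
  also have "\<dots> = (\<Sum>(i,j)\<in>{(i,j). i + j \<le> ?n}. u (take i x) * v (take j (drop i x)) * w (drop j (drop i x)))"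
    by (simp only: sum.triangle_reindex_eq)
  also have "{(i,j). i + j \<le> ?n} = Sigma {..?n} (\<lambda>i. {..?n - i})" by auto
  also have "(\<Sum>(i,j)\<in>\<dots>. u (take i x) * v (take j (drop i x)) * w (drop j (drop i x)))
      = fa_mult u (fa_mult v w) x"
    by (subst sum.Sigma[symmetric])
      (auto simp: fa_mult_def sum_distrib_left mult.assoc intro!: sum.cong)
  finally show "fa_mult (fa_mult u v) w x = fa_mult u (fa_mult v w) x" .
qed

lemma fa_mult_add_left: "fa_mult (u + v) w = fa_mult u w + fa_mult v w"
  by (rule ext) (simp add: fa_mult_def distrib_right sum.distrib)

lemma fa_mult_add_right: "fa_mult w (u + v) = fa_mult w u + fa_mult w v"
  by (rule ext) (simp add: fa_mult_def distrib_left sum.distrib)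

lemma fa_mult_scale_left: "fa_mult (\<lambda>x. a * u x) w = (\<lambda>x. a * fa_mult u w x)"
  by (rule ext) (simp add: fa_mult_def sum_distrib_left mult.assoc)

lemma fa_mult_scale_right: "fa_mult w (\<lambda>x. a * u x) = (\<lambda>x. a * fa_mult w u x)"
  by (rule ext) (simp add: fa_mult_def sum_distrib_left mult_ac)

lemma fa_mult_diff_left: "fa_mult (u - v) w = fa_mult u w - fa_mult v w"
  by (rule ext) (simp add: fa_mult_def left_diff_distrib sum_subtractf)

lemma fa_mult_diff_right: "fa_mult w (u - v) = fa_mult w u - fa_mult w v"
  by (rule ext) (simp add: fa_mult_def right_diff_distrib sum_subtractf)

text \<open>Among all cuts of \<open>z\<close> only the one at \<open>length x\<close> can
  contribute.\<close>

lemma fa_mult_word: "fa_mult (word x) (word y) = word (x @ y)"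
proof
  fix z
  have "word x (take i z) * word y (drop i z) = (if i = length x then word (x @ y) z else 0)"
    if "i \<le> length z" for i
  proof (cases "take i z = x \<and> drop i z = y")
    case True
    then have "z = x @ y" by (metis append_take_drop_id)
    moreover have "i = length x" using True that by (metis length_take min.absorb2)
    ultimately have "z = x @ y" "i = length x" .
    then show ?thesis by (simp add: word_def)
  next
    case False
    then have "word x (take i z) * word y (drop i z) = 0" by (simp add: word_def)
    moreover have "word (x @ y) z = 0" if "i = length x" using False that by (auto simp: word_def)
    ultimately show ?thesis by auto
  qed
  then have "fa_mult (word x) (word y) z = (\<Sum>i\<le>length z. if i = length x then word (x @ y) z else 0)"
    unfolding fa_mult_def by (intro sum.cong refl) auto
  also have "\<dots> = word (x @ y) z"
    by (auto simp: word_def)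
  finally show "fa_mult (word x) (word y) z = word (x @ y) z" .
qed

lemma fa_mult_one_left: "fa_mult (word []) u = u"
proof
  fix x
  have "fa_mult (word []) u x = (\<Sum>i\<le>length x. if i = 0 then u x else 0)"
    unfolding fa_mult_def by (intro sum.cong refl) (auto simp: word_def)
  then show "fa_mult (word []) u x = u x" by simp
qed

lemma fa_mult_one_right: "fa_mult u (word []) = u"
proof
  fix x
  have "fa_mult u (word []) x = (\<Sum>i\<le>length x. if i = length x then u x else 0)"
    unfolding fa_mult_def by (intro sum.cong refl) (auto simp: word_def)
  then show "fa_mult u (word []) x = u x" by simp
qed

lemma fa_const_word: "fa_const a = (\<lambda>x. a * word [] x)"
  by (rule ext) (simp add: fa_const_def)

lemma fa_carrier_zero: "0 \<in> fa_carrier l"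
  by (simp add: fa_carrier_def)

lemma fa_carrier_add: "\<lbrakk>u \<in> fa_carrier l; v \<in> fa_carrier l\<rbrakk> \<Longrightarrow> u + v \<in> fa_carrier l"
proof -
  assume uv: "u \<in> fa_carrier l" "v \<in> fa_carrier l"
  have "{x. (u + v) x \<noteq> 0} \<subseteq> {x. u x \<noteq> 0} \<union> {x. v x \<noteq> 0}" by auto
  moreover from uv have "finite ({x. u x \<noteq> 0} \<union> {x. v x \<noteq> 0})" by (simp add: fa_carrier_def)
  moreover from uv have "\<forall>x\<in>{x. u x \<noteq> 0} \<union> {x. v x \<noteq> 0}. set x \<subseteq> letters l"
    unfolding fa_carrier_def by blast
  ultimately show ?thesis unfolding fa_carrier_def using finite_subset by blast
qed

lemma fa_carrier_scale: "u \<in> fa_carrier l \<Longrightarrow> (\<lambda>x. a * u x) \<in> fa_carrier l"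
  unfolding fa_carrier_def by (auto intro: finite_subset[of _ "{x. u x \<noteq> 0}"])

lemma fa_carrier_word: "set x \<subseteq> letters l \<Longrightarrow> word x \<in> fa_carrier l"
  unfolding fa_carrier_def word_def by auto

text \<open>Induction on the support, splitting off one word with its coefficient. The single step
  \<open>a u + v\<close> is enough for every linear property proved below.\<close>

lemma fa_carrier_induct [consumes 1, case_names zero word comb]:
  assumes "u \<in> fa_carrier l" and "P 0"
    and "\<And>x. set x \<subseteq> letters l \<Longrightarrow> P (word x)"
    and "\<And>a u v. \<lbrakk>u \<in> fa_carrier l; v \<in> fa_carrier l; P u; P v\<rbrakk> \<Longrightarrow> P ((\<lambda>x. a * u x) + v)"
  shows "P u"
proof -
  have "finite {x. u x \<noteq> 0}" using assms(1) by (simp add: fa_carrier_def)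
  then show ?thesis using assms(1)
  proof (induction "{x. u x \<noteq> 0}" arbitrary: u rule: finite_induct)
    case empty
    then have "u = 0" by (auto simp: fun_eq_iff)
    then show ?case using assms(2) by blast
  next
    case (insert z S)
    define v where "v = u(z := 0)"
    have uv: "u = (\<lambda>x. u z * word z x) + v"
      by (auto simp: v_def word_def fun_eq_iff)
    have "{x. v x \<noteq> 0} = {x. u x \<noteq> 0} - {z}" by (auto simp: v_def)
    then have S: "S = {x. v x \<noteq> 0}" using insert(2) unfolding insert(4)[symmetric] by simp
    have "\<forall>x. v x \<noteq> 0 \<longrightarrow> set x \<subseteq> letters l"
      using insert.prems by (simp add: fa_carrier_def v_def)
    then have v: "v \<in> fa_carrier l"
      using insert(1) by (simp add: fa_carrier_def S)
    have z: "set z \<subseteq> letters l"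
      using insert.prems insert(4) by (auto simp: fa_carrier_def)
    show ?case
      by (subst uv) (intro assms(4) fa_carrier_word z v assms(3) insert(3) S)
  qed
qed

lemma fa_carrier_mult: "\<lbrakk>u \<in> fa_carrier l; v \<in> fa_carrier l\<rbrakk> \<Longrightarrow> fa_mult u v \<in> fa_carrier l"
proof (induction u rule: fa_carrier_induct)
  case zero
  then show ?case by (simp add: fa_mult_def fa_carrier_def)
next
  case (word x)
  from word(2) show ?case
  proof (induction v rule: fa_carrier_induct)
    case zero
    then show ?case by (simp add: fa_mult_def fa_carrier_def)
  next
    case (word y)
    then show ?case using \<open>set x \<subseteq> _\<close> by (simp add: fa_mult_word fa_carrier_word)
  next
    case (comb a u v)
    show ?case
      unfolding fa_mult_add_right fa_mult_scale_right by (intro fa_carrier_add fa_carrier_scale comb)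
  qed
next
  case (comb a u v)
  show ?case
    unfolding fa_mult_add_left fa_mult_scale_left by (intro fa_carrier_add fa_carrier_scale comb)
qed

lemma fa_rep_sel [simp]:
  "vecs (fa_rep l) = fa_carrier l" "vzero (fa_rep l) = 0" "vadd (fa_rep l) = (+)"
  "vscale (fa_rep l) = (\<lambda>a u x. a * u x)" "vact (fa_rep l) = fa_mult"
  by (simp_all add: fa_rep_def)

lemma cspace_fa_rep: "cspace (fa_rep l)"
  by unfold_locales
    (simp_all add: fa_carrier_zero fa_carrier_add fa_carrier_scale add.assoc add.commute,
      simp_all add: fun_eq_iff distrib_left distrib_right mult.assoc)

lemma fa_carrier_diff: "\<lbrakk>u \<in> fa_carrier l; v \<in> fa_carrier l\<rbrakk> \<Longrightarrow> u - v \<in> fa_carrier l"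
  using fa_carrier_add[OF _ fa_carrier_scale, of u l v "-1"] by (simp add: fun_diff_def plus_fun_def)

lemma fa_carrier_const: "fa_const a \<in> fa_carrier l"
  unfolding fa_const_word by (intro fa_carrier_scale fa_carrier_word) simp

section \<open>The hyperoctahedral group\<close>

lemma W_grp_id: "id \<in> W_grp l"
  by (simp add: W_grp_def permutes_id)

lemma W_grp_comp: "\<lbrakk>v \<in> W_grp l; w \<in> W_grp l\<rbrakk> \<Longrightarrow> v \<circ> w \<in> W_grp l"
  by (auto simp: W_grp_def intro: permutes_compose)

lemma W_grp_bij: "w \<in> W_grp l \<Longrightarrow> bij w"
  by (auto simp: W_grp_def permutes_bij)

lemma W_grp_inv: "w \<in> W_grp l \<Longrightarrow> inv w \<in> W_grp l"
  by (auto simp: W_grp_def permutes_inv) (metis permutes_inverses)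

text \<open>For \<open>i = 0\<close> the two transpositions would share the point 0, hence the
  bound.\<close>

lemma s_adj_apply:
  "1 \<le> i \<Longrightarrow> s_adj i j =
    (if j = int i then int i + 1 else if j = int i + 1 then int i
     else if j = - int i then - int i - 1 else if j = - int i - 1 then - int i else j)"
  by (auto simp: s_adj_def Transposition.transpose_def)

lemma s_eps_apply: "s_eps i j = (if j = int i then - int i else if j = - int i then int i else j)"
  by (auto simp: s_eps_def Transposition.transpose_def)

lemma s_adj_W: "i \<in> {1..<l} \<Longrightarrow> s_adj i \<in> W_grp l"
  unfolding W_grp_def s_adj_def
  by (auto intro!: permutes_compose permutes_swap_id simp: Transposition.transpose_def)

lemma s_eps_W: "i \<in> {1..l} \<Longrightarrow> s_eps i \<in> W_grp l"
  unfolding W_grp_def s_eps_def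
  by (auto intro!: permutes_swap_id simp: Transposition.transpose_def)

lemma s_adj_s_adj: "1 \<le> i \<Longrightarrow> s_adj i \<circ> s_adj i = id"
  by (auto simp: fun_eq_iff s_adj_apply)

lemma s_eps_s_eps: "s_eps i \<circ> s_eps i = id"
  by (auto simp: fun_eq_iff s_eps_apply)

lemma inv_s_adj: "1 \<le> i \<Longrightarrow> inv (s_adj i) = s_adj i"
  by (metis inv_unique_comp s_adj_s_adj)

lemma inv_s_eps: "inv (s_eps i) = s_eps i"
  by (metis inv_unique_comp s_eps_s_eps)

text \<open>Conjugation by \<open>s_adj i\<close> carries the sign change at \<open>i + 1\<close> to
  the one at \<open>i\<close>, so the last sign change yields all of them.\<close>

lemma s_eps_step: "1 \<le> i \<Longrightarrow> s_eps i = s_adj i \<circ> s_eps (Suc i) \<circ> s_adj i"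
  by (auto simp: fun_eq_iff s_adj_apply s_eps_apply)

text \<open>Only simple reflections are allowed as factors, because these are the group elements
  past which the Hecke relations move an \<open>Eps\<close> letter.\<close>

inductive W_gen :: "nat \<Rightarrow> (int \<Rightarrow> int) \<Rightarrow> bool" for l where
  W_gen_id: "W_gen l id"
| W_gen_adj: "\<lbrakk>W_gen l w; i \<in> {1..<l}\<rbrakk> \<Longrightarrow> W_gen l (s_adj i \<circ> w)"
| W_gen_eps: "\<lbrakk>W_gen l w; 1 \<le> l\<rbrakk> \<Longrightarrow> W_gen l (s_eps l \<circ> w)"

lemma W_gen_W: "W_gen l w \<Longrightarrow> w \<in> W_grp l"
  by (induction rule: W_gen.induct)
    (rule W_grp_id W_grp_comp | assumption | rule s_adj_W s_eps_W | simp)+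

text \<open>Downward induction from \<open>l\<close>, the one index at which the sign change is
  itself a generator.\<close>

lemma W_gen_eps_any:
  assumes "i \<in> {1..l}" "W_gen l w"
  shows "W_gen l (s_eps i \<circ> w)"
proof -
  have "i \<le> l" using assms by simp
  then show ?thesis using assms
  proof (induction i arbitrary: w rule: inc_induct)
    case base
    then show ?case by (intro W_gen_eps) auto
  next
    case (step i)
    have "W_gen l (s_adj i \<circ> (s_eps (Suc i) \<circ> (s_adj i \<circ> w)))"
      using step by (intro W_gen_adj step.IH) auto
    moreover have "s_eps i \<circ> w = s_adj i \<circ> (s_eps (Suc i) \<circ> (s_adj i \<circ> w))"
      using s_eps_step[of i] step.prems by (simp add: comp_assoc)
    ultimately show ?case by (metis (no_types))
  qed
qed

text \<open>Multiplying by generators, the largest moved index is moved back to its place.\<close>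

lemma W_grp_gen:
  assumes "w \<in> W_grp l"
  shows "W_gen l w"
proof -
  \<comment> \<open>The rank \<open>m\<close> of the group goes down in the induction, while the
    generators remain those of rank \<open>l\<close>.\<close>
  have "W_gen l w" if "m \<le> l" "w \<in> W_grp m" for m w
    using that
  proof (induction m arbitrary: w)
    case 0
    then have "w = id" by (auto simp: W_grp_def)
    then show ?case using W_gen_id[of l] by blast
  next
    case (Suc m)
    note wp = Suc.prems(2)
    have odd: "w (- j) = - w j" for j using wp by (simp add: W_grp_def)
    have perm: "w permutes {- int (Suc m)..int (Suc m)}" using wp by (simp add: W_grp_def)
    have w0: "w 0 = 0" using odd[of 0] by simp
    have pos: "W_gen l w" if "w \<in> W_grp (Suc m)" "0 < w (int (Suc m))" for w
      using that
    \<comment> \<open>The measure is the distance of the image of the top index \<open>m + 1\<close>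
      from \<open>m + 1\<close>; multiplying by \<open>s_adj j\<close> raises this image by
      one.\<close>
    proof (induction "nat (int (Suc m) - w (int (Suc m)))" arbitrary: w rule: less_induct)
      case less
      have odd: "w (- j) = - w j" for j using less.prems by (simp add: W_grp_def)
      have perm: "w permutes {- int (Suc m)..int (Suc m)}" using less.prems by (simp add: W_grp_def)
      have le: "w (int (Suc m)) \<le> int (Suc m)"
        using permutes_in_image[OF perm, of "int (Suc m)"] by simp
      show ?case
      proof (cases "w (int (Suc m)) = int (Suc m)")
        case True
        \<comment> \<open>An odd map that fixes \<open>m + 1\<close> fixes \<open>- (m + 1)\<close>
          too, so \<open>w\<close> already lies in the group of rank \<open>m\<close>.\<close>
        have "w permutes {- int m..int m}"
          unfolding permutes_def
        proof (intro conjI allI impI)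
          fix x assume x: "x \<notin> {- int m..int m}"
          show "w x = x"
          proof (cases "x = int (Suc m) \<or> x = - int (Suc m)")
            case True
            then show ?thesis using \<open>w (int (Suc m)) = _\<close> odd by metis
          next
            case False
            then have "x \<notin> {- int (Suc m)..int (Suc m)}" using x by auto
            then show ?thesis using perm unfolding permutes_def by blast
          qed
        qed (use perm in \<open>auto simp: permutes_def\<close>)
        then have "w \<in> W_grp m" using odd by (simp add: W_grp_def)
        then show ?thesis using Suc by simp
      next
        case False
        define j where "j = nat (w (int (Suc m)))"
        have j: "w (int (Suc m)) = int j" "1 \<le> j" "j < Suc m"
          using less.prems False le by (auto simp: j_def)
        have sj: "s_adj j \<in> W_grp (Suc m)" using j by (intro s_adj_W) auto
        have *: "(s_adj j \<circ> w) (int (Suc m)) = int j + 1" using j by (simp add: s_adj_apply)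
        have "W_gen l (s_adj j \<circ> w)"
          using j less.prems by (intro less.hyps W_grp_comp sj) (unfold *, auto)
        then have "W_gen l (s_adj j \<circ> (s_adj j \<circ> w))"
          using j Suc.prems by (intro W_gen_adj[of l "s_adj j \<circ> w"]) auto
        then show ?thesis using s_adj_s_adj[of j] j by (metis comp_assoc comp_id id_comp)
      qed
    qed
    show ?case
    proof (cases "0 < w (int (Suc m))")
      case True
      then show ?thesis using pos wp by blast
    next
      case False
      have "w (int (Suc m)) \<noteq> 0" using w0 permutes_inj[OF perm] by (metis injD of_nat_eq_0_iff Suc_neq_Zero)
      moreover have "- int (Suc m) \<le> w (int (Suc m))"
        using permutes_in_image[OF perm, of "int (Suc m)"] by simp
      ultimately obtain j where j: "w (int (Suc m)) = - int j" "1 \<le> j" "j \<le> Suc m"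
        using False by (intro that[of "nat (- w (int (Suc m)))"]) auto
      have "W_gen l (s_eps j \<circ> w)"
        using j wp by (intro pos W_grp_comp s_eps_W) (auto simp: s_eps_apply)
      then have "W_gen l (s_eps j \<circ> (s_eps j \<circ> w))"
        using j Suc.prems by (intro W_gen_eps_any[of j l "s_eps j \<circ> w"]) auto
      then show ?thesis using s_eps_s_eps[of j] by (metis comp_assoc id_comp)
    qed
  qed
  then show ?thesis using assms by blast
qed

lemma w_longest_Suc: "w_longest (Suc l) = w_longest l \<circ> s_eps (Suc l)"
  by (simp add: w_longest_def)

lemma w_longest_apply: "w_longest l j = (if \<bar>j\<bar> \<le> int l then - j else j)"
proof (induction l arbitrary: j)
  case 0
  then show ?case by (simp add: w_longest_def)
next
  case (Suc l)
  then show ?case by (auto simp: w_longest_Suc s_eps_apply)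
qed

text \<open>Partial products are included because the action of \<open>w_longest l\<close> is later
  computed one sign change at a time.\<close>

lemma w_longest_W_le: "m \<le> l \<Longrightarrow> w_longest m \<in> W_grp l"
proof (induction m)
  case 0
  then show ?case by (simp add: w_longest_def W_grp_id[unfolded id_def] id_def)
next
  case (Suc m)
  then show ?case unfolding w_longest_Suc by (intro W_grp_comp s_eps_W) auto
qed

lemma w_longest_W: "w_longest l \<in> W_grp l"
  by (rule w_longest_W_le) simp

lemma finite_W_grp: "finite (W_grp l)"
  by (rule finite_subset[OF _ finite_permutations[of "{- int l..int l}"]]) (auto simp: W_grp_def)

text \<open>On \<open>{- l..l}\<close> the longest element is negation, which commutes with every
  odd map; outside that interval both maps are the identity.\<close>

lemma w_longest_conj: "w \<in> W_grp l \<Longrightarrow> w_longest l \<circ> w \<circ> w_longest l = w"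
proof
  fix j assume w: "w \<in> W_grp l"
  then have perm: "w permutes {- int l..int l}" and odd: "w (- j) = - w j" for j
    by (auto simp: W_grp_def)
  have "\<bar>w i\<bar> \<le> int l \<longleftrightarrow> \<bar>i\<bar> \<le> int l" for i
    using permutes_in_image[OF perm, of i] by (auto simp: abs_le_iff)
  then show "(w_longest l \<circ> w \<circ> w_longest l) j = w j"
    by (auto simp: w_longest_apply odd)
qed

lemma w_longest_square: "w_longest l \<circ> w_longest l = id"
  by (auto simp: fun_eq_iff w_longest_apply)

section \<open>The involution on the free algebra\<close>

lemma letter_bullet_involution [simp]: "letter_bullet (letter_bullet x) = x"
  by (cases x) (auto simp: bij_imp_bij_inv inv_inv_eq)

lemma word_bullet_involution: "rev (map letter_bullet (rev (map letter_bullet x))) = x"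
  by (simp add: rev_map comp_def)

lemma letter_bullet_letters: "x \<in> letters l \<Longrightarrow> letter_bullet x \<in> letters l"
  by (cases x) (auto simp: letters_def W_grp_inv)

lemma fa_bullet_involution: "fa_bullet (fa_bullet u) = u"
  by (rule ext) (simp add: fa_bullet_def word_bullet_involution)

lemma fa_bullet_add: "fa_bullet (u + v) = fa_bullet u + fa_bullet v"
  by (rule ext) (simp add: fa_bullet_def)

lemma fa_bullet_diff: "fa_bullet (u - v) = fa_bullet u - fa_bullet v"
  by (rule ext) (simp add: fa_bullet_def)

lemma fa_bullet_scale: "fa_bullet (\<lambda>x. a * u x) = (\<lambda>x. cnj a * fa_bullet u x)"
  by (rule ext) (simp add: fa_bullet_def)

lemma fa_bullet_zero: "fa_bullet 0 = 0"
  by (rule ext) (simp add: fa_bullet_def)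

lemma fa_bullet_word: "fa_bullet (word x) = word (rev (map letter_bullet x))"
  using word_bullet_involution by (auto simp: fa_bullet_def word_def fun_eq_iff)

lemma fa_bullet_const: "fa_bullet (fa_const a) = fa_const (cnj a)"
  by (simp add: fa_const_word fa_bullet_scale fa_bullet_word)

text \<open>Reversing a word of length \<open>n\<close> turns the cut at \<open>i\<close> into the
  cut at \<open>n - i\<close> and exchanges the two pieces.\<close>

lemma fa_bullet_mult: "fa_bullet (fa_mult u v) = fa_mult (fa_bullet v) (fa_bullet u)"
proof
  fix x :: "hletter list"
  let ?r = "\<lambda>x. rev (map letter_bullet x)" and ?n = "length x"
  have "fa_bullet (fa_mult u v) x = (\<Sum>i\<le>?n. cnj (u (take i (?r x))) * cnj (v (drop i (?r x))))"
    by (simp add: fa_bullet_def fa_mult_def)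
  also have "\<dots> = (\<Sum>i\<le>?n. cnj (u (take (?n - i) (?r x))) * cnj (v (drop (?n - i) (?r x))))"
    by (rule sum.reindex_bij_witness[where i="\<lambda>i. ?n - i" and j="\<lambda>i. ?n - i"]) auto
  also have "\<dots> = fa_mult (fa_bullet v) (fa_bullet u) x"
    unfolding fa_mult_def fa_bullet_def
    by (intro sum.cong refl)
      (simp add: rev_take rev_drop take_map[symmetric] drop_map[symmetric] mult.commute)
  finally show "fa_bullet (fa_mult u v) x = fa_mult (fa_bullet v) (fa_bullet u) x" .
qed

lemma fa_bullet_carrier: "u \<in> fa_carrier l \<Longrightarrow> fa_bullet u \<in> fa_carrier l"
proof (induction u rule: fa_carrier_induct)
  case zero
  then show ?case by (simp only: fa_bullet_zero fa_carrier_zero)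
next
  case (word x)
  then show ?case
    by (auto simp: fa_bullet_word intro!: fa_carrier_word letter_bullet_letters)
next
  case (comb a u v)
  show ?case unfolding fa_bullet_add fa_bullet_scale by (intro fa_carrier_add fa_carrier_scale comb)
qed

section \<open>The Hecke algebra and its induced modules\<close>

lemma letters_Eps: "i \<in> {1..l} \<Longrightarrow> Eps i \<in> letters l"
  by (simp add: letters_def)

lemma letters_Grp: "w \<in> W_grp l \<Longrightarrow> Grp w \<in> letters l"
  by (simp add: letters_def)

lemma fa_word_Eps: "i \<in> {1..l} \<Longrightarrow> word [Eps i] \<in> fa_carrier l"
  by (intro fa_carrier_word) (simp add: letters_Eps)

lemma fa_word_Grp: "w \<in> W_grp l \<Longrightarrow> word [Grp w] \<in> fa_carrier l"
  by (intro fa_carrier_word) (simp add: letters_Grp)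

lemma hecke_relations_carrier: "hecke_relations b c l \<subseteq> fa_carrier l"
  unfolding hecke_relations_def
  by (auto intro!: fa_carrier_diff fa_carrier_add fa_carrier_const fa_carrier_word
      letters_Eps letters_Grp W_grp_comp W_grp_id s_adj_W s_eps_W)

section \<open>The ideal of relations and products of cosets\<close>

context
  fixes b c :: complex and l :: nat
begin

private abbreviation "hideal \<equiv> hecke_ideal b c l"
private abbreviation "helt \<equiv> hecke_elt b c l"

lemma csubspace_ideal: "csubspace (fa_rep l) hideal"
  unfolding hecke_ideal_def using hecke_relations_carrier
  by (intro cspace.csubspace_rep_span cspace_fa_rep) (auto intro!: fa_carrier_mult)

lemma ideal_carrier: "u \<in> hideal \<Longrightarrow> u \<in> fa_carrier l"
  using csubspace.sub_mem[OF csubspace_ideal] by simp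

lemma ideal_add: "\<lbrakk>u \<in> hideal; v \<in> hideal\<rbrakk> \<Longrightarrow> u + v \<in> hideal"
  using csubspace.sub_add[OF csubspace_ideal, of u v] by simp

lemma ideal_scale: "u \<in> hideal \<Longrightarrow> (\<lambda>x. a * u x) \<in> hideal"
  using csubspace.sub_scale[OF csubspace_ideal, of u a] by simp

lemma ideal_zero: "0 \<in> hideal"
  using csubspace.sub_zero[OF csubspace_ideal] by simp

lemma ideal_minus: "u \<in> hideal \<Longrightarrow> - u \<in> hideal"
  using ideal_scale[of u "-1"] by (simp add: fun_Compl_def)

lemma ideal_diff: "\<lbrakk>u \<in> hideal; v \<in> hideal\<rbrakk> \<Longrightarrow> u - v \<in> hideal"
  using ideal_add[OF _ ideal_minus, of u v] by simp

lemma ideal_mult_left: "\<lbrakk>u \<in> fa_carrier l; r \<in> hideal\<rbrakk> \<Longrightarrow> fa_mult u r \<in> hideal"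
proof -
  assume u: "u \<in> fa_carrier l" and "r \<in> hideal"
  from this(2) show ?thesis unfolding hecke_ideal_def
  proof (induction rule: rep_span_induct)
    case (base x)
    then obtain u' r v where "x = fa_mult (fa_mult u' r) v" "u' \<in> fa_carrier l"
      "r \<in> hecke_relations b c l" "v \<in> fa_carrier l" by blast
    moreover have "fa_mult u (fa_mult (fa_mult u' r) v) = fa_mult (fa_mult (fa_mult u u') r) v"
      by (simp add: fa_mult_assoc)
    ultimately show ?case
      using fa_carrier_mult[OF u] by (intro rep_span_superset[THEN subsetD]) blast
  next
    case zero
    have "fa_mult u 0 = 0" by (rule ext) (simp add: fa_mult_def)
    then show ?case using rep_span_zero[of "fa_rep l"] by (simp only: fa_rep_sel)
  next
    case (comb a b x y)
    then show ?case
      unfolding fa_rep_sel fa_mult_add_right fa_mult_scale_right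
      by (rule rep_span_comb[of _ "fa_rep l", unfolded fa_rep_sel])
  qed
qed

lemma ideal_mult_right: "\<lbrakk>u \<in> fa_carrier l; r \<in> hideal\<rbrakk> \<Longrightarrow> fa_mult r u \<in> hideal"
proof -
  assume u: "u \<in> fa_carrier l" and "r \<in> hideal"
  from this(2) show ?thesis unfolding hecke_ideal_def
  proof (induction rule: rep_span_induct)
    case (base x)
    then obtain u' r v where "x = fa_mult (fa_mult u' r) v" "u' \<in> fa_carrier l"
      "r \<in> hecke_relations b c l" "v \<in> fa_carrier l" by blast
    moreover have "fa_mult (fa_mult (fa_mult u' r) v) u = fa_mult (fa_mult u' r) (fa_mult v u)"
      by (simp add: fa_mult_assoc)
    ultimately show ?case
      using fa_carrier_mult[OF _ u] by (intro rep_span_superset[THEN subsetD]) blast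
  next
    case zero
    have "fa_mult 0 u = 0" by (rule ext) (simp add: fa_mult_def)
    then show ?case using rep_span_zero[of "fa_rep l"] by (simp only: fa_rep_sel)
  next
    case (comb a b x y)
    then show ?case
      unfolding fa_rep_sel fa_mult_add_left fa_mult_scale_left
      by (rule rep_span_comb[of _ "fa_rep l", unfolded fa_rep_sel])
  qed
qed

lemma relation_ideal: "r \<in> hecke_relations b c l \<Longrightarrow> r \<in> hideal"
proof -
  assume "r \<in> hecke_relations b c l"
  then have "fa_mult (fa_mult (word []) r) (word []) \<in> hideal"
    unfolding hecke_ideal_def
    by (intro rep_span_superset[THEN subsetD])
       (rule CollectI, intro exI conjI, rule refl, auto intro: fa_carrier_word)
  then show ?thesis by (simp add: fa_mult_one_left fa_mult_one_right)
qed

lemma rel_Eps_Eps: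
  "\<lbrakk>i \<in> {1..l}; j \<in> {1..l}\<rbrakk> \<Longrightarrow> word [Eps i, Eps j] - word [Eps j, Eps i] \<in> hideal"
  by (intro relation_ideal) (unfold hecke_relations_def, blast)

lemma rel_Grp_Grp:
  "\<lbrakk>v \<in> W_grp l; w \<in> W_grp l\<rbrakk> \<Longrightarrow> word [Grp v, Grp w] - word [Grp (v \<circ> w)] \<in> hideal"
  by (intro relation_ideal) (unfold hecke_relations_def, blast)

lemma rel_Grp_id: "word [Grp id] - word [] \<in> hideal"
  by (intro relation_ideal) (unfold hecke_relations_def, blast)

lemma rel_adj_Eps: "i \<in> {1..<l} \<Longrightarrow>
    word [Grp (s_adj i), Eps i] - word [Eps (i + 1), Grp (s_adj i)] - fa_const b \<in> hideal"
  by (intro relation_ideal) (unfold hecke_relations_def, blast)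

lemma rel_adj_Eps_other: "\<lbrakk>i \<in> {1..<l}; j \<in> {1..l}; j \<noteq> i; j \<noteq> i + 1\<rbrakk> \<Longrightarrow>
    word [Grp (s_adj i), Eps j] - word [Eps j, Grp (s_adj i)] \<in> hideal"
  by (intro relation_ideal) (unfold hecke_relations_def, blast)

lemma rel_eps_Eps: "1 \<le> l \<Longrightarrow>
    word [Grp (s_eps l), Eps l] + word [Eps l, Grp (s_eps l)] - fa_const (2 * c) \<in> hideal"
  by (intro relation_ideal) (simp add: hecke_relations_def)

lemma rel_eps_Eps_other: "\<lbrakk>j \<in> {1..l}; j \<noteq> l\<rbrakk> \<Longrightarrow>
    word [Grp (s_eps l), Eps j] - word [Eps j, Grp (s_eps l)] \<in> hideal"
  by (intro relation_ideal) (unfold hecke_relations_def, blast)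

lemma rel_square: "\<lbrakk>w \<in> W_grp l; w \<circ> w = id\<rbrakk> \<Longrightarrow> word [Grp w, Grp w] - word [] \<in> hideal"
  using ideal_add[OF rel_Grp_Grp rel_Grp_id, of w w] by simp

text \<open>The relation of \<open>s\<^sub>i\<^sub>,\<^sub>i\<^sub>+\<^sub>1\<close> with \<open>\<epsilon>\<^sub>i\<close>, multiplied by \<open>s\<^sub>i\<^sub>,\<^sub>i\<^sub>+\<^sub>1\<close> from both sides.\<close>

lemma rel_adj_Eps_swap:
  assumes "i \<in> {1..<l}"
  shows "word [Eps i, Grp (s_adj i)] - word [Grp (s_adj i), Eps (i + 1)] - fa_const b \<in> hideal"
proof -
  let ?s = "Grp (s_adj i)"
  let ?r = "word [?s, Eps i] - word [Eps (i + 1), ?s] - fa_const b"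
  let ?q = "word [?s, ?s] - word []"
  have q: "?q \<in> hideal" using assms by (intro rel_square s_adj_W s_adj_s_adj) auto
  have W: "Grp (s_adj i) \<in> letters l" "Eps i \<in> letters l" "Eps (i + 1) \<in> letters l"
    using assms by (auto intro!: letters_Grp letters_Eps s_adj_W)
  have *: "fa_mult (fa_mult x r) x - fa_mult q y + fa_mult z q + (\<lambda>x. b * q x) \<in> hideal"
    if "r \<in> hideal" "q \<in> hideal" "x \<in> fa_carrier l" "y \<in> fa_carrier l" "z \<in> fa_carrier l" for r q x y z
    using that by (intro ideal_add ideal_diff ideal_scale ideal_mult_left ideal_mult_right)
  \<comment> \<open>Conjugation leaves a square of \<open>?s\<close> in each of the three terms of
    \<open>?r\<close>; the three multiples of \<open>?q\<close> remove these squares.\<close>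
  have "fa_mult (fa_mult (word [?s]) ?r) (word [?s]) - fa_mult ?q (word [Eps i, ?s])
      + fa_mult (word [?s, Eps (i + 1)]) ?q + (\<lambda>x. b * ?q x) \<in> hideal"
    using W by (intro * rel_adj_Eps[OF assms] q fa_carrier_word) auto
  also have "fa_mult (fa_mult (word [?s]) ?r) (word [?s]) - fa_mult ?q (word [Eps i, ?s])
      + fa_mult (word [?s, Eps (i + 1)]) ?q + (\<lambda>x. b * ?q x)
      = word [Eps i, ?s] - word [?s, Eps (i + 1)] - fa_const b"
    unfolding fa_const_word fa_mult_diff_left fa_mult_diff_right fa_mult_scale_left
      fa_mult_scale_right fa_mult_word
    by (rule ext) (simp add: algebra_simps)
  finally show ?thesis .
qed

text \<open>Most families of relations are mapped to themselves, up to sign or inversion of group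
  elements. The exception is the relation of \<open>s_adj i\<close> with \<open>Eps i\<close>, whose
  reversal is \<open>rel_adj_Eps_swap\<close>. The constants must be real because the involution
  conjugates them.\<close>

lemma bullet_ideal:
  assumes "cnj b = b" "cnj c = c" "r \<in> hideal"
  shows "fa_bullet r \<in> hideal"
  using assms(3) unfolding hecke_ideal_def
proof (induction rule: rep_span_induct)
  case (base x)
  then obtain u r v where x: "x = fa_mult (fa_mult u r) v" "u \<in> fa_carrier l"
    "r \<in> hecke_relations b c l" "v \<in> fa_carrier l" by blast
  have inv: "letter_bullet (Grp (s_eps l)) = Grp (s_eps l)" if "1 \<le> l"
    using that s_eps_W[of l l] by (simp add: inv_s_eps W_grp_bij)
  have inv': "letter_bullet (Grp (s_adj i)) = Grp (s_adj i)" if "i \<in> {1..<l}" for i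
    using that s_adj_W[of i l] by (simp add: inv_s_adj W_grp_bij)
  have neg: "fa_bullet (word [x, y] - word [y, x]) \<in> hideal"
    if "word [x, y] - word [y, x] \<in> hideal" "letter_bullet x = x" "letter_bullet y = y" for x y
    using ideal_minus[OF that(1)] that(2,3) by (simp add: fa_bullet_diff fa_bullet_word)
  consider
      (1) i j where "i \<in> {1..l}" "j \<in> {1..l}" "r = word [Eps i, Eps j] - word [Eps j, Eps i]"
    | (2) v w where "v \<in> W_grp l" "w \<in> W_grp l" "r = word [Grp v, Grp w] - word [Grp (v \<circ> w)]"
    | (3) "r = word [Grp id] - word []"
    | (4) i where "i \<in> {1..<l}"
        "r = word [Grp (s_adj i), Eps i] - word [Eps (i + 1), Grp (s_adj i)] - fa_const b"
    | (5) i j where "i \<in> {1..<l}" "j \<in> {1..l}" "j \<noteq> i" "j \<noteq> i + 1"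
        "r = word [Grp (s_adj i), Eps j] - word [Eps j, Grp (s_adj i)]"
    | (6) "1 \<le> l" "r = word [Grp (s_eps l), Eps l] + word [Eps l, Grp (s_eps l)] - fa_const (2 * c)"
    | (7) j where "j \<in> {1..l}" "j \<noteq> l" "r = word [Grp (s_eps l), Eps j] - word [Eps j, Grp (s_eps l)]"
    using x(3) unfolding hecke_relations_def by (auto split: if_splits)
  then have "fa_bullet r \<in> hideal"
  proof cases
    case 1
    then show ?thesis using neg rel_Eps_Eps by simp
  next
    case 2
    then have "fa_bullet r = word [Grp (inv w), Grp (inv v)] - word [Grp (inv w \<circ> inv v)]"
      using W_grp_bij[OF W_grp_comp] W_grp_bij
      by (simp add: fa_bullet_diff fa_bullet_word o_inv_distrib)
    then show ?thesis using 2 rel_Grp_Grp W_grp_inv by simp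
  next
    case 3
    then show ?thesis using rel_Grp_id by (simp add: fa_bullet_diff fa_bullet_word)
  next
    case 4
    then show ?thesis using rel_adj_Eps_swap inv' assms(1)
      by (simp add: fa_bullet_diff fa_bullet_word fa_bullet_const del: letter_bullet.simps(2))
  next
    case 5
    then show ?thesis using neg rel_adj_Eps_other inv' by simp
  next
    case 6
    then show ?thesis using rel_eps_Eps inv assms(2)
      by (simp add: fa_bullet_diff fa_bullet_add fa_bullet_word fa_bullet_const add.commute
          del: letter_bullet.simps(2))
  next
    case 7
    then show ?thesis using neg rel_eps_Eps_other inv by simp
  qed
  then show ?case
    using x fa_bullet_carrier ideal_mult_left ideal_mult_right
    by (simp add: fa_bullet_mult hecke_ideal_def)
next
  case zero
  then show ?case using rep_span_zero[of "fa_rep l"] by (simp only: fa_rep_sel fa_bullet_zero)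
next
  case (comb a b x y)
  then show ?case
    unfolding fa_rep_sel fa_bullet_add fa_bullet_scale
    by (rule rep_span_comb[of _ "fa_rep l", unfolded fa_rep_sel])
qed

lemma elt_eq_iff: "\<lbrakk>u \<in> fa_carrier l; v \<in> fa_carrier l\<rbrakk> \<Longrightarrow> helt u = helt v \<longleftrightarrow> u - v \<in> hideal"
  unfolding hecke_elt_def
  using csubspace.coset_eq_iff[OF csubspace_ideal, of u v]
  by (simp add: plus_fun_def fun_diff_def)

lemma elt_mem_iff: "v \<in> helt u \<longleftrightarrow> v - u \<in> hideal"
  unfolding hecke_elt_def coset_def fa_rep_sel by (force simp: image_iff algebra_simps)

text \<open>The difference \<open>u' v' - u v\<close> equals
  \<open>u' (v' - v) + (u' - u) v\<close>, so stability of the ideal under multiplication from both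
  sides enters.\<close>

lemma mult_elt:
  assumes "u \<in> fa_carrier l" "v \<in> fa_carrier l"
  shows "hecke_mult b c l (helt u) (helt v) = helt (fa_mult u v)"
proof (intro equalityI subsetI)
  fix z assume "z \<in> hecke_mult b c l (helt u) (helt v)"
  then obtain u' v' r where z: "z = fa_mult u' v' + r" "u' - u \<in> hideal" "v' - v \<in> hideal" "r \<in> hideal"
    unfolding hecke_mult_def elt_mem_iff by blast
  then have u': "u' \<in> fa_carrier l"
    using fa_carrier_add[OF assms(1) ideal_carrier[of "u' - u"]] by simp
  have "fa_mult u' (v' - v) + fa_mult (u' - u) v + r \<in> hideal"
    using z u' assms by (intro ideal_add ideal_mult_left ideal_mult_right)
  also have "fa_mult u' (v' - v) + fa_mult (u' - u) v + r = z - fa_mult u v"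
    unfolding z(1) fa_mult_diff_left fa_mult_diff_right by (simp add: algebra_simps)
  finally show "z \<in> helt (fa_mult u v)" unfolding elt_mem_iff .
next
  fix z assume "z \<in> helt (fa_mult u v)"
  then have "z - fa_mult u v \<in> hideal" "z = fa_mult u v + (z - fa_mult u v)"
    unfolding elt_mem_iff by (auto simp: algebra_simps)
  moreover have "u \<in> helt u" "v \<in> helt v" by (simp_all add: elt_mem_iff ideal_zero)
  ultimately show "z \<in> hecke_mult b c l (helt u) (helt v)" unfolding hecke_mult_def by blast
qed

lemma bullet_elt:
  assumes "cnj b = b" "cnj c = c"
  shows "hecke_bullet (helt u) = helt (fa_bullet u)"
proof (intro equalityI subsetI)
  fix z assume "z \<in> hecke_bullet (helt u)"
  then show "z \<in> helt (fa_bullet u)"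
    unfolding hecke_bullet_def using bullet_ideal[OF assms]
    by (auto simp: elt_mem_iff fa_bullet_diff[symmetric])
next
  fix z assume "z \<in> helt (fa_bullet u)"
  then have "fa_bullet z - u \<in> hideal"
    using bullet_ideal[OF assms, of "z - fa_bullet u"]
    by (simp add: elt_mem_iff fa_bullet_diff fa_bullet_involution)
  then have "fa_bullet z \<in> helt u" "z = fa_bullet (fa_bullet z)"
    by (simp_all add: elt_mem_iff fa_bullet_involution)
  then show "z \<in> hecke_bullet (helt u)" unfolding hecke_bullet_def by blast
qed

lemma star_elt:
  assumes "cnj b = b" "cnj c = c" "u \<in> fa_carrier l"
  shows "hecke_star b c l (helt u) =
    helt (fa_mult (fa_mult (word [Grp (w_longest l)]) (fa_bullet u)) (word [Grp (w_longest l)]))"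
  unfolding hecke_star_def hecke_grp_def bullet_elt[OF assms(1,2)]
  using assms by (simp add: mult_elt fa_word_Grp w_longest_W fa_bullet_carrier fa_carrier_mult)

private abbreviation "hreg \<equiv> hecke_regular b c l"

lemma H_sel:
  "vecs hreg = helt ` fa_carrier l"
  "vact hreg = hecke_mult b c l"
  by (simp_all add: hecke_regular_def hecke_alg_def)

lemma H_quotient:
  "vecs hreg = vecs (quotient_rep (fa_rep l) hideal)"
  "vzero hreg = vzero (quotient_rep (fa_rep l) hideal)"
  "vadd hreg = vadd (quotient_rep (fa_rep l) hideal)"
  "vscale hreg = vscale (quotient_rep (fa_rep l) hideal)"
  by (simp_all add: hecke_regular_def hecke_alg_def quotient_rep_def hecke_elt_def)

lemma cspace_H: "cspace hreg"
  using csubspace.cspace_quotient[OF csubspace_ideal]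
  unfolding cspace_def H_quotient .

lemma vadd_elt: "\<lbrakk>u \<in> fa_carrier l; v \<in> fa_carrier l\<rbrakk> \<Longrightarrow> vadd hreg (helt u) (helt v) = helt (u + v)"
  unfolding H_quotient hecke_elt_def
  using csubspace.vadd_quotient[OF csubspace_ideal, of u v] by simp

lemma vscale_elt: "u \<in> fa_carrier l \<Longrightarrow> vscale hreg a (helt u) = helt (\<lambda>x. a * u x)"
  unfolding H_quotient hecke_elt_def
  using csubspace.vscale_quotient[OF csubspace_ideal, of u a] by simp

lemma vzero_elt: "vzero hreg = helt 0"
  unfolding H_quotient hecke_elt_def
  using csubspace.vzero_quotient[OF csubspace_ideal] by simp

section \<open>Modules induced from the polynomial subalgebra\<close>

context
  fixes \<nu> :: "nat \<Rightarrow> complex"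
begin

definition ind_span :: "fa set set" where
  "ind_span = rep_span hreg
     {vadd hreg (hecke_mult b c l h (helt (word (map Eps js)))) (vscale hreg (- prod_list (map \<nu> js)) h)
      | h js. h \<in> hecke_alg b c l \<and> set js \<subseteq> {1..l}}"

private abbreviation "hind \<equiv> induced_module b c l \<nu>"

lemma Y_quotient: "hind = quotient_rep hreg ind_span"
  by (simp add: induced_module_def ind_span_def Let_def)

lemma Eps_word: "set js \<subseteq> {1..l} \<Longrightarrow> word (map Eps js) \<in> fa_carrier l"
  by (intro fa_carrier_word) (auto simp: letters_def)

lemma vadd_mult_elt:
  "\<lbrakk>u \<in> fa_carrier l; v \<in> fa_carrier l\<rbrakk> \<Longrightarrow>
    vadd hreg (hecke_mult b c l (helt u) (helt v)) (vscale hreg a (helt u)) = helt (fa_mult u v + (\<lambda>x. a * u x))"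
  by (simp add: mult_elt vscale_elt vadd_elt fa_carrier_scale fa_carrier_mult)

lemma csubspace_ind: "csubspace hreg ind_span"
  unfolding ind_span_def
proof (intro cspace.csubspace_rep_span cspace_H subsetI, elim CollectE exE conjE)
  fix x h js
  assume x: "x = vadd hreg (hecke_mult b c l h (helt (word (map Eps js)))) (vscale hreg (- prod_list (map \<nu> js)) h)"
    and "h \<in> hecke_alg b c l" and js: "set js \<subseteq> {1..l}"
  then obtain u where u: "u \<in> fa_carrier l" "h = helt u" by (auto simp: hecke_alg_def)
  show "x \<in> vecs hreg"
    unfolding x u(2) vadd_mult_elt[OF u(1) Eps_word[OF js]] H_sel
    by (intro imageI fa_carrier_add fa_carrier_mult fa_carrier_scale u Eps_word js)
qed

text \<open>The vector \<open>u \<otimes> 1\<close> of the induced module. Every vector has this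
  form, so computations can be carried out on free algebra representatives.\<close>

definition ind_vec :: "fa \<Rightarrow> fa set set" where
  "ind_vec u = coset hreg ind_span (helt u)"

lemma cspace_Y: "cspace hind"
  unfolding Y_quotient by (rule csubspace.cspace_quotient[OF csubspace_ind])

lemma vecs_Y: "vecs hind = ind_vec ` fa_carrier l"
  unfolding Y_quotient csubspace.vecs_quotient[OF csubspace_ind] H_sel
  by (auto simp: ind_vec_def)

lemma ind_vec_mem: "u \<in> fa_carrier l \<Longrightarrow> ind_vec u \<in> vecs hind"
  by (simp add: vecs_Y)

lemma vadd_ind: "\<lbrakk>u \<in> fa_carrier l; v \<in> fa_carrier l\<rbrakk> \<Longrightarrow> vadd hind (ind_vec u) (ind_vec v) = ind_vec (u + v)"
  unfolding Y_quotient ind_vec_def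
  by (simp add: csubspace.vadd_quotient[OF csubspace_ind] H_sel vadd_elt)

lemma vscale_ind: "u \<in> fa_carrier l \<Longrightarrow> vscale hind a (ind_vec u) = ind_vec (\<lambda>x. a * u x)"
  unfolding Y_quotient ind_vec_def
  by (simp add: csubspace.vscale_quotient[OF csubspace_ind] H_sel vscale_elt)

lemma vzero_ind: "vzero hind = ind_vec 0"
  unfolding Y_quotient ind_vec_def
  by (simp add: csubspace.vzero_quotient[OF csubspace_ind] vzero_elt)

lemma ind_vec_cong: "\<lbrakk>u \<in> fa_carrier l; v \<in> fa_carrier l; u - v \<in> hideal\<rbrakk> \<Longrightarrow> ind_vec u = ind_vec v"
  unfolding ind_vec_def by (metis elt_eq_iff)

text \<open>Left multiplication turns a generator \<open>h s - \<nu>(s) h\<close> into the generator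
  with \<open>u h\<close> in place of \<open>h\<close>. So the span is a left ideal and the algebra
  acts on the quotient. Membership in the carrier is part of the induction because products are
  computed on representatives.\<close>

lemma ind_span_mult:
  assumes "u \<in> fa_carrier l" "x \<in> ind_span"
  shows "hecke_mult b c l (helt u) x \<in> ind_span"
  using assms(2) unfolding ind_span_def
proof -
  assume "x \<in> rep_span hreg
     {vadd hreg (hecke_mult b c l h (helt (word (map Eps js)))) (vscale hreg (- prod_list (map \<nu> js)) h)
      | h js. h \<in> hecke_alg b c l \<and> set js \<subseteq> {1..l}}" (is "_ \<in> rep_span hreg ?S")
  then have "x \<in> vecs hreg \<and> hecke_mult b c l (helt u) x \<in> rep_span hreg ?S"
  proof (induction rule: rep_span_induct)
    case (base x)
    then obtain v js where v: "v \<in> fa_carrier l" "set js \<subseteq> {1..l}" and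
      "x = vadd hreg (hecke_mult b c l (helt v) (helt (word (map Eps js)))) (vscale hreg (- prod_list (map \<nu> js)) (helt v))"
      by (auto simp: hecke_alg_def)
    then have x: "x = helt (fa_mult v (word (map Eps js)) + (\<lambda>x. - prod_list (map \<nu> js) * v x))"
      by (simp only: vadd_mult_elt Eps_word)
    have c: "fa_mult v (word (map Eps js)) + (\<lambda>x. - prod_list (map \<nu> js) * v x) \<in> fa_carrier l"
      using v by (intro fa_carrier_add fa_carrier_mult fa_carrier_scale Eps_word)
    have uv: "fa_mult u v \<in> fa_carrier l" using assms v by (intro fa_carrier_mult)
    have "hecke_mult b c l (helt u) x
        = helt (fa_mult (fa_mult u v) (word (map Eps js)) + (\<lambda>x. - prod_list (map \<nu> js) * fa_mult u v x))"
      unfolding x mult_elt[OF assms(1) c] fa_mult_add_right fa_mult_scale_right fa_mult_assoc ..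
    also have "\<dots> = vadd hreg (hecke_mult b c l (helt (fa_mult u v)) (helt (word (map Eps js))))
        (vscale hreg (- prod_list (map \<nu> js)) (helt (fa_mult u v)))"
      using v uv by (simp only: vadd_mult_elt Eps_word)
    also have "\<dots> \<in> rep_span hreg ?S"
      using v uv by (intro rep_span_superset[THEN subsetD]) (auto simp: hecke_alg_def)
    finally show ?case using c by (simp add: x H_sel)
  next
    case zero
    have "fa_mult u 0 = 0" by (rule ext) (simp add: fa_mult_def)
    then show ?case
      using rep_span_zero[of hreg] assms fa_carrier_zero[of l] by (simp add: vzero_elt mult_elt H_sel)
  next
    case (comb a a' x y)
    then obtain v w where vw: "x = helt v" "y = helt w" "v \<in> fa_carrier l" "w \<in> fa_carrier l"
      by (auto simp: H_sel)
    have "hecke_mult b c l (helt u) (vadd hreg (vscale hreg a x) (vscale hreg a' y)) =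
        vadd hreg (vscale hreg a (hecke_mult b c l (helt u) x)) (vscale hreg a' (hecke_mult b c l (helt u) y))"
      using vw assms
      by (simp add: vscale_elt vadd_elt mult_elt fa_carrier_scale fa_carrier_mult fa_carrier_add
          fa_mult_add_right fa_mult_scale_right)
    then show ?case using comb rep_span_comb[of _ hreg]
      by (simp add: cspace.add_mem[OF cspace_H] cspace.scale_mem[OF cspace_H])
  qed
  then show "hecke_mult b c l (helt u) x \<in> rep_span hreg ?S" ..
qed

lemma vact_ind:
  assumes u: "u \<in> fa_carrier l" and v: "v \<in> fa_carrier l"
  shows "vact hind (helt u) (ind_vec v) = ind_vec (fa_mult u v)"
proof -
  have "vact hind (helt u) (ind_vec v) = coset hreg ind_span (vact hreg (helt u) (helt v))"
    unfolding Y_quotient ind_vec_def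
  proof (rule csubspace.vact_quotient[OF csubspace_ind])
    fix x assume "x \<in> ind_span"
    then show "vact hreg (helt u) x \<in> ind_span" using ind_span_mult u by (simp add: H_sel)
  qed (use assms in \<open>auto simp: H_sel vadd_elt mult_elt fa_carrier_mult fa_carrier_add fa_mult_add_right\<close>)
  then show ?thesis using assms by (simp add: H_sel mult_elt ind_vec_def)
qed

text \<open>The case of a monomial with one letter: an \<open>Eps\<close> letter at the right end
  becomes a scalar.\<close>

lemma ind_vec_Eps:
  assumes "u \<in> fa_carrier l" "i \<in> {1..l}"
  shows "ind_vec (fa_mult u (word [Eps i])) = vscale hind (\<nu> i) (ind_vec u)"
proof -
  let ?e = "fa_mult u (word [Eps i])"
  have e: "?e \<in> fa_carrier l" using assms by (intro fa_carrier_mult fa_word_Eps)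
  have "vadd hreg (hecke_mult b c l (helt u) (helt (word (map Eps [i])))) (vscale hreg (- prod_list (map \<nu> [i])) (helt u))
      \<in> ind_span"
    unfolding ind_span_def using assms
    by (intro rep_span_superset[THEN subsetD] CollectI exI[of _ "helt u"] exI[of _ "[i]"])
      (simp add: hecke_alg_def)
  then have "vadd hreg (helt ?e) (vscale hreg (- 1) (helt (\<lambda>x. \<nu> i * u x))) \<in> ind_span"
    using assms by (simp add: mult_elt fa_word_Eps vscale_elt fa_carrier_scale)
  then show ?thesis
    unfolding vscale_ind[OF assms(1)] unfolding ind_vec_def
    using e assms by (subst csubspace.coset_eq_iff[OF csubspace_ind]) (auto simp: H_sel fa_carrier_scale)
qed

end

end

section \<open>Spanning by the hyperoctahedral group, and invariance from generators\<close>

context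
  fixes b c :: complex and l :: nat and \<nu> :: "nat \<Rightarrow> complex"
begin

private abbreviation "Y \<equiv> induced_module b c l \<nu>"
private abbreviation "I \<equiv> hecke_ideal b c l"
private abbreviation "elt \<equiv> hecke_elt b c l"
private abbreviation "iv \<equiv> ind_vec b c l \<nu>"

lemma vact_ind_mem: "\<lbrakk>u \<in> fa_carrier l; x \<in> vecs Y\<rbrakk> \<Longrightarrow> vact Y (elt u) x \<in> vecs Y"
  by (auto simp: vecs_Y vact_ind fa_carrier_mult)

lemma vact_ind_comb:
  assumes "u \<in> fa_carrier l" "x \<in> vecs Y" "y \<in> vecs Y"
  shows "vact Y (elt u) (vadd Y (vscale Y a x) (vscale Y a' y)) =
    vadd Y (vscale Y a (vact Y (elt u) x)) (vscale Y a' (vact Y (elt u) y))"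
proof -
  obtain v w where "v \<in> fa_carrier l" "w \<in> fa_carrier l" "x = iv v" "y = iv w"
    using assms by (auto simp: vecs_Y)
  then show ?thesis using assms(1)
    by (simp add: vscale_ind vadd_ind vact_ind fa_carrier_scale fa_carrier_add fa_carrier_mult
        fa_mult_add_right fa_mult_scale_right)
qed

lemma vact_ind_mult:
  assumes "u \<in> fa_carrier l" "v \<in> fa_carrier l" "x \<in> vecs Y"
  shows "vact Y (elt (fa_mult u v)) x = vact Y (elt u) (vact Y (elt v) x)"
  using assms by (auto simp: vecs_Y vact_ind fa_carrier_mult fa_mult_assoc)

lemma vact_ind_cong:
  assumes "u \<in> fa_carrier l" "v \<in> fa_carrier l" "u - v \<in> I"
  shows "vact Y (elt u) x = vact Y (elt v) x"
  using assms elt_eq_iff by metis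

lemma vact_ind_one: "x \<in> vecs Y \<Longrightarrow> vact Y (elt (word [])) x = x"
  by (auto simp: vecs_Y vact_ind fa_mult_one_left fa_carrier_word)

lemma vact_Grp_comp:
  assumes "v \<in> W_grp l" "w \<in> W_grp l" "x \<in> vecs Y"
  shows "vact Y (elt (word [Grp (v \<circ> w)])) x = vact Y (elt (word [Grp v])) (vact Y (elt (word [Grp w])) x)"
proof -
  have "word [Grp v, Grp w] = fa_mult (word [Grp v]) (word [Grp w])" by (simp add: fa_mult_word)
  then show ?thesis
    using vact_ind_cong[OF _ _ rel_Grp_Grp[OF assms(1,2)]] assms
    by (metis vact_ind_mult fa_carrier_mult fa_word_Grp W_grp_comp)
qed

lemma vact_Grp_id: "x \<in> vecs Y \<Longrightarrow> vact Y (elt (word [Grp id])) x = x"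
  using vact_ind_cong[OF _ _ rel_Grp_id] vact_ind_one
  by (metis fa_word_Grp W_grp_id fa_carrier_word empty_subsetI list.set(1))

text \<open>All cross relations are brought to the single shape
  \<open>\<epsilon>_i s = \<sigma> s \<epsilon>_i' + a\<close>, so that \<open>T_step\<close> can
  treat every simple reflection alike. Here \<open>\<sigma>\<close> is 1 and \<open>a\<close> is
  \<open>b\<close>, \<open>- b\<close> or 0.\<close>

lemma Eps_past_adj:
  assumes "i \<in> {1..l}" "j \<in> {1..<l}"
  obtains i' \<sigma> a where "i' \<in> {1..l}"
    "word [Eps i, Grp (s_adj j)] - ((\<lambda>x. \<sigma> * word [Grp (s_adj j), Eps i'] x) + fa_const a) \<in> I"
proof -
  let ?s = "Grp (s_adj j)"
  consider "i = j" | "i = j + 1" | "i \<noteq> j" "i \<noteq> j + 1" by blast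
  then show ?thesis
  proof cases
    case 1
    note rel_adj_Eps_swap[OF assms(2), where b=b and c=c]
    also have "word [Eps j, ?s] - word [?s, Eps (j + 1)] - fa_const b
        = word [Eps i, ?s] - ((\<lambda>x. 1 * word [?s, Eps (j + 1)] x) + fa_const b)"
      by (rule ext) (simp add: 1)
    finally show ?thesis by (rule that[rotated]) (use assms 1 in auto)
  next
    case 2
    note ideal_minus[OF rel_adj_Eps[OF assms(2), where b=b and c=c]]
    also have "- (word [?s, Eps j] - word [Eps (j + 1), ?s] - fa_const b)
        = word [Eps i, ?s] - ((\<lambda>x. 1 * word [?s, Eps j] x) + fa_const (- b))"
      by (rule ext) (simp add: 2 fa_const_def)
    finally show ?thesis by (rule that[rotated]) (use assms 2 in auto)
  next
    case 3
    note ideal_minus[OF rel_adj_Eps_other[OF assms(2,1) 3, where b=b and c=c]]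
    also have "- (word [?s, Eps i] - word [Eps i, ?s])
        = word [Eps i, ?s] - ((\<lambda>x. 1 * word [?s, Eps i] x) + fa_const 0)"
      by (rule ext) (simp add: fa_const_def)
    finally show ?thesis by (rule that[rotated]) (use assms in auto)
  qed
qed

text \<open>The same shape for the last sign change; \<open>\<sigma>\<close> is -1 and
  \<open>a\<close> is \<open>2 * c\<close> at \<open>i = l\<close>.\<close>

lemma Eps_past_eps:
  assumes "i \<in> {1..l}"
  obtains i' \<sigma> a where "i' \<in> {1..l}"
    "word [Eps i, Grp (s_eps l)] - ((\<lambda>x. \<sigma> * word [Grp (s_eps l), Eps i'] x) + fa_const a) \<in> I"
proof -
  let ?s = "Grp (s_eps l)"
  show ?thesis
  proof (cases "i = l")
    case True
    have "1 \<le> l" using assms by simp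
    note rel_eps_Eps[OF this, where b=b and c=c]
    also have "word [?s, Eps l] + word [Eps l, ?s] - fa_const (2 * c)
        = word [Eps i, ?s] - ((\<lambda>x. (- 1) * word [?s, Eps i] x) + fa_const (2 * c))"
      by (rule ext) (simp add: True fa_const_def)
    finally show ?thesis by (rule that[rotated]) (use assms in auto)
  next
    case False
    note ideal_minus[OF rel_eps_Eps_other[OF assms False, where b=b and c=c]]
    also have "- (word [?s, Eps i] - word [Eps i, ?s])
        = word [Eps i, ?s] - ((\<lambda>x. 1 * word [?s, Eps i] x) + fa_const 0)"
      by (rule ext) (simp add: fa_const_def)
    finally show ?thesis by (rule that[rotated]) (use assms in auto)
  qed
qed

text \<open>The aim is that \<open>T\<close> is the whole module. For this it suffices that
  \<open>T\<close> contains the class of the empty word and is stable under every letter.\<close>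

private abbreviation "T \<equiv> rep_span Y ((\<lambda>w. iv (word [Grp w])) ` W_grp l)"

private lemma T_sub: "csubspace Y T"
  by (intro cspace.csubspace_rep_span cspace_Y) (auto intro!: ind_vec_mem fa_word_Grp)

private lemma T_vact:
  assumes "u \<in> fa_carrier l" "x \<in> T"
    and "\<And>w. w \<in> W_grp l \<Longrightarrow> vact Y (elt u) (iv (word [Grp w])) \<in> T"
  shows "vact Y (elt u) x \<in> T"
proof -
  have "x \<in> vecs Y \<and> vact Y (elt u) x \<in> T"
    using assms(2)
  proof (induction rule: rep_span_induct)
    case (base x)
    then show ?case using assms(3) by (auto intro!: ind_vec_mem fa_word_Grp)
  next
    case zero
    have "fa_mult u 0 = 0" by (rule ext) (simp add: fa_mult_def)
    then show ?case
      using csubspace.sub_zero[OF T_sub] assms(1) fa_carrier_zero[of l] cspace.zero_mem[OF cspace_Y]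
      unfolding vzero_ind by (simp add: vact_ind)
  next
    case (comb a a' x y)
    then show ?case
      using assms(1) csubspace.sub_comb[OF T_sub]
      by (auto simp: vact_ind_comb intro!: cspace.add_mem[OF cspace_Y] cspace.scale_mem[OF cspace_Y])
  qed
  then show ?thesis ..
qed

private lemma T_Grp: "\<lbrakk>v \<in> W_grp l; x \<in> T\<rbrakk> \<Longrightarrow> vact Y (elt (word [Grp v])) x \<in> T"
proof (rule T_vact)
  fix w assume vw: "v \<in> W_grp l" "w \<in> W_grp l"
  have "vact Y (elt (word [Grp v])) (iv (word [Grp w])) = iv (word [Grp v, Grp w])"
    using vw by (simp add: vact_ind fa_word_Grp fa_mult_word)
  also have "\<dots> = iv (word [Grp (v \<circ> w)])"
    using vw rel_Grp_Grp[OF vw]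
    by (intro ind_vec_cong fa_word_Grp W_grp_comp fa_carrier_word) (auto intro: letters_Grp)
  also have "\<dots> \<in> T"
    using W_grp_comp[OF vw] by (intro rep_span_superset[THEN subsetD]) blast
  finally show "vact Y (elt (word [Grp v])) (iv (word [Grp w])) \<in> T" .
qed (auto intro: fa_word_Grp)

text \<open>Modulo the ideal, \<open>\<epsilon>_i (s w) = (\<epsilon>_i s) w = \<sigma> s
  (\<epsilon>_i' w) + a w\<close>, and \<open>T\<close> is stable under \<open>s\<close>.\<close>

private lemma T_step:
  assumes s: "s \<in> W_grp l" and w: "w \<in> W_grp l" and i: "i \<in> {1..l}" "i' \<in> {1..l}"
    and r: "word [Eps i, Grp s] - ((\<lambda>x. \<sigma> * word [Grp s, Eps i'] x) + fa_const a) \<in> I"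
    and IH: "iv (word [Eps i', Grp w]) \<in> T"
  shows "iv (word [Eps i, Grp (s \<circ> w)]) \<in> T"
proof -
  have L: "Grp s \<in> letters l" "Grp w \<in> letters l" "Eps i \<in> letters l" "Eps i' \<in> letters l"
    "Grp (s \<circ> w) \<in> letters l"
    using assms by (auto intro: letters_Grp letters_Eps W_grp_comp)
  have "fa_mult (word [Eps i]) (word [Grp s, Grp w] - word [Grp (s \<circ> w)]) \<in> I"
    by (intro ideal_mult_left rel_Grp_Grp s w fa_carrier_word) (use L in auto)
  then have "word [Eps i, Grp s, Grp w] - word [Eps i, Grp (s \<circ> w)] \<in> I"
    by (simp add: fa_mult_diff_right fa_mult_word)
  then have "iv (word [Eps i, Grp (s \<circ> w)]) = iv (word [Eps i, Grp s, Grp w])"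
    using L by (intro ind_vec_cong[symmetric] fa_carrier_word) auto
  also have "\<dots> = iv ((\<lambda>x. \<sigma> * word [Grp s, Eps i', Grp w] x) + (\<lambda>x. a * word [Grp w] x))"
  proof (rule ind_vec_cong)
    have "fa_mult (word [Eps i, Grp s] - ((\<lambda>x. \<sigma> * word [Grp s, Eps i'] x) + fa_const a)) (word [Grp w]) \<in> I"
      using r w by (intro ideal_mult_right fa_word_Grp)
    then show "word [Eps i, Grp s, Grp w] -
       ((\<lambda>x. \<sigma> * word [Grp s, Eps i', Grp w] x) + (\<lambda>x. a * word [Grp w] x)) \<in> I"
      unfolding fa_const_word fa_mult_diff_left fa_mult_add_left fa_mult_scale_left fa_mult_word by simp
  qed (use L in \<open>auto intro!: fa_carrier_add fa_carrier_scale fa_carrier_word\<close>)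
  also have "\<dots> = vadd Y (vscale Y \<sigma> (vact Y (elt (word [Grp s])) (iv (word [Eps i', Grp w]))))
      (vscale Y a (iv (word [Grp w])))"
    using L by (simp add: vact_ind vscale_ind vadd_ind fa_carrier_word fa_carrier_scale fa_mult_word)
  also have "\<dots> \<in> T"
    using rep_span_superset[of "(\<lambda>w. iv (word [Grp w])) ` W_grp l" Y] w
    by (intro csubspace.sub_comb[OF T_sub] T_Grp s IH) blast
  finally show ?thesis .
qed

text \<open>Induction along an expression of \<open>w\<close> in simple reflections, for all
  \<open>i\<close> at once because passing a reflection changes the index. When no reflection is
  left, the \<open>Eps\<close> letter acts by the scalar \<open>\<nu> i\<close>.\<close>

private lemma T_Eps_Grp: "W_gen l w \<Longrightarrow> \<forall>i\<in>{1..l}. iv (word [Eps i, Grp w]) \<in> T"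
proof (induction rule: W_gen.induct)
  case W_gen_id
  show ?case
  proof
    fix i assume i: "i \<in> {1..l}"
    have L: "Grp id \<in> letters l" "Eps i \<in> letters l" using i by (auto intro: letters_Grp letters_Eps W_grp_id)
    have "fa_mult (word [Eps i]) (word [Grp id] - word []) \<in> I"
      by (intro ideal_mult_left rel_Grp_id fa_word_Eps i)
    then have "iv (word [Eps i, Grp id]) = iv (word [Eps i])"
      using L by (intro ind_vec_cong fa_carrier_word) (auto simp: fa_mult_diff_right fa_mult_word)
    also have "\<dots> = vscale Y (\<nu> i) (iv (word []))"
      using ind_vec_Eps[of "word []" l i] i by (simp add: fa_mult_one_left fa_carrier_word)
    also have "iv (word []) = iv (word [Grp id])"
      using rel_Grp_id[where b=b and c=c and l=l] ideal_minus[OF rel_Grp_id[where b=b and c=c and l=l]]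
      by (intro ind_vec_cong fa_carrier_word) (auto simp: L)
    also have "vscale Y (\<nu> i) (iv (word [Grp id])) \<in> T"
      using rep_span_superset[of "(\<lambda>w. iv (word [Grp w])) ` W_grp l" Y] W_grp_id
      by (intro csubspace.sub_scale[OF T_sub]) blast
    finally show "iv (word [Eps i, Grp id]) \<in> T" .
  qed
next
  case (W_gen_adj w j)
  show ?case
  proof
    fix i assume i: "i \<in> {1..l}"
    from Eps_past_adj[OF i W_gen_adj(2)] obtain i' \<sigma> a where "i' \<in> {1..l}"
      "word [Eps i, Grp (s_adj j)] - ((\<lambda>x. \<sigma> * word [Grp (s_adj j), Eps i'] x) + fa_const a) \<in> I" .
    then show "iv (word [Eps i, Grp (s_adj j \<circ> w)]) \<in> T"
      using W_gen_adj i s_adj_W W_gen_W by (intro T_step) auto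
  qed
next
  case (W_gen_eps w)
  show ?case
  proof
    fix i assume i: "i \<in> {1..l}"
    from Eps_past_eps[OF i] obtain i' \<sigma> a where "i' \<in> {1..l}"
      "word [Eps i, Grp (s_eps l)] - ((\<lambda>x. \<sigma> * word [Grp (s_eps l), Eps i'] x) + fa_const a) \<in> I" .
    then show "iv (word [Eps i, Grp (s_eps l \<circ> w)]) \<in> T"
      using W_gen_eps i s_eps_W[of l l] W_gen_W by (intro T_step) auto
  qed
qed

private lemma T_word: "set xs \<subseteq> letters l \<Longrightarrow> iv (word xs) \<in> T"
proof (induction xs)
  case Nil
  have "iv (word []) = iv (word [Grp id])"
    using ideal_minus[OF rel_Grp_id[where b=b and c=c and l=l]]
    by (intro ind_vec_cong fa_carrier_word) (auto intro: letters_Grp W_grp_id)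
  then show ?case
    using rep_span_superset[of "(\<lambda>w. iv (word [Grp w])) ` W_grp l" Y] W_grp_id by auto
next
  case (Cons x xs)
  then have x: "x \<in> letters l" "iv (word xs) \<in> T" "set xs \<subseteq> letters l" by auto
  have "vact Y (elt (word [x])) (iv (word xs)) \<in> T"
  proof (cases x)
    case (Eps i)
    then have i: "i \<in> {1..l}" using x by (auto simp: letters_def)
    show ?thesis
    proof (rule T_vact)
      fix w assume w: "w \<in> W_grp l"
      then have "vact Y (elt (word [x])) (iv (word [Grp w])) = iv (word [Eps i, Grp w])"
        using x Eps i by (simp add: vact_ind fa_word_Grp fa_word_Eps fa_mult_word)
      then show "vact Y (elt (word [x])) (iv (word [Grp w])) \<in> T"
        using T_Eps_Grp[OF W_grp_gen[OF w]] i by simp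
    qed (use x in \<open>auto intro: fa_carrier_word\<close>)
  next
    case (Grp w)
    then show ?thesis using x T_Grp by (auto simp: letters_def)
  qed
  then show ?case using x by (simp add: vact_ind fa_carrier_word fa_mult_word)
qed

text \<open>The spanning half of the decomposition of the algebra into group algebra times
  polynomials. It provides the finite dimension on which the orthogonal projections rest.\<close>

lemma ind_vec_W_span: "vecs Y \<subseteq> rep_span Y ((\<lambda>w. iv (word [Grp w])) ` W_grp l)"
proof -
  have "iv u \<in> T" if "u \<in> fa_carrier l" for u
    using that
  proof (induction u rule: fa_carrier_induct)
    case zero
    then show ?case using csubspace.sub_zero[OF T_sub] by (simp only: vzero_ind)
  next
    case (word x)
    then show ?case by (rule T_word)
  next
    case (comb a u v)
    have "iv ((\<lambda>x. a * u x) + v) = vadd Y (vscale Y a (iv u)) (vscale Y 1 (iv v))"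
      using comb by (simp add: vscale_ind vadd_ind fa_carrier_scale)
    then show ?case using csubspace.sub_comb[OF T_sub] comb by (simp only:)
  qed
  then show ?thesis by (auto simp: vecs_Y)
qed

text \<open>Since \<open>w\<^sub>0\<close> is central in \<open>W(B\<^sub>l)\<close>, invariance under \<open>W(B\<^sub>l)\<close> does not involve it.\<close>

lemma invariant_form_generators:
  fixes F :: "fa set set \<Rightarrow> fa set set \<Rightarrow> complex"
  defines "w0 \<equiv> hecke_grp b c l (w_longest l)"
  assumes real: "cnj b = b" "cnj c = c"
    and F: "hermitian_form Y F"
    and eps: "\<And>i x y. \<lbrakk>i \<in> {1..l}; x \<in> vecs Y; y \<in> vecs Y\<rbrakk> \<Longrightarrow>
      F (vact Y (hecke_eps b c l i) x) y = F x (vact Y w0 (vact Y (hecke_eps b c l i) (vact Y w0 y)))"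
    and adj: "\<And>i x y. \<lbrakk>i \<in> {1..<l}; x \<in> vecs Y; y \<in> vecs Y\<rbrakk> \<Longrightarrow>
      F (vact Y (hecke_grp b c l (s_adj i)) x) y = F x (vact Y (hecke_grp b c l (s_adj i)) y)"
    and seps: "\<And>i x y. \<lbrakk>i \<in> {1..l}; x \<in> vecs Y; y \<in> vecs Y\<rbrakk> \<Longrightarrow>
      F (vact Y (hecke_grp b c l (s_eps i)) x) y = F x (vact Y (hecke_grp b c l (s_eps i)) y)"
  shows "invariant_form (hecke_alg b c l) (hecke_star b c l) Y F"
proof -
  let ?w = "word [Grp (w_longest l)]"
  note lin = F[unfolded hermitian_form_def, rule_format]
  have car: "?w \<in> fa_carrier l" by (simp add: fa_word_Grp w_longest_W)
  have grp: "F (vact Y (elt (word [Grp w])) x) y = F x (vact Y (elt (word [Grp (inv w)])) y)"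
    if "W_gen l w" "x \<in> vecs Y" "y \<in> vecs Y" for w x y
    using that
  proof (induction arbitrary: x y rule: W_gen.induct)
    case W_gen_id
    then show ?case using vact_Grp_id by (simp add: id_def[symmetric])
  next
    case (W_gen_adj w i)
    have w: "w \<in> W_grp l" "s_adj i \<in> W_grp l" using W_gen_adj W_gen_W s_adj_W by auto
    have inv: "inv (s_adj i \<circ> w) = inv w \<circ> s_adj i"
      using W_gen_adj w by (simp add: o_inv_distrib W_grp_bij inv_s_adj)
    have "F (vact Y (elt (word [Grp (s_adj i \<circ> w)])) x) y
        = F (vact Y (hecke_grp b c l (s_adj i)) (vact Y (elt (word [Grp w])) x)) y"
      using vact_Grp_comp w W_gen_adj by (simp add: hecke_grp_def)
    also have "\<dots> = F x (vact Y (elt (word [Grp (inv w)])) (vact Y (elt (word [Grp (s_adj i)])) y))"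
      using W_gen_adj w by (simp add: adj[unfolded hecke_grp_def] vact_ind_mem fa_word_Grp hecke_grp_def)
    also have "\<dots> = F x (vact Y (elt (word [Grp (inv (s_adj i \<circ> w))])) y)"
      using vact_Grp_comp[of "inv w" "s_adj i" y] w W_gen_adj W_grp_inv by (simp only: inv)
    finally show ?case .
  next
    case (W_gen_eps w)
    have w: "w \<in> W_grp l" "s_eps l \<in> W_grp l" using W_gen_eps W_gen_W s_eps_W[of l l] by auto
    have inv: "inv (s_eps l \<circ> w) = inv w \<circ> s_eps l"
      using W_gen_eps w by (simp add: o_inv_distrib W_grp_bij inv_s_eps)
    have "F (vact Y (elt (word [Grp (s_eps l \<circ> w)])) x) y
        = F (vact Y (hecke_grp b c l (s_eps l)) (vact Y (elt (word [Grp w])) x)) y"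
      using vact_Grp_comp w W_gen_eps by (simp add: hecke_grp_def)
    also have "\<dots> = F x (vact Y (elt (word [Grp (inv w)])) (vact Y (elt (word [Grp (s_eps l)])) y))"
      using W_gen_eps w by (simp add: seps[unfolded hecke_grp_def] vact_ind_mem fa_word_Grp hecke_grp_def)
    also have "\<dots> = F x (vact Y (elt (word [Grp (inv (s_eps l \<circ> w))])) y)"
      using vact_Grp_comp[of "inv w" "s_eps l" y] w W_gen_eps W_grp_inv by (simp only: inv)
    finally show ?case .
  qed
  have ww: "vact Y (elt ?w) (vact Y (elt ?w) y) = y" if "y \<in> vecs Y" for y
    using vact_Grp_comp[OF w_longest_W w_longest_W that] vact_Grp_id[OF that]
    by (simp add: w_longest_square)
  have letter: "F (vact Y (elt (word [a])) x) y
      = F x (vact Y (elt ?w) (vact Y (elt (word [letter_bullet a])) (vact Y (elt ?w) y)))"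
    if "a \<in> letters l" "x \<in> vecs Y" "y \<in> vecs Y" for a x y
  proof (cases a)
    case (Eps i)
    then show ?thesis using that eps[of i x y] by (auto simp: letters_def w0_def hecke_eps_def hecke_grp_def)
  next
    case (Grp w)
    then have w: "w \<in> W_grp l" using that by (auto simp: letters_def)
    have "vact Y (elt ?w) (vact Y (elt (word [Grp (inv w)])) (vact Y (elt ?w) y))
        = vact Y (elt (word [Grp (w_longest l \<circ> inv w \<circ> w_longest l)])) y"
      using that w by (simp add: vact_Grp_comp W_grp_inv w_longest_W W_grp_comp vact_ind_mem fa_word_Grp)
    then show ?thesis
      using Grp that w grp[OF W_grp_gen[OF w]] by (simp add: W_grp_bij w_longest_conj W_grp_inv)
  qed
  \<comment> \<open>Letters leave the first argument one by one and arrive in the second in reverse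
    order, each between two copies of \<open>?w\<close>; adjacent copies cancel by
    \<open>ww\<close>.\<close>
  have inv_word: "F (vact Y (elt (word xs)) x) y
      = F x (vact Y (elt ?w) (vact Y (elt (fa_bullet (word xs))) (vact Y (elt ?w) y)))"
    if "set xs \<subseteq> letters l" "x \<in> vecs Y" "y \<in> vecs Y" for xs x y
    using that
  proof (induction xs arbitrary: y)
    case Nil
    then show ?case using ww by (simp add: fa_bullet_word vact_ind_one vact_ind_mem car)
  next
    case (Cons a xs)
    have a: "word [a] \<in> fa_carrier l" "word xs \<in> fa_carrier l" "word [letter_bullet a] \<in> fa_carrier l"
      "fa_bullet (word xs) \<in> fa_carrier l"
      using Cons.prems by (auto intro!: fa_carrier_word fa_bullet_carrier letter_bullet_letters)
    have "F (vact Y (elt (word (a # xs))) x) y = F (vact Y (elt (word [a])) (vact Y (elt (word xs)) x)) y"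
      using a Cons.prems by (simp add: vact_ind_mult[symmetric] fa_mult_word)
    also have "\<dots> = F x (vact Y (elt ?w) (vact Y (elt (fa_bullet (word xs))) (vact Y (elt ?w)
        (vact Y (elt ?w) (vact Y (elt (word [letter_bullet a])) (vact Y (elt ?w) y))))))"
      using a Cons by (simp add: letter vact_ind_mem car)
    also have "\<dots> = F x (vact Y (elt ?w) (vact Y (elt (fa_mult (fa_bullet (word xs)) (word [letter_bullet a])))
        (vact Y (elt ?w) y)))"
      using a Cons.prems by (simp add: ww vact_ind_mem car vact_ind_mult)
    also have "fa_mult (fa_bullet (word xs)) (word [letter_bullet a]) = fa_bullet (word (a # xs))"
      by (simp add: fa_bullet_word fa_mult_word)
    finally show ?case .
  qed
  have all: "F (vact Y (elt u) x) y
      = F x (vact Y (elt ?w) (vact Y (elt (fa_bullet u)) (vact Y (elt ?w) y)))"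
    if "u \<in> fa_carrier l" "x \<in> vecs Y" "y \<in> vecs Y" for u x y
    using that
  proof (induction u rule: fa_carrier_induct)
    case zero
    \<comment> \<open>\<open>hermitian_form\<close> speaks only of linear combinations, so the zero
      vector is written as one.\<close>
    have z: "vact Y (elt 0) x = vadd Y (vscale Y 0 x) (vscale Y 0 x)" if x: "x \<in> vecs Y" for x
    proof -
      obtain v where v: "v \<in> fa_carrier l" "x = iv v" using x by (auto simp: vecs_Y)
      have "fa_mult 0 v = 0" by (rule ext) (simp add: fa_mult_def)
      moreover have "(\<lambda>x. 0 * v x) + (\<lambda>x. 0 * v x) = 0" by (rule ext) simp
      ultimately show ?thesis using v
        by (simp only: vact_ind fa_carrier_zero vscale_ind vadd_ind fa_carrier_scale)
    qed
    let ?y = "vact Y (elt ?w) y"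
    have y: "?y \<in> vecs Y" using zero by (intro vact_ind_mem car)
    have "F (vact Y (elt 0) x) y = 0" unfolding z[OF zero(1)] using lin zero by simp
    moreover have "F x (vact Y (elt ?w) (vact Y (elt (fa_bullet 0)) ?y)) = 0"
      unfolding fa_bullet_zero z[OF y] vact_ind_comb[OF car y y]
      using lin zero vact_ind_mem[OF car y] by simp
    ultimately show ?case by (rule trans[OF _ sym])
  next
    case (word xs)
    then show ?case by (rule inv_word)
  next
    case (comb a u v)
    have *: "vact Y (elt ((\<lambda>x. a * u x) + v)) x = vadd Y (vscale Y a (vact Y (elt u) x)) (vscale Y 1 (vact Y (elt v) x))"
      if uvx: "u \<in> fa_carrier l" "v \<in> fa_carrier l" "x \<in> vecs Y" for a u v x
    proof -
      obtain v' where "v' \<in> fa_carrier l" "x = iv v'" using uvx by (auto simp: vecs_Y)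
      then show ?thesis using uvx
        by (simp add: vact_ind vscale_ind vadd_ind fa_carrier_scale fa_carrier_add fa_carrier_mult
          fa_mult_add_left fa_mult_scale_left)
    qed
    let ?y = "vact Y (elt ?w) y"
    have y: "?y \<in> vecs Y" using comb by (intro vact_ind_mem car)
    have bc: "fa_bullet u \<in> fa_carrier l" "fa_bullet v \<in> fa_carrier l"
      using comb fa_bullet_carrier by auto
    show ?case
      unfolding fa_bullet_add fa_bullet_scale *[OF comb(1,2,5)] *[OF bc y]
      using comb bc y lin by (simp add: vact_ind_comb vact_ind_mem car)
  qed
  show ?thesis
    unfolding invariant_form_def
  proof (intro ballI)
    fix h x y assume "h \<in> hecke_alg b c l" and xy: "x \<in> vecs Y" "y \<in> vecs Y"
    then obtain u where u: "u \<in> fa_carrier l" "h = elt u" by (auto simp: hecke_alg_def)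
    have "vact Y (hecke_star b c l h) y = vact Y (elt ?w) (vact Y (elt (fa_bullet u)) (vact Y (elt ?w) y))"
      unfolding u star_elt[OF real u(1)]
      using xy u car fa_bullet_carrier by (simp add: vact_ind_mult fa_carrier_mult vact_ind_mem)
    then show "F (vact Y h x) y = F x (vact Y (hecke_star b c l h) y)"
      using all[OF u(1) xy] u by simp
  qed
qed

end

section \<open>Tensor products\<close>

definition fun_subspace :: "('a \<Rightarrow> complex) set \<Rightarrow> bool" where
  "fun_subspace X \<longleftrightarrow> 0 \<in> X \<and> (\<forall>f\<in>X. \<forall>g\<in>X. \<forall>a b. (\<lambda>x. a * f x + b * g x) \<in> X)"

lemma fun_subspace_comb:
  "\<lbrakk>fun_subspace X; f \<in> X; g \<in> X\<rbrakk> \<Longrightarrow> (\<lambda>x. a * f x + b * g x) \<in> X"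
  by (simp add: fun_subspace_def)

lemma fun_subspace_add: "\<lbrakk>fun_subspace X; f \<in> X; g \<in> X\<rbrakk> \<Longrightarrow> f + g \<in> X"
  using fun_subspace_comb[of X f g 1 1] by (simp add: plus_fun_def)

lemma fun_subspace_scale: "\<lbrakk>fun_subspace X; f \<in> X\<rbrakk> \<Longrightarrow> (\<lambda>x. a * f x) \<in> X"
  using fun_subspace_comb[of X f f a 0] by simp

lemma fun_subspace_sum:
  assumes "fun_subspace X" "finite A" "\<And>k. k \<in> A \<Longrightarrow> f k \<in> X"
  shows "(\<lambda>x. \<Sum>k\<in>A. c k * f k x) \<in> X"
  using assms(2,3)
proof (induction A rule: finite_induct)
  case empty
  then show ?case using assms(1) by (simp add: fun_subspace_def zero_fun_def)
next
  case (insert k A)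
  have "(\<lambda>x. c k * f k x) + (\<lambda>x. \<Sum>k\<in>A. c k * f k x) \<in> X"
    using insert by (intro fun_subspace_add fun_subspace_scale assms(1)) auto
  then show ?case using insert(1,2) by (simp add: plus_fun_def)
qed

text \<open>This is \<open>hermitian_form\<close> for functions with pointwise operations, freed
  from the record so that it applies to the components \<open>t J\<close> of a tensor.\<close>

definition sesquilinear_on :: "('a \<Rightarrow> complex) set \<Rightarrow> (('a \<Rightarrow> complex) \<Rightarrow> ('a \<Rightarrow> complex) \<Rightarrow> complex) \<Rightarrow> bool" where
  "sesquilinear_on X h \<longleftrightarrow> (\<forall>x\<in>X. \<forall>y\<in>X. \<forall>z\<in>X. \<forall>a b.
     h (\<lambda>g. a * x g + b * y g) z = a * h x z + b * h y z \<and>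
     h z (\<lambda>g. a * x g + b * y g) = cnj a * h z x + cnj b * h z y)"

lemma sesquilinear_onD:
  assumes "sesquilinear_on X h" "x \<in> X" "y \<in> X" "z \<in> X"
  shows "h (\<lambda>g. a * x g + b * y g) z = a * h x z + b * h y z"
    and "h z (\<lambda>g. a * x g + b * y g) = cnj a * h z x + cnj b * h z y"
  using assms by (simp_all add: sesquilinear_on_def)

lemma sesquilinear_zero:
  assumes "fun_subspace X" "sesquilinear_on X h" "x \<in> X"
  shows "h (\<lambda>_. 0) x = 0" "h x (\<lambda>_. 0) = 0"
proof -
  have "(\<lambda>_. 0) \<in> X" using assms(1) by (simp add: fun_subspace_def zero_fun_def)
  from sesquilinear_onD[OF assms(2) this this assms(3), of 0 0]
  show "h (\<lambda>_. 0) x = 0" "h x (\<lambda>_. 0) = 0" by simp_all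
qed

lemma sesquilinear_sum:
  assumes X: "fun_subspace X" and h: "sesquilinear_on X h"
    and "finite A" "\<And>k. k \<in> A \<Longrightarrow> f k \<in> X" and y: "y \<in> X"
  shows "h (\<lambda>x. \<Sum>k\<in>A. c k * f k x) y = (\<Sum>k\<in>A. c k * h (f k) y)"
    and "h y (\<lambda>x. \<Sum>k\<in>A. c k * f k x) = (\<Sum>k\<in>A. cnj (c k) * h y (f k))"
  using assms(3,4)
proof (induction A rule: finite_induct)
  case empty
  case 1 then show ?case using sesquilinear_zero[OF X h y] by simp
  case 2 then show ?case using sesquilinear_zero[OF X h y] by simp
next
  case (insert k A)
  have m: "f k \<in> X" "(\<lambda>x. \<Sum>k\<in>A. c k * f k x) \<in> X" if "\<And>k'. k' \<in> insert k A \<Longrightarrow> f k' \<in> X"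
    using that insert(1) by (auto intro: fun_subspace_sum[OF X])
  note * = sesquilinear_onD[OF h m y, of "c k" 1]
  case 1 then show ?case using insert *(1) by simp
  case 2 then show ?case using insert *(2) by simp
qed

lemma finite_lists_length [simp]: "finite {J :: 'm::finite list. length J = l}"
  using finite_lists_length_eq[of "UNIV :: 'm set" l] by simp

text \<open>The map from \<open>(J, a)\<close> to \<open>(J[k := a], J ! k)\<close>, which exchanges
  the old entry and the new one, is an involution. The lemma transposes a matrix acting in one
  tensor slot.\<close>

lemma sum_list_update_swap:
  fixes f :: "'m::finite list \<Rightarrow> 'm list \<Rightarrow> 'b::comm_monoid_add"
  assumes "k < l"
  shows "(\<Sum>J | length J = l. \<Sum>a\<in>UNIV. f J (J[k := a])) = (\<Sum>J | length J = l. \<Sum>a\<in>UNIV. f (J[k := a]) J)"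
  unfolding sum.cartesian_product
  by (rule sum.reindex_bij_witness[where i="\<lambda>(J,a). (J[k := a], J ! k)" and j="\<lambda>(J,a). (J[k := a], J ! k)"])
     (use assms in auto)

lemma V_leg_commute:
  assumes "i \<noteq> j" "1 \<le> i" "1 \<le> j"
  shows "V_leg i Z (V_leg j Z' t) = V_leg j Z' (V_leg i Z t)"
proof (intro ext)
  fix J g
  have ij: "i - 1 \<noteq> j - 1" using assms by auto
  have "V_leg i Z (V_leg j Z' t) J g
     = (\<Sum>a\<in>UNIV. \<Sum>b\<in>UNIV. Z $ (J!(i-1)) $ a * (Z' $ (J!(j-1)) $ b * t (J[i-1:=a, j-1:=b]) g))"
    using ij by (simp add: V_leg_def sum_distrib_left)
  also have "\<dots> = (\<Sum>b\<in>UNIV. \<Sum>a\<in>UNIV. Z' $ (J!(j-1)) $ b * (Z $ (J!(i-1)) $ a * t (J[j-1:=b, i-1:=a]) g))"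
    by (subst sum.swap, intro sum.cong refl, subst list_update_swap[OF ij]) (simp only: mult.left_commute)
  also have "\<dots> = V_leg j Z' (V_leg i Z t) J g"
    using ij by (simp add: V_leg_def sum_distrib_left)
  finally show "V_leg i Z (V_leg j Z' t) J g = V_leg j Z' (V_leg i Z t) J g" .
qed

lemma V_leg_mult:
  assumes "t \<in> tensors X l" "i \<in> {1..l}"
  shows "V_leg i Z (V_leg i Z' t) = V_leg i (Z ** Z') t"
proof (intro ext)
  fix J g
  show "V_leg i Z (V_leg i Z' t) J g = V_leg i (Z ** Z') t J g"
  proof (cases "length J = l")
    case True
    then have "i - 1 < length J" using assms(2) by auto
    then have "V_leg i Z (V_leg i Z' t) J g
     = (\<Sum>a\<in>UNIV. \<Sum>b\<in>UNIV. Z $ (J!(i-1)) $ a * Z' $ a $ b * t (J[i-1:=b]) g)"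
      by (simp add: V_leg_def sum_distrib_left mult.assoc)
    also have "\<dots> = (\<Sum>b\<in>UNIV. \<Sum>a\<in>UNIV. Z $ (J!(i-1)) $ a * Z' $ a $ b * t (J[i-1:=b]) g)"
      by (rule sum.swap)
    also have "\<dots> = V_leg i (Z ** Z') t J g"
      by (simp add: V_leg_def matrix_matrix_mult_def sum_distrib_right)
    finally show ?thesis .
  next
    \<comment> \<open>For short lists the update may have no effect, so this case cannot follow the
      computation above; \<open>t\<close> vanishes on all lists of a wrong length.\<close>
    case False
    then have "t (J[i-1:=a, i-1:=b]) = 0" "t (J[i-1:=b]) = 0" for a b
      using assms(1) by (auto simp: tensors_def)
    then show ?thesis by (simp add: V_leg_def)
  qed
qed

lemma V_leg_id: "t \<in> tensors X l \<Longrightarrow> i \<in> {1..l} \<Longrightarrow> V_leg i (mat 1) t = t"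
proof (intro ext)
  fix J g
  assume t: "t \<in> tensors X l" and i: "i \<in> {1..l}"
  have "V_leg i (mat 1) t J g = (\<Sum>a\<in>UNIV. if a = J!(i-1) then t (J[i-1:=a]) g else 0)"
    unfolding V_leg_def mat_def by (intro sum.cong) auto
  then show "V_leg i (mat 1) t J g = t J g" by simp
qed

lemma V_leg_add: "V_leg i Z (t + t') = V_leg i Z t + V_leg i Z t'"
  by (intro ext) (simp add: V_leg_def distrib_left sum.distrib)

lemma V_leg_comb:
  "V_leg i Z (\<lambda>J g. a * t J g + b * t' J g) = (\<lambda>J g. a * V_leg i Z t J g + b * V_leg i Z t' J g)"
  by (intro ext) (simp add: V_leg_def distrib_left sum.distrib sum_distrib_left mult.left_commute)

lemma V_leg_mem:
  assumes "fun_subspace X" "t \<in> tensors X l"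
  shows "V_leg i Z t \<in> tensors X l"
  unfolding tensors_def
proof (intro CollectI conjI allI impI)
  fix J :: "'a list" assume "length J = l"
  then have "(\<lambda>g. \<Sum>a\<in>UNIV. Z $ (J ! (i - 1)) $ a * t (J[i - 1 := a]) g) \<in> X"
    using assms(2) by (intro fun_subspace_sum[OF assms(1)]) (auto simp: tensors_def)
  then show "V_leg i Z t J \<in> X" by (simp add: V_leg_def[abs_def])
next
  fix J :: "'a list" assume "length J \<noteq> l"
  then show "V_leg i Z t J = 0"
    using assms(2) by (intro ext) (simp add: V_leg_def tensors_def)
qed

lemma tensors_comb:
  assumes "fun_subspace X" "t \<in> tensors X l" "t' \<in> tensors X l"
  shows "(\<lambda>J g. a * t J g + b * t' J g) \<in> tensors X l"
  using assms by (simp add: tensors_def fun_subspace_comb zero_fun_def)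

lemma tensors_sum:
  assumes "fun_subspace X" "finite A" "\<And>k. k \<in> A \<Longrightarrow> t k \<in> tensors X l"
  shows "sum t A \<in> tensors X l"
  using assms(2,3)
proof (induction A rule: finite_induct)
  case empty
  then show ?case using assms(1) by (simp add: tensors_def fun_subspace_def zero_fun_def)
next
  case (insert k A)
  then have "(\<lambda>J g. 1 * t k J g + 1 * sum t A J g) \<in> tensors X l"
    by (intro tensors_comb assms(1)) auto
  then show ?case using insert(1,2) by (simp add: plus_fun_def)
qed

section \<open>Product forms on tensors\<close>

locale tensor_forms =
  fixes X :: "(real^'m::finite^'m \<Rightarrow> complex) set" and l :: nat
    and h :: "(real^'m^'m \<Rightarrow> complex) \<Rightarrow> (real^'m^'m \<Rightarrow> complex) \<Rightarrow> complex"
    and hV :: "complex^'m \<Rightarrow> complex^'m \<Rightarrow> complex"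
  assumes X: "fun_subspace X" and h: "sesquilinear_on X h"
    and hV: "hermitian_form V_rep hV"
begin

abbreviation "tf \<equiv> tensor_form l h hV"
abbreviation "T \<equiv> tensors X l"
abbreviation "gram a b \<equiv> hV (axis a 1) (axis b 1)"
abbreviation "weight J J' \<equiv> \<Prod>i<l. gram (J ! i) (J' ! i)"

lemma T_mem: "t \<in> T \<Longrightarrow> length J = l \<Longrightarrow> t J \<in> X"
  by (simp add: tensors_def)

lemma tf_comb:
  assumes "t \<in> T" "t' \<in> T" "u \<in> T"
  shows "tf (\<lambda>J g. a * t J g + b * t' J g) u = a * tf t u + b * tf t' u"
    and "tf u (\<lambda>J g. a * t J g + b * t' J g) = cnj a * tf u t + cnj b * tf u t'"
proof -
  have "h (\<lambda>g. a * t J g + b * t' J g) (u J') = a * h (t J) (u J') + b * h (t' J) (u J')"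
    "h (u J') (\<lambda>g. a * t J g + b * t' J g) = cnj a * h (u J') (t J) + cnj b * h (u J') (t' J)"
    if "length J = l" "length J' = l" for J J'
    using sesquilinear_onD[OF h] that assms T_mem by auto
  then show "tf (\<lambda>J g. a * t J g + b * t' J g) u = a * tf t u + b * tf t' u"
    "tf u (\<lambda>J g. a * t J g + b * t' J g) = cnj a * tf u t + cnj b * tf u t'"
    by (simp_all add: tensor_form_def sum_distrib_left sum.distrib[symmetric] distrib_right mult.assoc)
qed

lemma tf_zero: "u \<in> T \<Longrightarrow> tf 0 u = 0" "u \<in> T \<Longrightarrow> tf u 0 = 0"
  using sesquilinear_zero[OF X h] T_mem by (simp_all add: tensor_form_def zero_fun_def)

lemma tf_sum:
  assumes "finite A" "\<And>k. k \<in> A \<Longrightarrow> t k \<in> T" "u \<in> T"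
  shows "tf (sum t A) u = (\<Sum>k\<in>A. tf (t k) u)" and "tf u (sum t A) = (\<Sum>k\<in>A. tf u (t k))"
  using assms(1,2)
proof (induction A rule: finite_induct)
  case empty
  case 1 show ?case unfolding sum.empty by (rule tf_zero(1)[OF assms(3)])
  case 2 show ?case unfolding sum.empty by (rule tf_zero(2)[OF assms(3)])
next
  case (insert k A)
  have eq: "sum t (insert k A) = (\<lambda>J g. 1 * t k J g + 1 * sum t A J g)"
    using insert(1,2) by (simp add: plus_fun_def)
  have m: "t k \<in> T" "sum t A \<in> T" if "\<And>k'. k' \<in> insert k A \<Longrightarrow> t k' \<in> T"
    using that insert(1) by (auto intro: tensors_sum[OF X])
  case 1 then show ?case unfolding eq using insert m tf_comb(1)[OF m assms(3), of 1 1] by simp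
  case 2 then show ?case unfolding eq using insert m tf_comb(2)[OF m assms(3), of 1 1] by simp
qed

text \<open>The hypothesis evaluated at basis vectors. In matrix form it says that the transpose of
  \<open>Z\<close> times the Gram matrix is the Gram matrix times the conjugate of
  \<open>Z'\<close>.\<close>

lemma gram_adjoint:
  assumes "\<And>v w. hV (Z *v v) w = hV v (Z' *v w)"
  shows "(\<Sum>a\<in>UNIV. Z $ a $ j * gram a k) = (\<Sum>a\<in>UNIV. cnj (Z' $ a $ k) * gram j a)"
proof -
  note lin = hV[unfolded hermitian_form_def, simplified V_rep_def, simplified, rule_format]
  have col: "Z *v axis j 1 = (\<Sum>a\<in>UNIV. Z $ a $ j *s axis a 1)" for Z :: "complex^'m^'m" and j
    by (simp add: vec_eq_iff matrix_vector_mult_def axis_def if_distrib cong: if_cong)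
  have zero: "hV 0 w = 0" "hV w 0 = 0" for w
    using lin[of 0 0 0 0 w] by (simp_all) 
  have s: "hV (\<Sum>a\<in>A. f a *s v a) w = (\<Sum>a\<in>A. f a * hV (v a) w)"
    "hV w (\<Sum>a\<in>A. f a *s v a) = (\<Sum>a\<in>A. cnj (f a) * hV w (v a))" if "finite A" for A :: "'m set" and f v w
    using that
  proof (induction A rule: finite_induct)
    case (insert a A)
    case 1 show ?case using insert lin[of "f a" "v a" 1 "\<Sum>a\<in>A. f a *s v a" w] by simp
    case 2 show ?case using insert lin[of "f a" "v a" 1 "\<Sum>a\<in>A. f a *s v a" w] by simp
  qed (simp_all add: zero)
  show ?thesis using assms[of "axis j 1" "axis k 1"] unfolding col by (simp add: s)
qed

lemma weight_update:
  assumes "k < l" "length J = l" "length J' = l"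
  shows "weight (J[k := a]) J' = gram a (J' ! k) * (\<Prod>i\<in>{..<l}-{k}. gram (J ! i) (J' ! i))"
    and "weight J' (J[k := a]) = gram (J' ! k) a * (\<Prod>i\<in>{..<l}-{k}. gram (J' ! i) (J ! i))"
  using assms by (simp_all add: prod.remove[of "{..<l}" k])

text \<open>\<open>sum_list_update_swap\<close> moves \<open>Z\<close> from the first tensor to the
  Gram factor of its slot, \<open>gram_adjoint\<close> exchanges it for \<open>Z'\<close> there, and
  the same swap moves \<open>Z'\<close> on to the second tensor.\<close>

lemma V_leg_adjoint:
  assumes adj: "\<And>v w. hV (Z *v v) w = hV v (Z' *v w)" and i: "i \<in> {1..l}" and t: "t \<in> T" "t' \<in> T"
  shows "tf (V_leg i Z t) t' = tf t (V_leg i Z' t')"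
proof -
  define k where "k = i - 1"
  have k: "k < l" using i by (auto simp: k_def)
  define R where "R J J' = (\<Prod>i\<in>{..<l}-{k}. gram (J ! i) (J' ! i))" for J J' :: "'m list"
  have "tf (V_leg i Z t) t'
      = (\<Sum>J | length J = l. \<Sum>J' | length J' = l. \<Sum>a\<in>UNIV. Z $ (J!k) $ a * h (t (J[k:=a])) (t' J') * weight J J')"
    unfolding tensor_form_def V_leg_def[abs_def] k_def[symmetric]
    by (intro sum.cong refl, subst sesquilinear_sum(1)[OF X h])
      (use t T_mem in \<open>auto simp: sum_distrib_right\<close>)
  \<comment> \<open>The entry \<open>a\<close> is rewritten as \<open>J[k:=a]!k\<close>, so that the
    summand is a function of the old and the new list only, as the swap requires.\<close>
  also have "\<dots> = (\<Sum>J | length J = l. \<Sum>a\<in>UNIV. \<Sum>J' | length J' = l.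
      Z $ (J!k) $ (J[k:=a]!k) * h (t (J[k:=a])) (t' J') * weight J J')"
    using k by (subst (2) sum.swap) simp
  also have "\<dots> = (\<Sum>J | length J = l. \<Sum>a\<in>UNIV. \<Sum>J' | length J' = l.
      Z $ (J[k:=a]!k) $ (J!k) * h (t J) (t' J') * weight (J[k:=a]) J')"
    by (rule sum_list_update_swap[OF k])
  also have "\<dots> = (\<Sum>J | length J = l. \<Sum>J' | length J' = l. h (t J) (t' J') * R J J' *
      (\<Sum>a\<in>UNIV. Z $ a $ (J!k) * gram a (J'!k)))"
    using k by (intro sum.cong refl, subst sum.swap) (simp add: weight_update R_def sum_distrib_left mult_ac)
  also have "\<dots> = (\<Sum>J | length J = l. \<Sum>J' | length J' = l. h (t J) (t' J') * R J J' *
      (\<Sum>a\<in>UNIV. cnj (Z' $ a $ (J'!k)) * gram (J!k) a))"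
    by (simp only: gram_adjoint[OF adj])
  also have "\<dots> = (\<Sum>J | length J = l. \<Sum>J' | length J' = l. \<Sum>a\<in>UNIV.
      cnj (Z' $ (J'[k:=a]!k) $ (J'!k)) * h (t J) (t' J') * weight J (J'[k:=a]))"
    using k by (simp add: weight_update R_def sum_distrib_left mult_ac)
  also have "\<dots> = (\<Sum>J | length J = l. \<Sum>J' | length J' = l. \<Sum>a\<in>UNIV.
      cnj (Z' $ (J'!k) $ (J'[k:=a]!k)) * h (t J) (t' (J'[k:=a])) * weight J J')"
    by (intro sum.cong refl sum_list_update_swap[OF k, symmetric])
  also have "\<dots> = (\<Sum>J | length J = l. \<Sum>J' | length J' = l. \<Sum>a\<in>UNIV.
      cnj (Z' $ (J'!k) $ a) * h (t J) (t' (J'[k:=a])) * weight J J')"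
    using k by simp
  also have "\<dots> = tf t (V_leg i Z' t')"
    unfolding tensor_form_def V_leg_def[abs_def] k_def[symmetric]
    by (intro sum.cong refl, subst sesquilinear_sum(2)[OF X h])
      (use t T_mem in \<open>auto simp: sum_distrib_right\<close>)
  finally show ?thesis .
qed

text \<open>The weight is a product over slots, hence unchanged when the slots of both lists are
  permuted simultaneously; and the flip is its own inverse.\<close>

lemma flip_adjoint:
  assumes i: "i \<in> {1..<l}"
  shows "tf (flip_op i t) t' = tf t (flip_op i t')"
proof -
  define sw :: "'m list \<Rightarrow> 'm list" where "sw J = J[i - 1 := J ! i, i := J ! (i - 1)]" for J
  have len: "length (sw J) = length J" for J by (simp add: sw_def)
  have nth: "sw J ! k = J ! (Transposition.transpose (i - 1) i k)" if "length J = l" for J k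
    using that i by (auto simp: sw_def nth_list_update Transposition.transpose_def)
  have inv: "sw (sw J) = J" if "length J = l" for J
    using that by (intro nth_equalityI) (auto simp: len nth)
  have bij: "bij_betw sw {J. length J = l} {J. length J = l}"
    by (rule bij_betw_byWitness[where f'=sw]) (auto simp: len inv)
  have W: "weight (sw J) (sw J') = weight J J'" if "length J = l" "length J' = l" for J J'
  proof -
    have "weight (sw J) (sw J') = (\<Prod>k<l. gram (J ! (Transposition.transpose (i - 1) i k)) (J' ! (Transposition.transpose (i - 1) i k)))"
      using that by (simp add: nth)
    also have "\<dots> = weight J J'"
      using i by (intro prod.permute[of _ _ "\<lambda>k. gram (J ! k) (J' ! k)", symmetric, unfolded comp_def] permutes_swap_id) auto
    finally show ?thesis .
  qed
  have "tf (flip_op i t) t' = (\<Sum>J | length J = l. \<Sum>J' | length J' = l. h (t (sw J)) (t' J') * weight J J')"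
    by (simp add: tensor_form_def flip_op_def sw_def)
  also have "\<dots> = (\<Sum>J | length J = l. \<Sum>J' | length J' = l. h (t (sw (sw J))) (t' J') * weight (sw J) J')"
    by (rule sum.reindex_bij_betw[OF bij, symmetric])
  also have "\<dots> = (\<Sum>J | length J = l. \<Sum>J' | length J' = l. h (t J) (t' (sw J')) * weight (sw J) (sw J'))"
  proof (rule sum.cong[OF refl])
    fix J :: "'m list" assume "J \<in> {J. length J = l}"
    then show "(\<Sum>J' | length J' = l. h (t (sw (sw J))) (t' J') * weight (sw J) J')
        = (\<Sum>J' | length J' = l. h (t J) (t' (sw J')) * weight (sw J) (sw J'))"
      using sum.reindex_bij_betw[OF bij, of "\<lambda>J'. h (t J) (t' J') * weight (sw J) J'"]
      by (simp add: inv)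
  qed
  also have "\<dots> = tf t (flip_op i t')"
    unfolding tensor_form_def flip_op_def sw_def[symmetric] by (intro sum.cong refl) (simp add: W)
  finally show ?thesis .
qed

lemma X_op_adjoint:
  assumes "\<And>x y. \<lbrakk>x \<in> X; y \<in> X\<rbrakk> \<Longrightarrow> h (A x) y = h x (A' y)" "t \<in> T" "t' \<in> T"
  shows "tf (\<lambda>J. A (t J)) t' = tf t (\<lambda>J. A' (t' J))"
  unfolding tensor_form_def using assms T_mem by (auto intro!: sum.cong)

text \<open>Think of \<open>m c\<close> as linear functionals on \<open>V\<close> in which its form
  becomes a sum of squares. Applying the functional \<open>m (C i)\<close> to the
  \<open>i\<close>-th slot (counted from 0) leaves an element of \<open>X\<close>.\<close>

definition contract :: "('c \<Rightarrow> 'm \<Rightarrow> complex) \<Rightarrow> (nat \<Rightarrow> 'c) \<Rightarrow> 'm tens \<Rightarrow> real^'m^'m \<Rightarrow> complex" where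
  "contract m C t = (\<lambda>g. \<Sum>J | length J = l. (\<Prod>i<l. m (C i) (J ! i)) * t J g)"

lemma contract_mem: "t \<in> T \<Longrightarrow> contract m C t \<in> X"
  unfolding contract_def by (intro fun_subspace_sum[OF X]) (auto simp: T_mem)

text \<open>Once the Gram matrix is factored, a product over slots of sums over \<open>S\<close> is
  a sum over choice functions. The contractions do not depend on \<open>h\<close>, so the same ones
  serve for two different forms on \<open>X\<close>.\<close>

lemma tf_gram:
  assumes "finite S" and gram: "\<And>a b. gram a b = (\<Sum>c\<in>S. m c a * cnj (m c b))"
    and t: "t \<in> T" "t' \<in> T"
  shows "tf t t' = (\<Sum>C\<in>PiE {..<l} (\<lambda>_. S). h (contract m C t) (contract m C t'))"
proof -
  have W: "weight J J' = (\<Sum>C\<in>PiE {..<l} (\<lambda>_. S). (\<Prod>i<l. m (C i) (J ! i)) * cnj (\<Prod>i<l. m (C i) (J' ! i)))"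
    for J J' :: "'m list"
    unfolding gram using assms(1) by (subst prod_sum_PiE) (auto simp: prod.distrib)
  have "h (contract m C t) (contract m C t') =
      (\<Sum>J | length J = l. \<Sum>J' | length J' = l. h (t J) (t' J') * ((\<Prod>i<l. m (C i) (J ! i)) * cnj (\<Prod>i<l. m (C i) (J' ! i))))" for C
  proof -
    have "h (contract m C t) (contract m C t')
        = (\<Sum>J | length J = l. (\<Prod>i<l. m (C i) (J ! i)) * h (t J) (contract m C t'))"
      unfolding contract_def[of m C t]
      by (intro sesquilinear_sum(1)[OF X h] contract_mem t) (auto simp: T_mem t)
    also have "\<dots> = (\<Sum>J | length J = l. (\<Prod>i<l. m (C i) (J ! i)) *
        (\<Sum>J' | length J' = l. cnj (\<Prod>i<l. m (C i) (J' ! i)) * h (t J) (t' J')))"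
      unfolding contract_def
      by (intro sum.cong refl arg_cong2[where f="(*)"] sesquilinear_sum(2)[OF X h]) (auto simp: T_mem t)
    finally show ?thesis by (simp add: sum_distrib_left mult_ac)
  qed
  then have "(\<Sum>C\<in>PiE {..<l} (\<lambda>_. S). h (contract m C t) (contract m C t'))
     = (\<Sum>C\<in>PiE {..<l} (\<lambda>_. S). \<Sum>J | length J = l. \<Sum>J' | length J' = l.
        h (t J) (t' J') * ((\<Prod>i<l. m (C i) (J ! i)) * cnj (\<Prod>i<l. m (C i) (J' ! i))))" by simp
  also have "\<dots> = (\<Sum>J | length J = l. \<Sum>J' | length J' = l. \<Sum>C\<in>PiE {..<l} (\<lambda>_. S).
        h (t J) (t' J') * ((\<Prod>i<l. m (C i) (J ! i)) * cnj (\<Prod>i<l. m (C i) (J' ! i))))"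
    by (subst sum.swap, intro sum.cong refl, subst sum.swap, rule refl)
  also have "\<dots> = tf t t'"
    unfolding tensor_form_def W by (simp add: sum_distrib_left)
  finally show ?thesis ..
qed

end

text \<open>For \<open>x = xi s e\<close> this is the action of \<open>w_longest m\<close>; the
  order of the recursion follows \<open>w_longest_Suc\<close>.\<close>

primrec all_legs :: "complex^'m::finite^'m \<Rightarrow> nat \<Rightarrow> 'm tens \<Rightarrow> 'm tens" where
  "all_legs x 0 t = t"
| "all_legs x (Suc m) t = all_legs x m (V_leg (Suc m) x t)"

lemma all_legs_mem: "\<lbrakk>fun_subspace X; t \<in> tensors X l\<rbrakk> \<Longrightarrow> all_legs x m t \<in> tensors X l"
  by (induction m arbitrary: t) (auto intro: V_leg_mem)

lemma all_legs_add: "all_legs x m (t + t') = all_legs x m t + all_legs x m t'"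
  by (induction m arbitrary: t t') (simp_all only: all_legs.simps V_leg_add)

lemma all_legs_zero: "all_legs x m 0 = 0"
  using all_legs_add[of x m 0 0] by simp

lemma all_legs_sum: "all_legs x m (sum t A) = (\<Sum>k\<in>A. all_legs x m (t k))"
  using sum_comp_morphism[of "all_legs x m" t A, OF all_legs_zero all_legs_add] by (simp only: comp_def)

lemma all_legs_comb:
  "all_legs x m (\<lambda>J g. a * t J g + b * t' J g) = (\<lambda>J g. a * all_legs x m t J g + b * all_legs x m t' J g)"
  by (induction m arbitrary: t t') (simp_all only: all_legs.simps V_leg_comb)

text \<open>On other factors \<open>x\<close> commutes with \<open>V_leg i Z\<close>; on the
  \<open>i\<close>-th factor \<open>x Z = (x Z x) x\<close> because \<open>x\<close> squares to
  1.\<close>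

lemma all_legs_V_leg:
  assumes "x ** x = mat 1" "fun_subspace X" "t \<in> tensors X l" "i \<in> {1..l}" "m \<le> l"
  shows "all_legs x m (V_leg i Z t) = V_leg i (if i \<le> m then x ** Z ** x else Z) (all_legs x m t)"
  using assms(3,5)
proof (induction m arbitrary: t Z)
  case 0
  then show ?case using assms(4) by simp
next
  case (Suc m)
  show ?case
  proof (cases "i = Suc m")
    case True
    have "x ** Z ** x ** x = x ** Z" by (metis assms(1) matrix_mul_assoc matrix_mul_rid)
    then have "V_leg i x (V_leg i Z t) = V_leg i (x ** Z ** x) (V_leg i x t)"
      using Suc.prems assms(4) by (simp add: V_leg_mult)
    then show ?thesis
      using Suc True V_leg_mem[OF assms(2) Suc.prems(1)] by simp
  next
    case False
    then have "V_leg (Suc m) x (V_leg i Z t) = V_leg i Z (V_leg (Suc m) x t)"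
      using assms(4) by (intro V_leg_commute) auto
    then show ?thesis
      using Suc False V_leg_mem[OF assms(2) Suc.prems(1)] by simp
  qed
qed

lemma all_legs_all_legs:
  assumes "x ** x = mat 1" "fun_subspace X" "t \<in> tensors X l" "m \<le> l"
  shows "all_legs x m (all_legs x m t) = t"
  using assms(3,4)
proof (induction m arbitrary: t)
  case (Suc m)
  let ?t = "V_leg (Suc m) x t"
  have t: "?t \<in> tensors X l" by (intro V_leg_mem assms Suc)
  have "all_legs x (Suc m) (all_legs x (Suc m) t) = all_legs x m (all_legs x m (V_leg (Suc m) x ?t))"
    using all_legs_V_leg[OF assms(1,2) t, of "Suc m" m x] Suc.prems by simp
  also have "\<dots> = V_leg (Suc m) x ?t"
    using Suc t by (intro Suc.IH V_leg_mem assms) auto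
  also have "\<dots> = t"
    using Suc.prems V_leg_mult[OF Suc.prems(1), of "Suc m" x x] V_leg_id[OF Suc.prems(1), of "Suc m"]
    by (simp add: assms(1))
  finally show ?case .
qed simp

section \<open>Trace form and Killing form\<close>

lemma cmat_scale_nth: "cmat_scale a x $ i $ j = a * x $ i $ j"
  by (simp add: cmat_scale_def)

lemma cmat_scale_mult: "cmat_scale a x ** y = cmat_scale a (x ** y)" "x ** cmat_scale a y = cmat_scale a (x ** y)"
  by (simp_all add: vec_eq_iff cmat_scale_def matrix_matrix_mult_def sum_distrib_left mult_ac)

lemma transpose_cmat_scale: "transpose (cmat_scale a x) = cmat_scale a (transpose x)"
  by (simp add: vec_eq_iff cmat_scale_def transpose_def)

lemma transpose_add: "transpose (x + y) = transpose x + transpose y"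
  by (simp add: vec_eq_iff transpose_def)

lemma transpose_diff: "transpose (x - y) = transpose x - transpose (y :: 'a::ab_group_add^'n^'m)"
  by (simp add: vec_eq_iff transpose_def)

lemma trace_cmat_scale: "trace (cmat_scale a x) = a * trace x"
  by (simp add: trace_def cmat_scale_def sum_distrib_left)

lemma trace_mult: "trace (x ** y) = (\<Sum>i\<in>UNIV. \<Sum>j\<in>UNIV. x $ i $ j * y $ j $ i)"
  by (simp add: trace_def matrix_matrix_mult_def)

lemma trace_neg: "trace (- x) = - trace (x :: 'a::ring_1^'n^'n)"
  by (simp add: trace_def sum_negf)

lemma trace_transpose: "trace (transpose x) = trace x"
  by (simp add: trace_def transpose_def)

lemma matrix_sub_ldistrib: "x ** (y - z) = x ** y - x ** (z :: 'a::ring_1^'n^'m)"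
  by (simp add: vec_eq_iff matrix_matrix_mult_def right_diff_distrib sum_subtractf)

lemma matrix_sub_rdistrib: "(y - z) ** x = y ** x - z ** (x :: 'a::ring_1^'n^'m)"
  by (simp add: vec_eq_iff matrix_matrix_mult_def left_diff_distrib sum_subtractf)

lemma matrix_add_mult: "(y + z) ** x = y ** x + z ** (x :: 'a::semiring_1^'n^'m)"
  by (simp add: vec_eq_iff matrix_matrix_mult_def distrib_right sum.distrib)

lemma matrix_neg_mult: "(- y) ** x = - (y ** x)" "y ** (- x) = - (y ** (x :: 'a::ring_1^'n^'m))"
  by (simp_all add: vec_eq_iff matrix_matrix_mult_def sum_negf)

lemma matrix_zero_mult: "0 ** x = 0" "y ** 0 = (0 :: 'a::semiring_1^'n^'m)"
  by (simp_all add: vec_eq_iff matrix_matrix_mult_def)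

lemma matrix_mult_sum: "x ** (\<Sum>k\<in>A. f k) = (\<Sum>k\<in>A. x ** (f k :: 'a::semiring_1^'n^'m))"
  by (induction A rule: infinite_finite_induct) (simp_all add: matrix_zero_mult matrix_add_ldistrib)

lemma sum_matrix_mult: "(\<Sum>k\<in>A. f k) ** x = (\<Sum>k\<in>A. f k ** (x :: 'a::semiring_1^'n^'m))"
  by (induction A rule: infinite_finite_induct) (simp_all add: matrix_zero_mult matrix_add_mult)

lemma trace_setsum: "trace (\<Sum>k\<in>A. f k) = (\<Sum>k\<in>A. trace (f k :: 'a::semiring_1^'n^'n))"
  by (induction A rule: infinite_finite_induct) (simp_all add: trace_def sum.distrib)

definition unit_mat :: "'m \<Rightarrow> 'm \<Rightarrow> complex^'m^'m" where
  "unit_mat a b = (\<chi> x y. if x = a \<and> y = b then 1 else 0)"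

lemma unit_mat_nth: "unit_mat a b $ x $ y = (if x = a \<and> y = b then 1 else 0)"
  by (simp add: unit_mat_def)

lemma sum_delta2:
  "(\<Sum>i\<in>UNIV. \<Sum>j\<in>UNIV. if i = a \<and> j = b then f i j else 0) = (f (a::'m::finite) (b::'n::finite) :: 'b::comm_monoid_add)"
proof -
  have "(\<Sum>i\<in>UNIV. \<Sum>j\<in>UNIV. if i = a \<and> j = b then f i j else 0)
      = (\<Sum>i\<in>UNIV. if i = a then (\<Sum>j\<in>UNIV. if j = b then f i j else 0) else 0)"
    by (intro sum.cong) auto
  then show ?thesis by simp
qed

lemma cmat_unit_sum: "(Z :: complex^'m::finite^'m) = (\<Sum>i\<in>UNIV. \<Sum>j\<in>UNIV. cmat_scale (Z $ i $ j) (unit_mat i j))"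
proof -
  have "Z $ x $ y = (\<Sum>i\<in>UNIV. \<Sum>j\<in>UNIV. if i = x \<and> j = y then Z $ i $ j else 0)" for x y
    by (simp only: sum_delta2)
  moreover have "Z $ i $ j * (if x = i \<and> y = j then 1 else 0) = (if i = x \<and> j = y then Z $ i $ j else 0)" for x y i j
    by auto
  ultimately show ?thesis by (simp add: vec_eq_iff cmat_scale_nth unit_mat_nth)
qed

lemma mult_unit_mult: "(A ** unit_mat k m ** D) $ i $ j = A $ i $ k * D $ m $ j"
proof -
  have "(A ** unit_mat k m ** D) $ i $ j
      = (\<Sum>y\<in>UNIV. \<Sum>x\<in>UNIV. A $ i $ x * (if x = k \<and> y = m then 1 else 0) * D $ y $ j)"
    by (simp add: matrix_matrix_mult_def unit_mat_nth sum_distrib_right)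
  also have "\<dots> = (\<Sum>y\<in>UNIV. \<Sum>x\<in>UNIV. if y = m \<and> x = k then A $ i $ x * D $ y $ j else 0)"
    by (intro sum.cong) auto
  also have "\<dots> = A $ i $ k * D $ m $ j"
    by (rule sum_delta2)
  finally show ?thesis .
qed

lemma transpose_unit: "transpose (unit_mat a b) = unit_mat b a"
  by (auto simp: vec_eq_iff transpose_def unit_mat_nth)

text \<open>One sign covers both families: \<open>\<epsilon>\<close> is 1 for the symmetric form of
  \<open>O(p,q)\<close> and -1 for the alternating form of the symplectic group.\<close>

locale form_mat =
  fixes J :: "complex^'m::finite^'m" and \<epsilon> :: complex
  assumes JJ: "J ** J = cmat_scale \<epsilon> (mat 1)" and JT: "transpose J = cmat_scale \<epsilon> J"
    and eps: "\<epsilon> * \<epsilon> = 1"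
begin

definition lie :: "(complex^'m^'m) set" where
  "lie = {Z. transpose Z ** J + J ** Z = 0}"

text \<open>The matrix subtracted from \<open>Z\<close> is its adjoint for the bilinear form
  \<open>J\<close>. The Lie algebra is the -1 eigenspace of this anti-involution, and
  \<open>proj\<close> is the projection to it along the +1 eigenspace. Being defined on all
  matrices, it turns matrix units into a spanning family that is the same for every basis
  \<open>B\<close>.\<close>

definition proj :: "complex^'m^'m \<Rightarrow> complex^'m^'m" where
  "proj Z = cmat_scale (1/2) (Z - cmat_scale \<epsilon> (J ** transpose Z ** J))"

lemma JJx: "J ** (J ** x) = cmat_scale \<epsilon> x"
  by (simp add: matrix_mul_assoc JJ cmat_scale_mult)

lemma xJJ: "x ** J ** J = cmat_scale \<epsilon> x"
  by (simp add: matrix_mul_assoc[symmetric] JJ cmat_scale_mult)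

lemma lie_iff: "Z \<in> lie \<longleftrightarrow> J ** transpose Z ** J = cmat_scale (- \<epsilon>) Z"
proof
  assume "Z \<in> lie"
  then have "transpose Z ** J = - (J ** Z)" by (simp add: lie_def eq_neg_iff_add_eq_0)
  then have "J ** (transpose Z ** J) = J ** (- (J ** Z))" by simp
  also have "\<dots> = cmat_scale (- \<epsilon>) Z"
    by (simp add: matrix_neg_mult JJx)
  finally show "J ** transpose Z ** J = cmat_scale (- \<epsilon>) Z" by (simp add: matrix_mul_assoc)
next
  assume "J ** transpose Z ** J = cmat_scale (- \<epsilon>) Z"
  then have "J ** (J ** (transpose Z ** J)) = J ** cmat_scale (- \<epsilon>) Z" by (simp add: matrix_mul_assoc)
  then have "cmat_scale \<epsilon> (transpose Z ** J) = - cmat_scale \<epsilon> (J ** Z)" by (simp add: JJx cmat_scale_mult matrix_neg_mult)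
  then have "cmat_scale \<epsilon> (cmat_scale \<epsilon> (transpose Z ** J)) = - cmat_scale \<epsilon> (cmat_scale \<epsilon> (J ** Z))"
    by simp
  then show "Z \<in> lie" by (simp add: eps lie_def)
qed

lemma proj_add: "proj (x + y) = proj x + proj y"
  by (simp add: proj_def transpose_add matrix_add_ldistrib matrix_add_mult
      cmat.scale_right_distrib cmat.scale_right_diff_distrib)

lemma proj_scale: "proj (cmat_scale a x) = cmat_scale a (proj x)"
  by (simp add: proj_def transpose_cmat_scale cmat_scale_mult cmat.scale_right_diff_distrib mult_ac)

lemma proj_sum: "proj (\<Sum>k\<in>A. cmat_scale (c k) (f k)) = (\<Sum>k\<in>A. cmat_scale (c k) (proj (f k)))"
proof -
  have "proj 0 = 0" using proj_scale[of 0 0] by simp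
  then show ?thesis
    by (induction A rule: infinite_finite_induct) (simp_all add: proj_add proj_scale)
qed

lemma proj_lie: "proj Z \<in> lie"
proof -
  have "transpose (J ** transpose Z ** J) = J ** Z ** J"
    by (simp add: matrix_transpose_mul JT cmat_scale_mult eps matrix_mul_assoc)
  then have "J ** transpose (proj Z) ** J = cmat_scale (1/2) (J ** transpose Z ** J - cmat_scale \<epsilon> (J ** (J ** Z ** J) ** J))"
    by (simp add: proj_def transpose_cmat_scale transpose_diff matrix_sub_ldistrib matrix_sub_rdistrib cmat_scale_mult)
  also have "J ** (J ** Z ** J) ** J = Z"
    by (simp add: matrix_mul_assoc JJ cmat_scale_mult xJJ eps)
  finally show ?thesis
    unfolding lie_iff proj_def by (simp add: cmat.scale_right_diff_distrib eps mult_ac)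
qed

lemma proj_id: "Z \<in> lie \<Longrightarrow> proj Z = Z"
  unfolding lie_iff proj_def by (simp add: eps) (simp add: vec_eq_iff cmat_scale_nth)

text \<open>For \<open>x\<close> in the Lie algebra the pairing with \<open>y\<close> thus sees only
  \<open>proj y\<close>. The dual basis and the nondegeneracy of the trace form both rest on
  this.\<close>

lemma trace_proj: "trace (x ** proj y) = trace (proj x ** y)"
proof -
  have "trace (x ** (J ** transpose y ** J)) = trace (transpose (x ** (J ** transpose y ** J)))"
    by (simp only: trace_transpose)
  also have "transpose (x ** (J ** transpose y ** J)) = (J ** y ** J) ** transpose x"
    by (simp add: matrix_transpose_mul JT cmat_scale_mult eps matrix_mul_assoc)
  also have "trace \<dots> = trace ((y ** J ** transpose x) ** J)"
    by (subst trace_mul_sym) (simp add: matrix_mul_assoc[symmetric])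
  also have "\<dots> = trace ((J ** transpose x ** J) ** y)"
    by (subst trace_mul_sym[of "J ** transpose x ** J"]) (simp add: matrix_mul_assoc)
  finally show ?thesis
    by (simp add: proj_def cmat_scale_mult trace_cmat_scale matrix_sub_ldistrib matrix_sub_rdistrib trace_sub)
qed

lemma trace_lie: "x \<in> lie \<Longrightarrow> trace x = 0"
proof -
  assume "x \<in> lie"
  then have "cmat_scale (- \<epsilon>) x = J ** transpose x ** J" by (simp add: lie_iff)
  then have "- \<epsilon> * trace x = trace (J ** (transpose x ** J))"
    by (metis trace_cmat_scale matrix_mul_assoc)
  also have "\<dots> = \<epsilon> * trace x"
    by (subst trace_mul_sym) (simp add: xJJ trace_cmat_scale trace_transpose)
  finally show ?thesis using eps by auto
qed

lemma lie_add: "\<lbrakk>x \<in> lie; y \<in> lie\<rbrakk> \<Longrightarrow> x + y \<in> lie"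
  unfolding lie_iff by (simp add: transpose_add matrix_add_ldistrib matrix_add_mult cmat.scale_right_distrib)

lemma lie_scale: "x \<in> lie \<Longrightarrow> cmat_scale a x \<in> lie"
  unfolding lie_iff by (simp add: transpose_cmat_scale cmat_scale_mult mult.commute)

lemma lie_sum: "\<lbrakk>\<And>k. k \<in> A \<Longrightarrow> f k \<in> lie\<rbrakk> \<Longrightarrow> (\<Sum>k\<in>A. cmat_scale (c k) (f k)) \<in> lie"
proof (induction A rule: infinite_finite_induct)
  case (insert k A)
  then show ?case by (auto intro: lie_add lie_scale)
qed (simp_all add: lie_def transpose_def vec_eq_iff matrix_matrix_mult_def)

lemma lie_bracket_lie:
  assumes "x \<in> lie" "y \<in> lie"
  shows "lie_bracket x y \<in> lie"
proof -
  have *: "J ** transpose (x ** y) ** J = cmat_scale \<epsilon> (y ** x)" if "x \<in> lie" "y \<in> lie" for x y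
  proof -
    have "J ** transpose (x ** y) ** J = cmat_scale \<epsilon> ((J ** transpose y ** J) ** (J ** transpose x ** J))"
      by (simp add: matrix_transpose_mul matrix_mul_assoc xJJ cmat_scale_mult eps)
    then show ?thesis using that by (simp add: lie_iff cmat_scale_mult eps matrix_neg_mult)
  qed
  show ?thesis
    unfolding lie_iff lie_bracket_def
    using *[OF assms] *[OF assms(2,1)]
    by (simp add: transpose_diff matrix_sub_ldistrib matrix_sub_rdistrib cmat.scale_right_diff_distrib)
qed

context
  fixes B :: "(complex^'m^'m) set"
  assumes B: "finite B" "cmat.independent B" "cmat.span B = lie"
begin

text \<open>Composition with \<open>proj\<close> extends the coordinate functionals linearly to all
  matrices, where they are determined by their values on matrix units.\<close>

abbreviation "coord b Z \<equiv> cmat.representation B (proj Z) b"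

lemma coord_sum: "coord b (\<Sum>k\<in>A. cmat_scale (c k) (f k)) = (\<Sum>k\<in>A. c k * coord b (f k))"
proof -
  have "proj 0 = 0" using proj_scale[of 0 0] by simp
  then have zero: "coord b 0 = 0" by (simp add: cmat.representation_zero)
  show ?thesis
  proof (induction A rule: infinite_finite_induct)
  case (insert k A)
  have "proj (cmat_scale (c k) (f k)) \<in> cmat.span B" "proj (\<Sum>k\<in>A. cmat_scale (c k) (f k)) \<in> cmat.span B"
    using B proj_lie by auto
  then have "coord b (cmat_scale (c k) (f k) + (\<Sum>k\<in>A. cmat_scale (c k) (f k)))
      = coord b (cmat_scale (c k) (f k)) + coord b (\<Sum>k\<in>A. cmat_scale (c k) (f k))"
    unfolding proj_add by (subst cmat.representation_add[OF B(2)]) auto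
  also have "coord b (cmat_scale (c k) (f k)) = c k * coord b (f k)"
    unfolding proj_scale using B proj_lie by (subst cmat.representation_scale[OF B(2)]) auto
  finally show ?case using insert by simp
  qed (simp_all add: zero)
qed

lemma coord_unit: "coord b Z = (\<Sum>i\<in>UNIV. \<Sum>j\<in>UNIV. Z $ i $ j * coord b (unit_mat i j))"
proof -
  have Z: "Z = (\<Sum>(i,j)\<in>UNIV. cmat_scale (Z $ i $ j) (unit_mat i j))"
    by (subst cmat_unit_sum) (simp add: sum.cartesian_product)
  show ?thesis
    by (subst Z, unfold split_def, subst coord_sum) (simp add: sum.cartesian_product split_def)
qed

lemma coord_expand: "Z \<in> lie \<Longrightarrow> (\<Sum>b\<in>B. cmat_scale (coord b Z) b) = Z"
  using cmat.sum_representation_eq[OF B(2), of Z B] B by (simp add: proj_id)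

text \<open>Composing with a projection onto the Lie algebra does not change the trace, and the
  trace on all matrices can be read off from matrix units.\<close>

lemma trace_on_lie:
  assumes lin: "\<And>(A :: (complex^'m^'m) set) c f. finite A \<Longrightarrow> T (\<Sum>k\<in>A. cmat_scale (c k) (f k)) = (\<Sum>k\<in>A. cmat_scale (c k) (T (f k)))"
    and T: "\<And>x. x \<in> lie \<Longrightarrow> T x \<in> lie"
  shows "(\<Sum>b\<in>B. cmat.representation B (T b) b) = (\<Sum>i\<in>UNIV. \<Sum>j\<in>UNIV. T (proj (unit_mat i j)) $ i $ j)"
proof -
  have Bl: "b \<in> lie" if "b \<in> B" for b using that B cmat.span_base by blast
  have "T (proj (unit_mat i j)) $ i $ j = (\<Sum>b\<in>B. coord b (unit_mat i j) * T b $ i $ j)" for i j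
  proof -
    have "proj (proj (unit_mat i j)) = proj (unit_mat i j)" by (intro proj_id proj_lie)
    then have "proj (unit_mat i j) = (\<Sum>b\<in>B. cmat_scale (coord b (unit_mat i j)) b)"
      using coord_expand[OF proj_lie, of "unit_mat i j"] by simp
    then have "T (proj (unit_mat i j)) = (\<Sum>b\<in>B. cmat_scale (coord b (unit_mat i j)) (T b))"
      using lin[OF B(1), of "\<lambda>b. coord b (unit_mat i j)" "\<lambda>b. b"] by simp
    then show ?thesis by (simp add: cmat_scale_nth)
  qed
  then have "(\<Sum>i\<in>UNIV. \<Sum>j\<in>UNIV. T (proj (unit_mat i j)) $ i $ j)
      = (\<Sum>i\<in>UNIV. \<Sum>j\<in>UNIV. \<Sum>b\<in>B. T b $ i $ j * coord b (unit_mat i j))" by (simp add: mult.commute)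
  also have "\<dots> = (\<Sum>i\<in>UNIV. \<Sum>b\<in>B. \<Sum>j\<in>UNIV. T b $ i $ j * coord b (unit_mat i j))"
    by (rule sum.cong[OF refl], rule sum.swap)
  also have "\<dots> = (\<Sum>b\<in>B. \<Sum>i\<in>UNIV. \<Sum>j\<in>UNIV. T b $ i $ j * coord b (unit_mat i j))"
    by (rule sum.swap)
  also have "\<dots> = (\<Sum>b\<in>B. cmat.representation B (T b) b)"
    by (intro sum.cong refl) (simp add: coord_unit[symmetric] proj_id T Bl)
  finally show ?thesis ..
qed

text \<open>With \<open>N = CARD('m)\<close>, the two halves of \<open>proj\<close> contribute
  \<open>2 N\<close> and \<open>4 \<epsilon>\<close> times the trace of \<open>x y\<close>, and half
  of the difference is the stated constant: \<open>2 n + 2\<close> for the symplectic group,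
  \<open>p + q - 2\<close> for the orthogonal one.\<close>

lemma killing_trace:
  assumes "x \<in> lie" "y \<in> lie"
  shows "killing B x y = (of_nat CARD('m) - 2 * \<epsilon>) * trace (x ** y)"
proof -
  let ?T = "\<lambda>Z. lie_bracket x (lie_bracket y Z)"
  have T: "?T Z = x ** y ** Z - x ** Z ** y - y ** Z ** x + Z ** (y ** x)" for Z
    by (simp add: lie_bracket_def matrix_sub_ldistrib matrix_sub_rdistrib matrix_mul_assoc)
  have T_add: "?T (z + w) = ?T z + ?T w" for z w
    by (simp add: T matrix_add_ldistrib matrix_add_mult)
  have T_scale: "?T (cmat_scale a z) = cmat_scale a (?T z)" for a z
    by (simp add: T cmat_scale_mult cmat.scale_right_distrib cmat.scale_right_diff_distrib)
  have T_sum: "?T (\<Sum>k\<in>A. cmat_scale (c k) (f k)) = (\<Sum>k\<in>A. cmat_scale (c k) (?T (f k)))" if "finite A" for A c f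
    using that
  proof (induction A rule: finite_induct)
    case empty
    then show ?case using T_scale[of 0 0] by simp
  qed (simp add: T_add T_scale)
  have S1: "(\<Sum>i\<in>UNIV. \<Sum>j\<in>UNIV. (A ** unit_mat i j ** D) $ i $ j) = trace A * trace D" for A D
    by (simp add: mult_unit_mult trace_def sum_product)
  have S2: "(\<Sum>i\<in>UNIV. \<Sum>j\<in>UNIV. (A ** (J ** unit_mat j i ** J) ** D) $ i $ j) = \<epsilon> * trace (A ** (J ** transpose D ** J))" for A D
  proof -
    have "(\<Sum>i\<in>UNIV. \<Sum>j\<in>UNIV. (A ** (J ** unit_mat j i ** J) ** D) $ i $ j)
        = (\<Sum>i\<in>UNIV. \<Sum>j\<in>UNIV. (A ** J) $ i $ j * (J ** D) $ i $ j)"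
      by (simp add: mult_unit_mult[of "A ** J" _ _ "J ** D", symmetric] matrix_mul_assoc)
    also have "\<dots> = trace ((A ** J) ** transpose (J ** D))"
      by (simp add: trace_mult transpose_def)
    also have "transpose (J ** D) = cmat_scale \<epsilon> (transpose D ** J)"
      by (simp add: matrix_transpose_mul JT cmat_scale_mult)
    finally show ?thesis by (simp add: cmat_scale_mult trace_cmat_scale matrix_mul_assoc)
  qed
  have Tr: "?T Z = x ** y ** Z ** mat 1 - x ** Z ** y - y ** Z ** x + mat 1 ** Z ** (y ** x)" for Z
    by (simp add: T)
  \<comment> \<open>The outer terms give \<open>N\<close> times the trace of \<open>x y\<close>
    each; the middle ones give products of the traces of \<open>x\<close> and \<open>y\<close>,
    which vanish.\<close>
  have s1: "(\<Sum>i\<in>UNIV. \<Sum>j\<in>UNIV. ?T (unit_mat i j) $ i $ j) = 2 * of_nat CARD('m) * trace (x ** y)"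
    unfolding Tr by (simp add: sum.distrib sum_subtractf S1 S1[of _ "mat 1", simplified] S1[of "mat 1", simplified] trace_lie assms trace_I trace_mul_sym[of y x])
  \<comment> \<open>All four terms contribute the same amount: the anti-involution is -1 on
    \<open>x\<close> and \<open>y\<close>, which cancels the signs of the two middle terms.\<close>
  have s2: "(\<Sum>i\<in>UNIV. \<Sum>j\<in>UNIV. ?T (J ** unit_mat j i ** J) $ i $ j) = 4 * trace (x ** y)"
  proof -
    have xx: "J ** transpose x ** J = cmat_scale (- \<epsilon>) x" "J ** transpose y ** J = cmat_scale (- \<epsilon>) y"
      using assms by (simp_all add: lie_iff)
    have yx: "J ** transpose (y ** x) ** J = cmat_scale \<epsilon> (x ** y)"
    proof -
      have "J ** transpose (y ** x) ** J = cmat_scale \<epsilon> ((J ** transpose x ** J) ** (J ** transpose y ** J))"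
        by (simp add: matrix_transpose_mul matrix_mul_assoc xJJ cmat_scale_mult eps)
      then show ?thesis by (simp add: xx cmat_scale_mult eps matrix_neg_mult)
    qed
    show ?thesis
      unfolding Tr
      by (simp add: sum.distrib sum_subtractf S2 S2[of _ "mat 1", simplified transpose_mat matrix_mul_rid]
          S2[of "mat 1", simplified matrix_mul_lid] xx yx cmat_scale_mult trace_cmat_scale matrix_neg_mult trace_neg
          transpose_mat JJ eps mult.assoc[symmetric] trace_mul_sym[of y x])
  qed
  have e: "?T (proj (unit_mat i j)) $ i $ j
     = (1/2) * (?T (unit_mat i j) $ i $ j - \<epsilon> * ?T (J ** unit_mat j i ** J) $ i $ j)" for i j
  proof -
    have "?T (proj (unit_mat i j)) = cmat_scale (1/2) (?T (unit_mat i j) + cmat_scale (- \<epsilon>) (?T (J ** unit_mat j i ** J)))"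
      unfolding T_scale[symmetric] T_add[symmetric] by (simp add: proj_def transpose_unit)
    then show ?thesis by (simp add: cmat_scale_nth)
  qed
  have "(\<Sum>i\<in>UNIV. \<Sum>j\<in>UNIV. ?T (proj (unit_mat i j)) $ i $ j)
     = (1/2) * (2 * of_nat CARD('m) * trace (x ** y) - \<epsilon> * (4 * trace (x ** y)))"
    unfolding e s1[symmetric] s2[symmetric] by (simp only: sum_distrib_left sum_subtractf right_diff_distrib)
  moreover have "killing B x y = (\<Sum>i\<in>UNIV. \<Sum>j\<in>UNIV. ?T (proj (unit_mat i j)) $ i $ j)"
    unfolding killing_def by (rule trace_on_lie) (auto simp: T_sum intro: lie_bracket_lie assms)
  ultimately show ?thesis by (simp add: algebra_simps)
qed

text \<open>The functional \<open>coord b\<close> represented through the trace form and projected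
  to the Lie algebra, that is, the member dual to \<open>b\<close> of the trace-dual basis.\<close>

definition dual_vec :: "complex^'m^'m \<Rightarrow> complex^'m^'m" where
  "dual_vec b = (\<Sum>(i,j)\<in>UNIV. cmat_scale (coord b (unit_mat i j)) (proj (unit_mat j i)))"

lemma trace_dual_vec: "x \<in> lie \<Longrightarrow> trace (x ** dual_vec b) = cmat.representation B x b"
proof -
  assume x: "x \<in> lie"
  have "dual_vec b = proj (\<Sum>(i,j)\<in>UNIV. cmat_scale (coord b (unit_mat i j)) (unit_mat j i))"
    by (simp add: dual_vec_def proj_sum split_def)
  then have "trace (x ** dual_vec b) = trace (x ** (\<Sum>(i,j)\<in>UNIV. cmat_scale (coord b (unit_mat i j)) (unit_mat j i)))"
    by (simp add: trace_proj proj_id x)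
  also have "\<dots> = (\<Sum>(i,j)\<in>UNIV. coord b (unit_mat i j) * trace (x ** unit_mat j i))"
    by (simp add: matrix_mult_sum trace_setsum split_def cmat_scale_mult trace_cmat_scale)
  also have "\<dots> = (\<Sum>i\<in>UNIV. \<Sum>j\<in>UNIV. coord b (unit_mat i j) * trace (x ** unit_mat j i))"
    by (simp add: sum.cartesian_product)
  also have "\<dots> = coord b x"
  proof -
    have "trace (x ** unit_mat j i) = x $ i $ j" for i j
    proof -
      have "trace (x ** unit_mat j i) = trace (x ** unit_mat j i ** mat 1)" by simp
      also have "\<dots> = (\<Sum>k\<in>UNIV. x $ k $ j * (if i = k then 1 else 0))"
        by (simp only: trace_def mult_unit_mult) (simp add: mat_def)
      finally show ?thesis by (simp add: if_distrib cong: if_cong)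
    qed
    then show ?thesis by (subst coord_unit) (simp add: mult.commute)
  qed
  finally show ?thesis by (simp add: proj_id x)
qed

lemma dual_vec_lie: "dual_vec b \<in> lie"
  unfolding dual_vec_def split_def by (rule lie_sum) (simp add: proj_lie)

text \<open>The definite description requires uniqueness, which is the nondegeneracy of the trace
  form on the Lie algebra. The factor \<open>\<kappa>\<close> relates the scaled Killing form to the
  trace form.\<close>

lemma dual_elt_dual_vec:
  assumes lie: "lie = g_cpx s e" and \<kappa>: "\<kappa> = form_scale nm s * (of_nat CARD('m) - 2 * \<epsilon>)" "\<kappa> \<noteq> 0"
    and b: "b \<in> B"
  shows "dual_elt nm s e B b = cmat_scale (1 / \<kappa>) (dual_vec b)"
  unfolding dual_elt_def lie[symmetric]
proof (rule the_equality)
  have Bl: "b \<in> lie" if "b \<in> B" for b using that B cmat.span_base by blast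
  have kil: "form_scale nm s * killing B b' y = \<kappa> * trace (b' ** y)" if "b' \<in> B" "y \<in> lie" for b' y
    using that by (simp add: killing_trace Bl \<kappa>)
  have rep: "cmat.representation B b' b = (if b' = b then 1 else 0)" if "b' \<in> B" for b'
    using cmat.representation_basis[OF B(2) that] by auto
  have y: "cmat_scale (1 / \<kappa>) (dual_vec b) \<in> lie" by (intro lie_scale dual_vec_lie)
  have dual: "form_scale nm s * killing B b' (cmat_scale (1 / \<kappa>) (dual_vec b)) = (if b' = b then 1 else 0)"
    if "b' \<in> B" for b'
    using that \<kappa>(2) by (simp add: kil y cmat_scale_mult trace_cmat_scale trace_dual_vec Bl rep)
  show "cmat_scale (1 / \<kappa>) (dual_vec b) \<in> lie \<and>
     (\<forall>b'\<in>B. form_scale nm s * killing B b' (cmat_scale (1 / \<kappa>) (dual_vec b)) = (if b' = b then 1 else 0))"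
    using y dual by blast
  fix z assume z: "z \<in> lie \<and> (\<forall>b'\<in>B. form_scale nm s * killing B b' z = (if b' = b then 1 else 0))"
  define d where "d = z - cmat_scale (1 / \<kappa>) (dual_vec b)"
  have "d \<in> lie"
    using z lie_add[of z "cmat_scale (- 1) (cmat_scale (1 / \<kappa>) (dual_vec b))"] lie_scale[OF y, of "- 1"]
    by (simp add: d_def)
  have "trace (b' ** d) = 0" if "b' \<in> B" for b'
  proof -
    have "\<kappa> * trace (b' ** z) = \<kappa> * trace (b' ** cmat_scale (1 / \<kappa>) (dual_vec b))"
      using z dual that kil y by metis
    then show ?thesis using \<kappa>(2) by (simp add: d_def matrix_sub_ldistrib trace_sub)
  qed
  then have B0: "trace (b' ** d) = 0" if "b' \<in> B" for b' using that by blast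
  have "trace (x ** d) = 0" if "x \<in> lie" for x
  proof -
    have "x ** d = (\<Sum>b\<in>B. cmat_scale (coord b x) (b ** d))"
      by (subst coord_expand[OF that, symmetric])
        (simp add: sum_matrix_mult cmat_scale_mult)
    then show ?thesis by (simp add: trace_setsum trace_cmat_scale B0)
  qed
  \<comment> \<open>Since \<open>d = proj d\<close>, the projection can be moved onto the matrix
    unit, which brings the test matrix into the Lie algebra.\<close>
  then have "trace (unit_mat j i ** d) = 0" for i j
    using trace_proj[of "unit_mat j i" d] proj_id[OF \<open>d \<in> lie\<close>] proj_lie by simp
  moreover have "trace (unit_mat j i ** d) = d $ i $ j" for i j
  proof -
    have "trace (unit_mat j i ** d) = trace (mat 1 ** unit_mat j i ** d)" by simp
    also have "\<dots> = (\<Sum>k\<in>UNIV. (if k = j then 1 else 0) * d $ i $ k)"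
      by (simp only: trace_def mult_unit_mult) (simp add: mat_def)
    finally show ?thesis by (simp add: if_distrib[where f="\<lambda>x. x * _"] cong: if_cong)
  qed
  ultimately have "d = 0" by (simp add: vec_eq_iff)
  then show "z = cmat_scale (1 / \<kappa>) (dual_vec b)" by (simp add: d_def)
qed

text \<open>The Casimir tensor does not depend on the basis.\<close>

lemma casimir_sum:
  assumes add1: "\<And>x y w. \<lbrakk>x \<in> lie; y \<in> lie; w \<in> lie\<rbrakk> \<Longrightarrow> \<beta> (x + y) w = \<beta> x w + \<beta> y w"
    and scale1: "\<And>a x w. \<lbrakk>x \<in> lie; w \<in> lie\<rbrakk> \<Longrightarrow> \<beta> (cmat_scale a x) w = a * \<beta> x w"
    and add2: "\<And>x y w. \<lbrakk>x \<in> lie; y \<in> lie; w \<in> lie\<rbrakk> \<Longrightarrow> \<beta> w (x + y) = \<beta> w x + \<beta> w y"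
    and scale2: "\<And>a x w. \<lbrakk>x \<in> lie; w \<in> lie\<rbrakk> \<Longrightarrow> \<beta> w (cmat_scale a x) = a * \<beta> w x"
  shows "(\<Sum>b\<in>B. \<beta> b (cmat_scale a (dual_vec b)))
      = a * (\<Sum>i\<in>UNIV. \<Sum>j\<in>UNIV. \<beta> (proj (unit_mat i j)) (proj (unit_mat j i)))"
proof -
  have Bl: "b \<in> lie" if "b \<in> B" for b using that B cmat.span_base by blast
  have zero: "0 \<in> lie" using lie_scale[OF proj_lie, of 0] by simp
  have sum1: "\<beta> (\<Sum>k\<in>A. cmat_scale (c k) (f k)) w = (\<Sum>k\<in>A. c k * \<beta> (f k) w)"
    if "\<And>k. k \<in> A \<Longrightarrow> f k \<in> lie" "w \<in> lie" for A :: "(complex^'m^'m) set" and c f w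
    using that
  proof (induction A rule: infinite_finite_induct)
    case (insert k A)
    then show ?case by (simp add: add1 scale1 lie_scale lie_sum)
  qed (use scale1[OF zero, of w 0] in simp_all)
  have sum2: "\<beta> w (\<Sum>k\<in>A. cmat_scale (c k) (f k)) = (\<Sum>k\<in>A. c k * \<beta> w (f k))"
    if "\<And>k. k \<in> A \<Longrightarrow> f k \<in> lie" "w \<in> lie" for A :: "('m \<times> 'm) set" and c f w
    using that
  proof (induction A rule: infinite_finite_induct)
    case (insert k A)
    then show ?case by (simp add: add2 scale2 lie_scale lie_sum)
  qed (use scale2[OF zero, of w 0] in simp_all)
  have "(\<Sum>b\<in>B. \<beta> b (cmat_scale a (dual_vec b)))
     = (\<Sum>b\<in>B. a * (\<Sum>(i,j)\<in>UNIV. coord b (unit_mat i j) * \<beta> b (proj (unit_mat j i))))"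
    by (intro sum.cong refl, subst scale2, rule dual_vec_lie, erule Bl, unfold dual_vec_def split_def, subst sum2)
      (simp_all add: proj_lie Bl)
  also have "\<dots> = a * (\<Sum>(i,j)\<in>UNIV. \<Sum>b\<in>B. coord b (unit_mat i j) * \<beta> b (proj (unit_mat j i)))"
    unfolding sum_distrib_left[symmetric] split_def by (subst sum.swap) (rule refl)
  also have "\<dots> = a * (\<Sum>(i,j)\<in>UNIV. \<beta> (proj (unit_mat i j)) (proj (unit_mat j i)))"
  proof -
    have "(\<Sum>b\<in>B. coord b (unit_mat i j) * \<beta> b (proj (unit_mat j i))) = \<beta> (proj (unit_mat i j)) (proj (unit_mat j i))" for i j
    proof -
      have "(\<Sum>b\<in>B. cmat_scale (coord b (unit_mat i j)) b) = proj (unit_mat i j)"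
        using coord_expand[OF proj_lie, of "unit_mat i j"] by (simp add: proj_id proj_lie)
      then show ?thesis using sum1[of B "\<lambda>b. b" "proj (unit_mat j i)" "\<lambda>b. coord b (unit_mat i j)"] Bl proj_lie by simp
    qed
    then show ?thesis by simp
  qed
  finally show ?thesis by (simp add: sum.cartesian_product)
qed

end

end

section \<open>The form matrices\<close>

lemma cmat_of_mult: "cmat_of (x ** y) = cmat_of x ** cmat_of y"
  by (simp add: vec_eq_iff cmat_of_def matrix_matrix_mult_def)

lemma cmat_of_add: "cmat_of (x + y) = cmat_of x + cmat_of y"
  by (simp add: vec_eq_iff cmat_of_def)

lemma cmat_of_scaleR: "cmat_of (r *\<^sub>R x) = cmat_scale (of_real r) (cmat_of x)"
  by (simp add: vec_eq_iff cmat_of_def cmat_scale_def)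

lemma cmat_of_transpose: "cmat_of (transpose x) = transpose (cmat_of x)"
  by (simp add: vec_eq_iff cmat_of_def transpose_def)

lemma cmat_of_mat_1: "cmat_of (mat 1) = mat 1"
  by (simp add: vec_eq_iff cmat_of_def mat_def)

lemma cmat_of_minus: "cmat_of (- x) = - cmat_of x"
  by (simp add: vec_eq_iff cmat_of_def)

lemma cmat_Re_of [simp]: "cmat_Re (cmat_of x) = x"
  by (simp add: vec_eq_iff cmat_of_def cmat_Re_def)

lemma cmat_Im_of [simp]: "cmat_Im (cmat_of x) = 0"
  by (simp add: vec_eq_iff cmat_of_def cmat_Im_def)

fun form_sign :: "setting \<Rightarrow> real" where
  "form_sign (Sp n) = - 1"
| "form_sign (O1 p q) = 1"
| "form_sign (O2 p q) = 1"

lemma form_sign_square: "form_sign s * form_sign s = 1"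
  by (cases s) auto

text \<open>The form matrix is a signed permutation matrix: in row \<open>i\<close> the only nonzero
  entry is \<open>entry_sign s i\<close>, in column \<open>partner s i\<close>. This lets the
  settings share their matrix computations.\<close>

fun partner :: "setting \<Rightarrow> nat \<Rightarrow> nat" where
  "partner (Sp n) i = (if i \<le> n then n + i else i - n)"
| "partner (O1 p q) i = i"
| "partner (O2 p q) i = i"

fun entry_sign :: "setting \<Rightarrow> nat \<Rightarrow> real" where
  "entry_sign (Sp n) i = (if i \<le> n then 1 else - 1)"
| "entry_sign (O1 p q) i = (if i \<le> p then 1 else - 1)"
| "entry_sign (O2 p q) i = (if i \<le> p then 1 else - 1)"

lemma partner_mem: "i \<in> {1..mat_size s} \<Longrightarrow> partner s i \<in> {1..mat_size s}"
  by (cases s) auto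

lemma partner_partner: "i \<in> {1..mat_size s} \<Longrightarrow> partner s (partner s i) = i"
  by (cases s) auto

lemma entry_sign_partner: "i \<in> {1..mat_size s} \<Longrightarrow> entry_sign s (partner s i) = form_sign s * entry_sign s i"
  by (cases s) auto

lemma entry_sign_square: "entry_sign s i * entry_sign s i = 1"
  by (cases s) auto

lemma scaleR_matrix_mult: "(r *\<^sub>R A) ** B = r *\<^sub>R (A ** (B :: real^'n^'m))"
  by (simp add: vec_eq_iff matrix_matrix_mult_def sum_distrib_left mult.assoc)

lemma matrix_mult_scaleR: "A ** (r *\<^sub>R B) = r *\<^sub>R (A ** (B :: real^'n^'m))"
  by (simp add: vec_eq_iff matrix_matrix_mult_def sum_distrib_left mult.left_commute)

locale group_setting =
  fixes s :: setting and e :: "nat \<Rightarrow> 'm::finite"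
  assumes e: "bij_betw e {1..mat_size s} UNIV"
begin

abbreviation "N \<equiv> mat_size s"
abbreviation "J \<equiv> form_matrix s e"
abbreviation "\<epsilon> \<equiv> form_sign s"

lemma CARD_N: "CARD('m) = N"
  unfolding bij_betw_same_card[OF e, symmetric] by simp

lemma e_eq_iff: "\<lbrakk>i \<in> {1..N}; j \<in> {1..N}\<rbrakk> \<Longrightarrow> e i = e j \<longleftrightarrow> i = j"
  by (rule inj_on_eq_iff[OF bij_betw_imp_inj_on[OF e]])

lemma sum_e: "(\<Sum>x\<in>UNIV. f x) = (\<Sum>k=1..N. f (e k))"
  by (rule sum.reindex_bij_betw[OF e, symmetric])

lemma mat_eqI:
  assumes "\<And>i j. \<lbrakk>i \<in> {1..N}; j \<in> {1..N}\<rbrakk> \<Longrightarrow> A $ e i $ e j = B $ e i $ e j"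
  shows "A = B"
  unfolding vec_eq_iff
proof (intro allI)
  fix x y
  have "x \<in> e ` {1..N}" "y \<in> e ` {1..N}" unfolding bij_betw_imp_surj_on[OF e] by simp_all
  then obtain i j where "i \<in> {1..N}" "j \<in> {1..N}" "x = e i" "y = e j" by (elim imageE)
  then show "A $ x $ y = B $ x $ y" using assms by simp
qed

lemma E_nth:
  "\<lbrakk>i \<in> {1..N}; j \<in> {1..N}; a \<in> {1..N}; b \<in> {1..N}\<rbrakk> \<Longrightarrow>
    E e a b $ e i $ e j = (if i = a \<and> j = b then 1 else 0)"
  by (simp add: E_def e_eq_iff del: atLeastAtMost_iff)

lemma diag_nth:
  assumes "i \<in> {1..N}" "j \<in> {1..N}" "A \<subseteq> {1..N}"
  shows "(\<Sum>k\<in>A. E e k k) $ e i $ e j = (if i = j \<and> i \<in> A then 1 else 0)"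
proof -
  have fin: "finite A" using assms(3) finite_subset by blast
  have "(\<Sum>k\<in>A. E e k k) $ e i $ e j = (\<Sum>k\<in>A. if k = i then (if i = j then 1 else 0) else 0)"
    unfolding sum_component using assms by (intro sum.cong refl, subst E_nth) auto
  then show ?thesis using fin by auto
qed

lemma form_nth:
  assumes "i \<in> {1..N}" "j \<in> {1..N}"
  shows "J $ e i $ e j = (if j = partner s i then entry_sign s i else 0)"
proof (cases s)
  case (Sp n)
  have "J $ e i $ e j = (\<Sum>k=1..n. E e k (n + k) $ e i $ e j - E e (n + k) k $ e i $ e j)"
    by (simp add: Sp)
  also have "\<dots> = (\<Sum>k=1..n. (if k = i then (if j = n + i then 1 else 0) else 0)
      - (if k = j then (if i = n + j then 1 else 0) else 0))"
    using assms by (intro sum.cong refl arg_cong2[where f="(-)"]; subst E_nth) (auto simp: Sp)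
  also have "\<dots> = (if j = partner s i then entry_sign s i else 0)"
    using assms by (auto simp: Sp sum_subtractf)
  finally show ?thesis .
next
  case (O1 p q)
  have "J $ e i $ e j = (\<Sum>k\<in>{1..p}. E e k k) $ e i $ e j - (\<Sum>k\<in>{p+1..p+q}. E e k k) $ e i $ e j"
    by (simp add: O1)
  also have "\<dots> = (if j = partner s i then entry_sign s i else 0)"
    using assms by (subst (1 2) diag_nth) (auto simp: O1)
  finally show ?thesis .
next
  case (O2 p q)
  have "J $ e i $ e j = (\<Sum>k\<in>{1..p}. E e k k) $ e i $ e j - (\<Sum>k\<in>{p+1..p+q}. E e k k) $ e i $ e j"
    by (simp add: O2)
  also have "\<dots> = (if j = partner s i then entry_sign s i else 0)"
    using assms by (subst (1 2) diag_nth) (auto simp: O2)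
  finally show ?thesis .
qed

lemma J_mult_nth:
  assumes "i \<in> {1..N}"
  shows "(J ** A) $ e i $ y = entry_sign s i * A $ e (partner s i) $ y"
proof -
  have "(J ** A) $ e i $ y = (\<Sum>k=1..N. if k = partner s i then entry_sign s i * A $ e k $ y else 0)"
    unfolding matrix_matrix_mult_def using assms by (simp add: sum_e form_nth if_distrib[where f="\<lambda>x. x * _"] cong: if_cong)
  then show ?thesis using partner_mem[OF assms] by simp
qed

lemma form_square: "J ** J = \<epsilon> *\<^sub>R mat 1"
proof (rule mat_eqI)
  fix i j assume ij: "i \<in> {1..N}" "j \<in> {1..N}"
  have "(J ** J) $ e i $ e j = (if i = j then entry_sign s i * (\<epsilon> * entry_sign s i) else 0)"
    unfolding J_mult_nth[OF ij(1)] form_nth[OF partner_mem[OF ij(1)] ij(2)]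
    using ij by (auto simp: partner_partner entry_sign_partner)
  then show "(J ** J) $ e i $ e j = (\<epsilon> *\<^sub>R mat 1) $ e i $ e j"
    using ij by (simp add: mat_def e_eq_iff mult.left_commute[of _ \<epsilon>] entry_sign_square del: atLeastAtMost_iff)
qed

lemma form_transpose: "transpose J = \<epsilon> *\<^sub>R J"
proof (rule mat_eqI)
  fix i j assume ij: "i \<in> {1..N}" "j \<in> {1..N}"
  have "transpose J $ e i $ e j = (if i = partner s j then entry_sign s j else 0)"
    using ij by (simp add: transpose_def form_nth)
  also have "\<dots> = (if j = partner s i then entry_sign s (partner s i) else 0)"
    using ij partner_partner by metis
  finally show "transpose J $ e i $ e j = (\<epsilon> *\<^sub>R J) $ e i $ e j"
    using ij by (simp add: form_nth entry_sign_partner)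
qed

sublocale form_mat "cmat_of J" "of_real \<epsilon>"
proof
  show "cmat_of J ** cmat_of J = cmat_scale (of_real \<epsilon>) (mat 1)"
    using arg_cong[OF form_square, of cmat_of] by (simp add: cmat_of_mult cmat_of_scaleR cmat_of_mat_1)
  show "transpose (cmat_of J) = cmat_scale (of_real \<epsilon>) (cmat_of J)"
    using arg_cong[OF form_transpose, of cmat_of] by (simp add: cmat_of_transpose cmat_of_scaleR)
  show "complex_of_real \<epsilon> * of_real \<epsilon> = 1"
    using form_sign_square[of s] by (metis of_real_1 of_real_mult)
qed

lemma lie_g_cpx: "lie = g_cpx s e"
proof -
  have "transpose Z ** cmat_of J + cmat_of J ** Z = 0 \<longleftrightarrow>
     transpose (cmat_Re Z) ** J + J ** cmat_Re Z = 0 \<and> transpose (cmat_Im Z) ** J + J ** cmat_Im Z = 0" for Z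
    by (simp add: vec_eq_iff matrix_matrix_mult_def transpose_def cmat_of_def cmat_Re_def cmat_Im_def
        complex_eq_iff) blast
  then show ?thesis by (auto simp: lie_def g_cpx_def g0_def)
qed

lemma g0_lie: "X \<in> g0 s e \<longleftrightarrow> cmat_of X \<in> lie"
proof -
  have "0 \<in> g0 s e" by (simp add: g0_def vec_eq_iff matrix_matrix_mult_def transpose_def)
  then show ?thesis by (simp add: lie_g_cpx g_cpx_def)
qed

lemma g_star_lie: "Z \<in> lie \<Longrightarrow> g_star Z \<in> lie"
proof -
  have "cmat_Re (g_star Z) = - cmat_Re Z" "cmat_Im (g_star Z) = cmat_Im Z"
    by (simp_all add: vec_eq_iff g_star_def cmat_cnj_def cmat_Re_def cmat_Im_def)
  moreover have "X \<in> g0 s e \<Longrightarrow> - X \<in> g0 s e" for X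
    using lie_scale[of "cmat_of X" "- 1"] by (simp add: g0_lie cmat_of_minus)
  ultimately show "Z \<in> lie \<Longrightarrow> g_star Z \<in> lie" by (simp add: lie_g_cpx g_cpx_def)
qed

text \<open>Conjugation commutes with \<open>proj\<close>, since \<open>J\<close> comes from a real
  matrix and \<open>\<epsilon>\<close> is a sign.\<close>

lemma proj_unit_real: "proj (unit_mat i j) = cmat_of (cmat_Re (proj (unit_mat i j)))"
proof -
  have r: "cmat_cnj (proj (unit_mat i j)) = proj (unit_mat i j)"
    unfolding proj_def transpose_unit
    by (simp add: vec_eq_iff cmat_scale_nth mult_unit_mult unit_mat_nth cmat_cnj_def)
      (simp add: cmat_of_def)
  then have "Im (proj (unit_mat i j) $ x $ y) = 0" for x y
    by (auto simp: vec_eq_iff cmat_cnj_def complex_eq_iff)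
  then show ?thesis by (simp add: vec_eq_iff cmat_of_def cmat_Re_def complex_eq_iff)
qed

text \<open>\<open>\<theta>\<close> is the imaginary unit or 1. Its square makes \<open>xi\<close>
  an involution, and its conjugate makes \<open>xi\<close> self-adjoint on \<open>V\<close> in
  \<open>hV_xi\<close>.\<close>

lemma xi_scale: "\<exists>\<theta>. xi s e = cmat_scale \<theta> (cmat_of J) \<and> \<theta> * \<theta> = of_real \<epsilon> \<and> cnj \<theta> = \<theta> * of_real \<epsilon>"
  by (cases s) (auto intro: exI[of _ \<i>] exI[of _ 1])

lemma xi_square: "xi s e ** xi s e = mat 1"
proof -
  obtain \<theta> where \<theta>: "xi s e = cmat_scale \<theta> (cmat_of J)" "\<theta> * \<theta> = of_real \<epsilon>" using xi_scale by blast
  then have "xi s e ** xi s e = cmat_scale (\<theta> * \<theta>) (cmat_of J ** cmat_of J)"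
    by (simp add: cmat_scale_mult)
  then show ?thesis
    using form_mat.eps[OF form_mat_axioms] by (simp add: \<theta> form_mat.JJ[OF form_mat_axioms])
qed

lemma xi_conj: "Z \<in> lie \<Longrightarrow> xi s e ** Z ** xi s e = - transpose Z"
proof -
  assume "Z \<in> lie"
  then have Z: "cmat_of J ** Z = - (transpose Z ** cmat_of J)"
    by (simp add: lie_def add_eq_0_iff)
  obtain \<theta> where \<theta>: "xi s e = cmat_scale \<theta> (cmat_of J)" "\<theta> * \<theta> = of_real \<epsilon>" using xi_scale by blast
  have "xi s e ** Z ** xi s e = cmat_scale (of_real \<epsilon>) (cmat_of J ** Z ** cmat_of J)"
    by (simp add: \<theta> cmat_scale_mult)
  also have "cmat_of J ** Z ** cmat_of J = - cmat_scale (of_real \<epsilon>) (transpose Z)"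
    unfolding Z by (simp add: matrix_neg_mult xJJ)
  finally show ?thesis using form_mat.eps[OF form_mat_axioms] by simp
qed

lemma transpose_lie: "Z \<in> lie \<Longrightarrow> transpose Z \<in> lie"
proof -
  assume Z: "Z \<in> lie"
  then have "transpose Z ** cmat_of J = - (cmat_of J ** Z)" by (simp add: lie_def eq_neg_iff_add_eq_0)
  then have "cmat_of J ** (transpose Z ** cmat_of J) ** cmat_of J = - (cmat_of J ** (cmat_of J ** Z) ** cmat_of J)"
    by (simp add: matrix_neg_mult)
  then have "cmat_scale (of_real \<epsilon>) (cmat_of J ** transpose Z) = - cmat_scale (of_real \<epsilon>) (Z ** cmat_of J)"
    by (simp add: matrix_mul_assoc xJJ) (simp add: form_mat.JJ[OF form_mat_axioms] cmat_scale_mult)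
  then have "cmat_scale (of_real \<epsilon>) (cmat_scale (of_real \<epsilon>) (cmat_of J ** transpose Z))
      = - cmat_scale (of_real \<epsilon>) (cmat_scale (of_real \<epsilon>) (Z ** cmat_of J))" by simp
  then show ?thesis using form_mat.eps[OF form_mat_axioms] by (simp add: lie_def transpose_transpose)
qed

text \<open>Every setting has the shape \<open>E e a b + E e b a\<close> with opposite entry signs
  at \<open>a\<close> and \<open>b\<close>, where \<open>partner\<close> either exchanges the two
  indices or is the identity. This places the subgroup \<open>A\<close> inside \<open>G\<close>,
  which is needed when the equivariance of functions in \<open>ps_space\<close> is
  differentiated.\<close>

lemma a_elt_g0:
  assumes i: "i \<in> {1..real_rank s}" and v: "valid_setting s"
  shows "a_elt s e i \<in> g0 s e"
proof -
  obtain a b where X: "a_elt s e i = E e a b + E e b a" and ab: "a \<in> {1..N}" "b \<in> {1..N}"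
    and sg: "entry_sign s a + entry_sign s b = 0"
    and pt: "partner s a = b \<and> partner s b = a \<and> \<epsilon> = - 1 \<or> (\<forall>x. partner s x = x) \<and> \<epsilon> = 1"
  proof (cases s)
    case (Sp n)
    then show ?thesis using i by (intro that[of i "n + i"]) auto
  next
    case (O1 p q)
    then show ?thesis using i v by (intro that[of "p + 1 - i" "p + i"]) auto
  next
    case (O2 p q)
    then show ?thesis using i v by (intro that[of "p + 1 - i" "p + i"]) auto
  qed
  let ?X = "E e a b + E e b a"
  have nth: "?X $ e k $ e m = (if k = a \<and> m = b then 1 else 0) + (if k = b \<and> m = a then 1 else 0)"
    if "k \<in> {1..N}" "m \<in> {1..N}" for k m
    using that ab by (simp add: E_nth del: atLeastAtMost_iff)
  have "transpose ?X ** J = transpose (transpose J ** ?X)"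
    by (simp add: matrix_transpose_mul)
  also have "transpose J ** ?X = \<epsilon> *\<^sub>R (J ** ?X)"
    unfolding form_transpose by (rule scaleR_matrix_mult)
  finally have XJ: "transpose ?X ** J = transpose (\<epsilon> *\<^sub>R (J ** ?X))" .
  have "transpose ?X ** J + J ** ?X = 0"
  proof (rule mat_eqI)
    fix k m assume km: "k \<in> {1..N}" "m \<in> {1..N}"
    have null: "\<epsilon> * (entry_sign s m * ((if partner s m = a \<and> k = b then 1 else 0) + (if partner s m = b \<and> k = a then 1 else 0)))
        + entry_sign s k * ((if partner s k = a \<and> m = b then 1 else 0) + (if partner s k = b \<and> m = a then 1 else 0)) = 0"
      using pt
    proof
      assume *: "partner s a = b \<and> partner s b = a \<and> \<epsilon> = - 1"
      have p: "partner s i = x \<longleftrightarrow> i = partner s x" if "i \<in> {1..N}" "x \<in> {1..N}" for i x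
        using partner_partner[OF that(1)] partner_partner[OF that(2)] by metis
      have pm: "partner s m = a \<longleftrightarrow> m = b" "partner s m = b \<longleftrightarrow> m = a"
        "partner s k = a \<longleftrightarrow> k = b" "partner s k = b \<longleftrightarrow> k = a"
        using p[OF km(1) ab(1)] p[OF km(1) ab(2)] p[OF km(2) ab(1)] p[OF km(2) ab(2)] * by metis+
      have "\<epsilon> = - 1" using * by blast
      then show ?thesis unfolding pm by auto
    next
      assume "(\<forall>x. partner s x = x) \<and> \<epsilon> = 1"
      then have pm: "partner s m = m" "partner s k = k" "\<epsilon> = 1" by blast+
      have "entry_sign s k + entry_sign s m = 0" if "k = a \<and> m = b \<or> k = b \<and> m = a"
        using that sg by (elim disjE conjE) simp_all
      then show ?thesis unfolding pm by (cases "k = a"; cases "m = b"; cases "k = b"; cases "m = a") simp_all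
    qed
    have "(transpose ?X ** J + J ** ?X) $ e k $ e m
        = \<epsilon> * (entry_sign s m * ?X $ e (partner s m) $ e k) + entry_sign s k * ?X $ e (partner s k) $ e m"
      unfolding XJ using km by (simp add: transpose_def J_mult_nth)
    also have "\<dots> = 0"
      unfolding nth[OF partner_mem[OF km(1)] km(2)] nth[OF partner_mem[OF km(2)] km(1)] by (rule null)
    finally show "(transpose ?X ** J + J ** ?X) $ e k $ e m = 0 $ e k $ e m" by simp
  qed
  then show ?thesis by (simp add: g0_def X)
qed

end

section \<open>The matrix exponential\<close>

definition mpow :: "real^'m::finite^'m \<Rightarrow> nat \<Rightarrow> real^'m^'m" where
  "mpow X r = ((**) X ^^ r) (mat 1)"

lemma mpow_0: "mpow X 0 = mat 1"
  by (simp add: mpow_def)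

lemma mpow_Suc: "mpow X (Suc r) = X ** mpow X r"
  by (simp add: mpow_def)

lemma bounded_bilinear_matrix_mult: "bounded_bilinear ((**) :: real^'m::finite^'n::finite \<Rightarrow> real^'k::finite^'m \<Rightarrow> real^'k^'n)"
  unfolding bilinear_conv_bounded_bilinear[symmetric] bilinear_def
  by (auto intro!: linearI simp: matrix_add_ldistrib matrix_add_mult scaleR_matrix_mult matrix_mult_scaleR)

lemmas bounded_linear_matrix_mult_left = bounded_bilinear.bounded_linear_left[OF bounded_bilinear_matrix_mult]
lemmas bounded_linear_matrix_mult_right = bounded_bilinear.bounded_linear_right[OF bounded_bilinear_matrix_mult]

lemma bounded_linear_nth_nth: "bounded_linear (\<lambda>A :: real^'m::finite^'n::finite. A $ i $ j)"
  by (intro bounded_linear_compose[OF bounded_linear_vec_nth] bounded_linear_vec_nth)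

lemma summable_mexp: "summable (\<lambda>r. (t ^ r / fact r) *\<^sub>R mpow X r)"
proof -
  \<comment> \<open>\<open>C\<close> bounds left multiplication by \<open>X\<close> and takes the
    place of submultiplicativity of the norm.\<close>
  obtain C where C: "C > 0" "\<And>A :: real^'a^'a. norm (X ** A) \<le> C * norm A"
    using linear_bounded_pos[of "(**) X"] bounded_linear_matrix_mult_right[of X, THEN bounded_linear.linear] by blast
  have pow: "norm (mpow X r) \<le> C ^ r * norm (mat 1 :: real^'a^'a)" for r
  proof (induction r)
    case (Suc r)
    have "norm (mpow X (Suc r)) \<le> C * norm (mpow X r)" unfolding mpow_Suc by (rule C(2))
    also have "\<dots> \<le> C * (C ^ r * norm (mat 1 :: real^'a^'a))" using C(1) Suc by (intro mult_left_mono) auto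
    finally show ?case by simp
  qed (simp add: mpow_0)
  have "summable (\<lambda>r. norm (mat 1 :: real^'a^'a) * ((\<bar>t\<bar> * C) ^ r /\<^sub>R fact r))"
    by (intro summable_mult summable_exp_generic)
  then show ?thesis
  proof (rule summable_comparison_test'[where N=0])
    fix r
    have "norm ((t ^ r / fact r) *\<^sub>R mpow X r) = \<bar>t\<bar> ^ r / fact r * norm (mpow X r)"
      by (simp add: power_abs)
    also have "\<dots> \<le> \<bar>t\<bar> ^ r / fact r * (C ^ r * norm (mat 1 :: real^'a^'a))"
      by (intro mult_left_mono pow) auto
    finally show "norm ((t ^ r / fact r) *\<^sub>R mpow X r) \<le> norm (mat 1 :: real^'a^'a) * ((\<bar>t\<bar> * C) ^ r /\<^sub>R fact r)"
      by (simp add: power_mult_distrib field_simps)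
  qed
qed

lemma mexp_series: "mexp (t *\<^sub>R X) = (\<Sum>r. (t ^ r / fact r) *\<^sub>R mpow X r)"
proof -
  have "mpow (t *\<^sub>R X) r = t ^ r *\<^sub>R mpow X r" for r
    by (induction r) (simp_all add: mpow_0 mpow_Suc scaleR_matrix_mult matrix_mult_scaleR)
  then show ?thesis by (simp add: mexp_def mpow_def[symmetric])
qed

lemma mexp_0: "mexp (0 *\<^sub>R X) = mat 1"
proof -
  have "(\<lambda>r. (0 ^ r / fact r) *\<^sub>R mpow X r) = (\<lambda>r. if r = 0 then mat 1 else 0)"
    by (auto simp: mpow_0 fun_eq_iff)
  then show ?thesis unfolding mexp_series using suminf_finite[of "{0}" "\<lambda>r. if r = 0 then mat 1 else 0"] by simp
qed

lemma matrix_has_vector_derivative: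
  fixes M :: "real \<Rightarrow> real^'m::finite^'n::finite"
  assumes "\<And>i j. ((\<lambda>t. M t $ i $ j) has_field_derivative M' $ i $ j) (at t)"
  shows "(M has_vector_derivative M') (at t)"
  unfolding has_vector_derivative_def
proof (subst has_derivative_componentwise_within, intro ballI)
  fix b :: "real^'m^'n" assume "b \<in> Basis"
  then obtain i j where b: "b = axis i (axis j 1)" by (auto simp: Basis_vec_def)
  show "((\<lambda>x. M x \<bullet> b) has_derivative (\<lambda>x. x *\<^sub>R M' \<bullet> b)) (at t)"
    using assms[of i j] by (simp add: b inner_axis has_field_derivative_def mult.commute[of _ "M' $ i $ j"] mult_commute_abs)
qed

text \<open>Each entry is a power series in \<open>t\<close> and is differentiated termwise;
  shifting the coefficients by \<open>diffs\<close> produces the factor \<open>X\<close>.\<close>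

lemma mexp_has_vector_derivative:
  "((\<lambda>t. mexp (t *\<^sub>R X)) has_vector_derivative X ** mexp (t *\<^sub>R X)) (at t)"
proof (rule matrix_has_vector_derivative)
  fix i j
  define c where "c r = mpow X r $ i $ j / fact r" for r
  have nth: "mexp (t *\<^sub>R X) $ i $ j = (\<Sum>r. c r * t ^ r)" for t
    unfolding mexp_series bounded_linear.suminf[OF bounded_linear_nth_nth summable_mexp]
    by (simp add: c_def mult.commute)
  have sm: "summable (\<lambda>r. c r * t ^ r)" for t
    using bounded_linear.summable[OF bounded_linear_nth_nth[of i j] summable_mexp[of t X]]
    by (simp add: c_def mult.commute)
  have "(X ** mexp (t *\<^sub>R X)) $ i $ j = (\<Sum>r. (X ** ((t ^ r / fact r) *\<^sub>R mpow X r)) $ i $ j)"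
    unfolding mexp_series
    by (rule bounded_linear.suminf[OF bounded_linear_compose[OF bounded_linear_nth_nth bounded_linear_matrix_mult_right] summable_mexp])
  also have "\<dots> = (\<Sum>r. diffs c r * t ^ r)"
    by (intro suminf_cong) (simp add: diffs_def c_def matrix_mult_scaleR mpow_Suc[symmetric] del: of_nat_Suc)
  finally have "(X ** mexp (t *\<^sub>R X)) $ i $ j = (\<Sum>r. diffs c r * t ^ r)" .
  then show "((\<lambda>t. mexp (t *\<^sub>R X) $ i $ j) has_field_derivative (X ** mexp (t *\<^sub>R X)) $ i $ j) (at t)"
    unfolding nth using termdiffs_strong_converges_everywhere[OF sm] by simp
qed

lemma mexp_commute:
  assumes "A ** X = X ** A"
  shows "A ** mexp (t *\<^sub>R X) = mexp (t *\<^sub>R X) ** A"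
proof -
  have "A ** mpow X r = mpow X r ** A" for r
    by (induction r) (simp_all add: mpow_0 mpow_Suc matrix_mul_assoc assms, metis assms matrix_mul_assoc)
  then show ?thesis
    unfolding mexp_series
      bounded_linear.suminf[OF bounded_linear_matrix_mult_right summable_mexp]
      bounded_linear.suminf[OF bounded_linear_matrix_mult_left summable_mexp]
    by (simp add: scaleR_matrix_mult matrix_mult_scaleR)
qed

lemma matrix_inv_eq:
  assumes "B ** A = mat 1"
  shows "matrix_inv A ** A = mat 1" "A ** matrix_inv A = mat 1" "matrix_inv A = (B :: real^'n::finite^'n)"
proof -
  have "\<exists>A'. A ** A' = mat 1 \<and> A' ** A = mat 1"
    using assms matrix_left_right_inverse by blast
  then have "A ** matrix_inv A = mat 1 \<and> matrix_inv A ** A = mat 1"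
    unfolding matrix_inv_def by (rule someI_ex)
  then show 1: "matrix_inv A ** A = mat 1" "A ** matrix_inv A = mat 1" by auto
  have "matrix_inv A = (B ** A) ** matrix_inv A" by (simp add: assms)
  also have "\<dots> = B" by (simp add: matrix_mul_assoc[symmetric] 1)
  finally show "matrix_inv A = B" .
qed

context group_setting
begin

lemma G_mult: "\<lbrakk>g \<in> G_grp s e; h \<in> G_grp s e\<rbrakk> \<Longrightarrow> g ** h \<in> G_grp s e"
  unfolding G_grp_def by (simp add: matrix_transpose_mul) (metis matrix_mul_assoc)

lemma G_left_inverse: "g \<in> G_grp s e \<Longrightarrow> (form_sign s *\<^sub>R (J ** transpose g ** J)) ** g = mat 1"
  unfolding G_grp_def
  by (simp add: scaleR_matrix_mult matrix_mul_assoc[symmetric])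
    (simp add: form_square form_sign_square)

lemmas G_inv = matrix_inv_eq(1,2)[OF G_left_inverse]

lemma G_inv_mem: "g \<in> G_grp s e \<Longrightarrow> matrix_inv g \<in> G_grp s e"
proof -
  assume g: "g \<in> G_grp s e"
  let ?h = "matrix_inv g"
  have "transpose ?h ** J ** ?h = transpose ?h ** (transpose g ** J ** g) ** ?h"
    using g by (simp add: G_grp_def)
  also have "\<dots> = transpose (g ** ?h) ** J ** (g ** ?h)"
    by (simp add: matrix_transpose_mul matrix_mul_assoc)
  also have "\<dots> = J" by (simp add: G_inv[OF g] transpose_mat)
  finally show ?thesis by (simp add: G_grp_def)
qed

text \<open>Along \<open>mexp (t *\<^sub>R X)\<close> the transported form has derivative zero, by
  the defining equation of \<open>g0\<close>, and it is \<open>J\<close> at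
  \<open>t = 0\<close>.\<close>

lemma mexp_G: "X \<in> g0 s e \<Longrightarrow> mexp (t *\<^sub>R X) \<in> G_grp s e"
proof -
  assume X: "X \<in> g0 s e"
  let ?M = "\<lambda>t. mexp (t *\<^sub>R X)"
  have lin: "bounded_linear (transpose :: real^'m^'m \<Rightarrow> _)"
    by (intro linear_conv_bounded_linear[THEN iffD1] linearI) (simp_all add: transpose_add transpose_scalar vec_eq_iff transpose_def)
  have "((\<lambda>t. transpose (?M t) ** (J ** ?M t)) has_vector_derivative
      transpose (?M t) ** (J ** (X ** ?M t)) + transpose (X ** ?M t) ** (J ** ?M t)) (at t)" for t
    by (intro bounded_bilinear.has_vector_derivative[OF bounded_bilinear_matrix_mult]
        bounded_linear.has_vector_derivative[OF lin]
        bounded_linear.has_vector_derivative[OF bounded_linear_matrix_mult_right] mexp_has_vector_derivative)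
  moreover have "transpose (?M t) ** (J ** (X ** ?M t)) + transpose (X ** ?M t) ** (J ** ?M t)
      = transpose (?M t) ** (transpose X ** J + J ** X) ** ?M t" for t
    by (simp add: matrix_transpose_mul matrix_add_ldistrib matrix_add_mult matrix_mul_assoc add.commute)
  ultimately have "((\<lambda>t. transpose (?M t) ** (J ** ?M t)) has_derivative (\<lambda>h. 0)) (at t)" for t
    using X by (simp add: g0_def matrix_zero_mult has_vector_derivative_def)
  then obtain c where "\<And>t. transpose (?M t) ** (J ** ?M t) = c"
    using has_derivative_zero_constant[of UNIV "\<lambda>t. transpose (?M t) ** (J ** ?M t)"] by auto
  from this[of t] this[of 0] show ?thesis
    by (simp add: G_grp_def mexp_0[of X, simplified] transpose_mat matrix_mul_assoc)
qed

end

section \<open>Smooth functions\<close>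

lemma Ck_on_cong:
  assumes "open U" "\<And>x. x \<in> U \<Longrightarrow> F x = G x" "Ck_on r U F"
  shows "Ck_on r U G"
  using assms(2,3)
proof (induction r arbitrary: F G)
  case 0
  then show ?case using continuous_on_cong[of U U F G] by simp
next
  case (Suc r)
  have d: "F differentiable (at x)" if "x \<in> U" for x
    using Suc.prems(2) that assms(1) by (simp add: differentiable_on_eq_differentiable_at)
  have G: "(G has_derivative frechet_derivative F (at x)) (at x)" if "x \<in> U" for x
    using has_derivative_transform_within_open[OF frechet_derivative_works[THEN iffD1, OF d[OF that]] assms(1) that]
      Suc.prems(1) by blast
  then have "G differentiable_on U"
    using assms(1) by (auto simp: differentiable_on_eq_differentiable_at differentiable_def)
  moreover have "Ck_on r U (\<lambda>x. frechet_derivative G (at x) v)" for v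
  proof (rule Suc.IH)
    show "Ck_on r U (\<lambda>x. frechet_derivative F (at x) v)" using Suc.prems by simp
    show "frechet_derivative F (at x) v = frechet_derivative G (at x) v" if "x \<in> U" for x
      using frechet_derivative_at[OF G[OF that]] by simp
  qed
  ultimately show ?case by simp
qed

lemma Ck_on_subset:
  assumes "V \<subseteq> U" "Ck_on r U F"
  shows "Ck_on r V F"
  using assms(2)
  by (induction r arbitrary: F) (use assms(1) continuous_on_subset differentiable_on_subset in \<open>auto\<close>)

lemma Ck_on_SucD: "Ck_on (Suc r) U F \<Longrightarrow> Ck_on r U F"
  by (induction r arbitrary: F) (auto simp: differentiable_imp_continuous_on)

text \<open>Allows the derivative to be given by any formula; on an open set it is identified with
  \<open>frechet_derivative\<close> by uniqueness.\<close>

lemma Ck_on_SucI: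
  assumes U: "open U" and F: "\<And>x. x \<in> U \<Longrightarrow> (F has_derivative F' x) (at x)"
    and "\<And>v. Ck_on r U (\<lambda>x. F' x v)"
  shows "Ck_on (Suc r) U F"
proof -
  have "F differentiable_on U"
    using F by (auto simp: differentiable_on_eq_differentiable_at[OF U] differentiable_def)
  moreover have "Ck_on r U (\<lambda>x. frechet_derivative F (at x) v)" for v
    by (rule Ck_on_cong[OF U _ assms(3)[of v]]) (simp add: frechet_derivative_at[OF F, symmetric])
  ultimately show ?thesis by simp
qed

lemma Ck_on_has_derivative:
  "\<lbrakk>open U; Ck_on (Suc r) U F; x \<in> U\<rbrakk> \<Longrightarrow> (F has_derivative frechet_derivative F (at x)) (at x)"
  by (simp add: differentiable_on_eq_differentiable_at frechet_derivative_works[symmetric])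

lemma Ck_on_const: "open U \<Longrightarrow> Ck_on r U (\<lambda>_. c)"
proof (induction r arbitrary: c)
  case (Suc r)
  then show ?case by (intro Ck_on_SucI[where F'="\<lambda>_ _. 0"]) auto
qed simp

lemma Ck_on_linear: "open U \<Longrightarrow> bounded_linear L \<Longrightarrow> Ck_on r U L"
proof (cases r)
  case 0
  then show "bounded_linear L \<Longrightarrow> Ck_on r U L"
    using linear_continuous_on by simp
next
  case (Suc r')
  then show "open U \<Longrightarrow> bounded_linear L \<Longrightarrow> Ck_on r U L"
    by (auto simp del: Ck_on.simps(2) intro!: Ck_on_SucI[where F'="\<lambda>_. L"] bounded_linear_imp_has_derivative Ck_on_const)
qed

lemma Ck_on_add: "\<lbrakk>open U; Ck_on r U F; Ck_on r U G\<rbrakk> \<Longrightarrow> Ck_on r U (\<lambda>x. F x + G x)"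
proof (induction r arbitrary: F G)
  case 0
  then show ?case by (simp add: continuous_on_add)
next
  case (Suc r)
  show ?case
  proof (rule Ck_on_SucI[OF Suc.prems(1)])
    show "((\<lambda>x. F x + G x) has_derivative (\<lambda>v. frechet_derivative F (at x) v + frechet_derivative G (at x) v)) (at x)"
      if "x \<in> U" for x
      using Suc.prems that by (intro has_derivative_add Ck_on_has_derivative)
    show "Ck_on r U (\<lambda>x. frechet_derivative F (at x) v + frechet_derivative G (at x) v)" for v
      using Suc.prems by (intro Suc.IH) auto
  qed
qed

lemma Ck_on_mult: "\<lbrakk>open U; Ck_on r U F; Ck_on r U G\<rbrakk> \<Longrightarrow> Ck_on r U (\<lambda>x. F x * G x)"
proof (induction r arbitrary: F G)
  case 0
  then show ?case by (simp add: continuous_on_mult)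
next
  case (Suc r)
  show ?case
  proof (rule Ck_on_SucI[OF Suc.prems(1)])
    show "((\<lambda>x. F x * G x) has_derivative (\<lambda>v. F x * frechet_derivative G (at x) v + frechet_derivative F (at x) v * G x)) (at x)"
      if "x \<in> U" for x
      using Suc.prems that by (intro has_derivative_mult Ck_on_has_derivative)
    show "Ck_on r U (\<lambda>x. F x * frechet_derivative G (at x) v + frechet_derivative F (at x) v * G x)" for v
      using Suc.prems Ck_on_SucD[OF Suc.prems(2)] Ck_on_SucD[OF Suc.prems(3)]
      by (intro Ck_on_add Suc.IH) auto
  qed
qed

lemma Ck_on_sum: "open U \<Longrightarrow> (\<And>k. k \<in> A \<Longrightarrow> Ck_on r U (F k)) \<Longrightarrow> Ck_on r U (\<lambda>x. \<Sum>k\<in>A. F k x)"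
  by (induction A rule: infinite_finite_induct) (auto intro: Ck_on_const Ck_on_add)

text \<open>\<open>Ck_on\<close> controls derivatives in a fixed direction only. A direction
  depending linearly on the point, such as \<open>- (X ** x)\<close>, is expanded in the standard
  basis.\<close>

lemma Ck_on_derivative_linear:
  fixes F :: "'a::euclidean_space \<Rightarrow> complex"
  assumes U: "open U" and F: "\<And>r. Ck_on r U F" and L: "bounded_linear L"
  shows "Ck_on r U (\<lambda>x. frechet_derivative F (at x) (L x))"
proof -
  have "Ck_on r U (\<lambda>x. \<Sum>b\<in>Basis. of_real (L x \<bullet> b) * frechet_derivative F (at x) b)"
  proof (intro Ck_on_sum U Ck_on_mult)
    fix b :: 'a
    show "Ck_on r U (\<lambda>x. of_real (L x \<bullet> b))"
      by (intro Ck_on_linear U bounded_linear_compose[OF bounded_linear_of_real]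
          bounded_linear_compose[OF bounded_linear_inner_left] L)
    show "Ck_on r U (\<lambda>x. frechet_derivative F (at x) b)" using F[of "Suc r"] by simp
  qed
  moreover have "(\<Sum>b\<in>Basis. of_real (L x \<bullet> b) * frechet_derivative F (at x) b) = frechet_derivative F (at x) (L x)"
    if "x \<in> U" for x
  proof -
    have lin: "linear (frechet_derivative F (at x))"
      using has_derivative_bounded_linear[OF Ck_on_has_derivative[OF U F that]] bounded_linear.linear by blast
    have "frechet_derivative F (at x) (L x) = frechet_derivative F (at x) (\<Sum>b\<in>Basis. (L x \<bullet> b) *\<^sub>R b)"
      by (simp add: euclidean_representation)
    then show ?thesis by (simp add: linear_sum[OF lin] linear_scale[OF lin] scaleR_conv_of_real)
  qed
  ultimately show ?thesis by (rule Ck_on_cong[OF U, rotated])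
qed

lemma smooth_on_setE:
  assumes "smooth_on_set S f" "g \<in> S"
  obtains U F where "open U" "g \<in> U" "\<And>r. Ck_on r U F" "\<And>x. x \<in> U \<inter> S \<Longrightarrow> F x = f x"
  using bspec[OF assms(1)[unfolded smooth_on_set_def] assms(2)]
proof (elim exE conjE)
  fix U F
  assume "open U" "g \<in> U" "\<forall>r. Ck_on r U F" "\<forall>x\<in>U \<inter> S. F x = f x"
  then show thesis by (intro that[of U F]) simp_all
qed

lemma smooth_on_set_comb:
  assumes "smooth_on_set S f" "smooth_on_set S f'"
  shows "smooth_on_set S (\<lambda>x. a * f x + b * f' x)"
  unfolding smooth_on_set_def
proof
  fix g assume g: "g \<in> S"
  obtain U F where U: "open U" "g \<in> U" "\<And>r. Ck_on r U F" "\<And>x. x \<in> U \<inter> S \<Longrightarrow> F x = f x"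
    using smooth_on_setE[OF assms(1) g] by blast
  obtain U' F' where U': "open U'" "g \<in> U'" "\<And>r. Ck_on r U' F'" "\<And>x. x \<in> U' \<inter> S \<Longrightarrow> F' x = f' x"
    using smooth_on_setE[OF assms(2) g] by blast
  have o: "open (U \<inter> U')" using U U' by auto
  have "Ck_on r (U \<inter> U') (\<lambda>x. a * F x + b * F' x)" for r
    using Ck_on_subset[OF _ U(3), of "U \<inter> U'"] Ck_on_subset[OF _ U'(3), of "U \<inter> U'"] o
    by (intro Ck_on_add Ck_on_mult Ck_on_const) auto
  then show "\<exists>U F. open U \<and> g \<in> U \<and> (\<forall>r. Ck_on r U F) \<and> (\<forall>x\<in>U \<inter> S. F x = a * f x + b * f' x)"
    using U(2,4) U'(2,4) o
    by (intro exI[of _ "U \<inter> U'"] exI[of _ "\<lambda>x. a * F x + b * F' x"] conjI allI) simp_all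
qed

text \<open>Smoothness on \<open>S\<close> provides only a local extension \<open>F\<close> to an
  open set. A curve inside \<open>S\<close> cannot distinguish \<open>F\<close> from
  \<open>f\<close>, so the chain rule for \<open>F\<close> applies.\<close>

lemma curve_has_vector_derivative:
  assumes "open U" "g \<in> U" "Ck_on (Suc 0) U F" "\<And>x. x \<in> U \<inter> S \<Longrightarrow> F x = f x"
    and c: "c 0 = g" "\<And>t. c t \<in> S" "(c has_vector_derivative v) (at 0)"
  shows "((\<lambda>t. f (c t)) has_vector_derivative frechet_derivative F (at g) v) (at 0)"
proof -
  have F: "(F has_derivative frechet_derivative F (at g)) (at (c 0))"
    using Ck_on_has_derivative[OF assms(1,3,2)] c(1) by simp
  have "((\<lambda>t. F (c t)) has_derivative (\<lambda>h. frechet_derivative F (at g) (h *\<^sub>R v))) (at 0)"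
    using has_derivative_compose[OF c(3)[unfolded has_vector_derivative_def] F] .
  moreover have "linear (frechet_derivative F (at g))"
    using has_derivative_bounded_linear[OF F] bounded_linear.linear by blast
  ultimately have D: "((\<lambda>t. F (c t)) has_vector_derivative frechet_derivative F (at g) v) (at 0)"
    by (simp add: has_vector_derivative_def linear_scale)
  have "continuous (at 0) c" using has_vector_derivative_continuous[OF c(3)] .
  then have "\<forall>\<^sub>F t in at 0. c t \<in> U"
    using assms(1,2) c(1) by (auto simp: continuous_at dest: topological_tendstoD)
  then obtain d where d: "d > 0" "\<And>t. \<bar>t\<bar> < d \<Longrightarrow> t \<noteq> 0 \<Longrightarrow> c t \<in> U"
    by (auto simp: eventually_at dist_real_def)
  have "F (c t) = f (c t)" if "t \<in> {-d<..<d}" for t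
    using that d(2)[of t] assms(2,4) c(1,2) by (cases "t = 0") auto
  then show ?thesis
    using has_vector_derivative_transform_within_open[OF D, of "{-d<..<d}"] d(1) by auto
qed

context group_setting
begin

abbreviation "G \<equiv> G_grp s e"

lemma mexp_curve:
  "((\<lambda>t. mexp (- t *\<^sub>R X) ** g) has_vector_derivative - (X ** g)) (at 0)"
proof -
  have "((\<lambda>t. mexp (t *\<^sub>R (- X)) ** g) has_vector_derivative (- X ** mexp (0 *\<^sub>R (- X))) ** g) (at 0)"
    by (intro bounded_linear.has_vector_derivative[OF bounded_linear_matrix_mult_left] mexp_has_vector_derivative)
  then show ?thesis unfolding mexp_0 by (simp add: matrix_neg_mult)
qed

text \<open>As a directional derivative of the extension, the Lie derivative becomes visibly linear
  in \<open>X\<close> and smooth in \<open>g\<close>.\<close>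

lemma lie_deriv_extension:
  assumes "open U" "g \<in> U" "Ck_on (Suc 0) U F" "\<And>x. x \<in> U \<inter> G \<Longrightarrow> F x = f x"
    and X: "X \<in> g0 s e" and g: "g \<in> G"
  shows "((\<lambda>t. f (mexp (- t *\<^sub>R X) ** g)) has_vector_derivative lie_deriv X f g) (at 0)"
    and "lie_deriv X f g = frechet_derivative F (at g) (- (X ** g))"
proof -
  have "mexp (- t *\<^sub>R X) ** g \<in> G" for t by (intro G_mult mexp_G X g)
  moreover have "mexp (- 0 *\<^sub>R X) ** g = g" using mexp_0[of X] by simp
  ultimately have D: "((\<lambda>t. f (mexp (- t *\<^sub>R X) ** g)) has_vector_derivative frechet_derivative F (at g) (- (X ** g))) (at 0)"
    by (intro curve_has_vector_derivative[OF assms(1-4)] mexp_curve) auto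
  then show 2: "lie_deriv X f g = frechet_derivative F (at g) (- (X ** g))"
    unfolding lie_deriv_def by (rule vector_derivative_at)
  show "((\<lambda>t. f (mexp (- t *\<^sub>R X) ** g)) has_vector_derivative lie_deriv X f g) (at 0)"
    unfolding 2 by (rule D)
qed

lemma lie_deriv_has_derivative:
  assumes "smooth_on_set G f" "X \<in> g0 s e" "g \<in> G"
  shows "((\<lambda>t. f (mexp (- t *\<^sub>R X) ** g)) has_vector_derivative lie_deriv X f g) (at 0)"
  using smooth_on_setE[OF assms(1,3)] lie_deriv_extension(1) assms by metis

lemma g0_comb: "\<lbrakk>X \<in> g0 s e; Y \<in> g0 s e\<rbrakk> \<Longrightarrow> a *\<^sub>R X + b *\<^sub>R Y \<in> g0 s e"
  unfolding g0_lie cmat_of_add cmat_of_scaleR by (intro lie_add lie_scale)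

lemma lie_deriv_linear:
  assumes f: "smooth_on_set G f" and X: "X \<in> g0 s e" "Y \<in> g0 s e" and g: "g \<in> G"
  shows "lie_deriv (a *\<^sub>R X + b *\<^sub>R Y) f g = a * lie_deriv X f g + b * lie_deriv Y f g"
proof -
  obtain U F where U: "open U" "g \<in> U" "\<And>r. Ck_on r U F" "\<And>x. x \<in> U \<inter> G \<Longrightarrow> F x = f x"
    using smooth_on_setE[OF f g] by blast
  have lin: "linear (frechet_derivative F (at g))"
    using has_derivative_bounded_linear[OF Ck_on_has_derivative[OF U(1) U(3) U(2)]] bounded_linear.linear by blast
  have *: "lie_deriv X f g = frechet_derivative F (at g) (- (X ** g))" if "X \<in> g0 s e" for X
    using U g that by (intro lie_deriv_extension(2)) (auto simp del: Ck_on.simps)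
  have "lie_deriv (a *\<^sub>R X + b *\<^sub>R Y) f g = frechet_derivative F (at g) (a *\<^sub>R (- (X ** g)) + b *\<^sub>R (- (Y ** g)))"
    using *[OF g0_comb[OF X, of a b]] by (simp add: matrix_add_mult scaleR_matrix_mult)
  also have "\<dots> = a *\<^sub>R frechet_derivative F (at g) (- (X ** g)) + b *\<^sub>R frechet_derivative F (at g) (- (Y ** g))"
    by (simp only: linear_add[OF lin] linear_scale[OF lin])
  finally show ?thesis by (simp add: * X scaleR_conv_of_real)
qed

lemma lie_deriv_comb:
  assumes "smooth_on_set G f" "smooth_on_set G f'" "X \<in> g0 s e" "g \<in> G"
  shows "lie_deriv X (\<lambda>x. a * f x + b * f' x) g = a * lie_deriv X f g + b * lie_deriv X f' g"
  unfolding lie_deriv_def[of X "\<lambda>x. a * f x + b * f' x"]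
  by (intro vector_derivative_at has_vector_derivative_add has_vector_derivative_mult_right
      lie_deriv_has_derivative assms)

lemma lie_act_comb:
  assumes "smooth_on_set G f" "smooth_on_set G f'" "Z \<in> lie"
  shows "lie_act s e Z (\<lambda>x. a * f x + b * f' x) = (\<lambda>x. a * lie_act s e Z f x + b * lie_act s e Z f' x)"
proof
  fix g
  have "cmat_Re Z \<in> g0 s e" "cmat_Im Z \<in> g0 s e" using assms(3) by (auto simp: lie_g_cpx g_cpx_def)
  then show "lie_act s e Z (\<lambda>x. a * f x + b * f' x) g = a * lie_act s e Z f g + b * lie_act s e Z f' g"
    using assms by (simp add: lie_act_def lie_deriv_comb algebra_simps)
qed

lemma lie_act_add:
  assumes "smooth_on_set G f" "Z \<in> lie" "W \<in> lie"
  shows "lie_act s e (Z + W) f g = lie_act s e Z f g + lie_act s e W f g"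
proof -
  have m: "cmat_Re Z \<in> g0 s e" "cmat_Im Z \<in> g0 s e" "cmat_Re W \<in> g0 s e" "cmat_Im W \<in> g0 s e"
    using assms(2,3) by (auto simp: lie_g_cpx g_cpx_def)
  have eq: "cmat_Re (Z + W) = 1 *\<^sub>R cmat_Re Z + 1 *\<^sub>R cmat_Re W" "cmat_Im (Z + W) = 1 *\<^sub>R cmat_Im Z + 1 *\<^sub>R cmat_Im W"
    by (simp_all add: vec_eq_iff cmat_Re_def cmat_Im_def)
  show ?thesis
    unfolding lie_act_def eq
    using lie_deriv_linear[OF assms(1) m(1) m(3), of g 1 1] lie_deriv_linear[OF assms(1) m(2) m(4), of g 1 1]
    by (simp add: algebra_simps)
qed

lemma lie_act_scale:
  assumes "smooth_on_set G f" "Z \<in> lie"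
  shows "lie_act s e (cmat_scale c Z) f g = c * lie_act s e Z f g"
proof -
  have m: "cmat_Re Z \<in> g0 s e" "cmat_Im Z \<in> g0 s e"
    using assms(2) by (auto simp: lie_g_cpx g_cpx_def)
  have eq: "cmat_Re (cmat_scale c Z) = Re c *\<^sub>R cmat_Re Z + (- Im c) *\<^sub>R cmat_Im Z"
    "cmat_Im (cmat_scale c Z) = Im c *\<^sub>R cmat_Re Z + Re c *\<^sub>R cmat_Im Z"
    by (simp_all add: vec_eq_iff cmat_Re_def cmat_Im_def cmat_scale_nth)
  have c: "c = Re c + \<i> * Im c" by (simp add: complex_eq_iff)
  show ?thesis
  proof (cases "g \<in> G")
    case True
    have "lie_act s e (cmat_scale c Z) f g = (Re c + \<i> * Im c) * lie_act s e Z f g"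
      unfolding lie_act_def eq lie_deriv_linear[OF assms(1) m True]
      using True by (simp add: algebra_simps)
    then show ?thesis using c by simp
  qed (simp add: lie_act_def)
qed

lemma lie_act_smooth:
  assumes f: "smooth_on_set G f" and Z: "Z \<in> lie"
  shows "smooth_on_set G (lie_act s e Z f)"
  unfolding smooth_on_set_def
proof
  fix g assume g: "g \<in> G"
  have m: "cmat_Re Z \<in> g0 s e" "cmat_Im Z \<in> g0 s e"
    using Z by (auto simp: lie_g_cpx g_cpx_def)
  obtain U F where U: "open U" "g \<in> U" "\<And>r. Ck_on r U F" "\<And>x. x \<in> U \<inter> G \<Longrightarrow> F x = f x"
    using smooth_on_setE[OF f g] by blast
  let ?F = "\<lambda>x. frechet_derivative F (at x) (- (cmat_Re Z ** x)) + \<i> * frechet_derivative F (at x) (- (cmat_Im Z ** x))"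
  have "Ck_on r U ?F" for r
    by (intro Ck_on_add Ck_on_mult Ck_on_const Ck_on_derivative_linear U bounded_linear_minus
        bounded_linear_matrix_mult_right)
  moreover have "?F x = lie_act s e Z f x" if "x \<in> U \<inter> G" for x
    using that lie_deriv_extension(2)[OF U(1) _ U(3) U(4)] m by (simp add: lie_act_def)
  ultimately show "\<exists>U F. open U \<and> g \<in> U \<and> (\<forall>r. Ck_on r U F) \<and> (\<forall>x\<in>U \<inter> G. F x = lie_act s e Z f x)"
    using U(1,2) by (intro exI[of _ U] exI[of _ ?F] conjI allI ballI) simp_all
qed

end

section \<open>K-finiteness\<close>

text \<open>\<open>K_finite\<close> asks for a set of functions, whereas a family may repeat a
  function; coefficients with the same \<open>u i\<close> are collected.\<close>

lemma K_finite_family: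
  assumes "finite I" and "\<And>\<kappa>. \<kappa> \<in> K_grp s e \<Longrightarrow> \<exists>c. \<forall>g. f (matrix_inv \<kappa> ** g) = (\<Sum>i\<in>I. c i * u i g)"
  shows "K_finite s e f"
  unfolding K_finite_def
proof (intro exI[of _ "u ` I"] conjI ballI)
  fix \<kappa> assume "\<kappa> \<in> K_grp s e"
  then obtain c where c: "\<And>g. f (matrix_inv \<kappa> ** g) = (\<Sum>i\<in>I. c i * u i g)" using assms(2) by blast
  have "(\<Sum>i\<in>I. c i * u i g) = (\<Sum>w\<in>u ` I. (\<Sum>i\<in>{i \<in> I. u i = w}. c i) * w g)" for g
  proof -
    have "(\<Sum>i\<in>I. c i * u i g) = (\<Sum>w\<in>u ` I. \<Sum>i\<in>{i \<in> I. u i = w}. c i * u i g)"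
      by (rule sum.image_gen[OF assms(1)])
    also have "\<dots> = (\<Sum>w\<in>u ` I. (\<Sum>i\<in>{i \<in> I. u i = w}. c i) * w g)"
      by (intro sum.cong refl) (auto simp: sum_distrib_right)
    finally show ?thesis .
  qed
  then show "\<exists>c. \<forall>g. f (matrix_inv \<kappa> ** g) = (\<Sum>w\<in>u ` I. c w * w g)"
    unfolding c by (intro exI[of _ "\<lambda>w. \<Sum>i\<in>{i \<in> I. u i = w}. c i"] allI)
qed (use assms in auto)

lemma K_finite_comb:
  assumes "K_finite s e f" "K_finite s e f'"
  shows "K_finite s e (\<lambda>x. a * f x + b * f' x)"
proof -
  obtain S where S: "finite S" "\<And>\<kappa>. \<kappa> \<in> K_grp s e \<Longrightarrow> \<exists>c :: _ \<Rightarrow> complex. \<forall>g. f (matrix_inv \<kappa> ** g) = (\<Sum>u\<in>S. c u * u g)"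
    using assms(1) unfolding K_finite_def by blast
  obtain S' where S': "finite S'" "\<And>\<kappa>. \<kappa> \<in> K_grp s e \<Longrightarrow> \<exists>c :: _ \<Rightarrow> complex. \<forall>g. f' (matrix_inv \<kappa> ** g) = (\<Sum>u\<in>S'. c u * u g)"
    using assms(2) unfolding K_finite_def by blast
  show ?thesis
  proof (rule K_finite_family[where I="S <+> S'" and u="case_sum id id"])
    show "finite (S <+> S')" using S(1) S'(1) by simp
    fix \<kappa> assume k: "\<kappa> \<in> K_grp s e"
    obtain c c' where c: "\<And>g. f (matrix_inv \<kappa> ** g) = (\<Sum>u\<in>S. c u * u g)"
      "\<And>g. f' (matrix_inv \<kappa> ** g) = (\<Sum>u\<in>S'. c' u * u g)" using S(2)[OF k] S'(2)[OF k] by blast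
    show "\<exists>c. \<forall>g. a * f (matrix_inv \<kappa> ** g) + b * f' (matrix_inv \<kappa> ** g) = (\<Sum>i\<in>S <+> S'. c i * case_sum id id i g)"
      by (intro exI[of _ "case_sum (\<lambda>u. a * c u) (\<lambda>u. b * c' u)"] allI)
        (simp add: c sum.Plus S(1) S'(1) sum_distrib_left mult.assoc)
  qed
qed

interpretation cfun: vector_space "\<lambda>(a::complex) (f :: 'a \<Rightarrow> complex) x. a * f x"
  by unfold_locales (simp_all add: fun_eq_iff algebra_simps)

lemma sum_apply_fun: "(\<Sum>k\<in>A. h k) x = (\<Sum>k\<in>A. h k x :: 'b::comm_monoid_add)"
  by (induction A rule: infinite_finite_induct) auto

text \<open>The functions in the definition of \<open>K_finite\<close> are arbitrary and cannot be
  differentiated. A basis of the span of all translates, chosen among the translates themselves,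
  consists of functions built from \<open>f\<close>.\<close>

lemma K_finite_translates:
  assumes "K_finite s e f"
  obtains T where "finite T" "T \<subseteq> K_grp s e"
    "\<And>\<kappa>. \<kappa> \<in> K_grp s e \<Longrightarrow> \<exists>c. \<forall>g. f (matrix_inv \<kappa> ** g) = (\<Sum>\<tau>\<in>T. c \<tau> * f (matrix_inv \<tau> ** g))"
proof -
  obtain S where S: "finite S" "\<And>\<kappa>. \<kappa> \<in> K_grp s e \<Longrightarrow> \<exists>c :: _ \<Rightarrow> complex. \<forall>g. f (matrix_inv \<kappa> ** g) = (\<Sum>u\<in>S. c u * u g)"
    using assms unfolding K_finite_def by blast
  define tr where "tr \<kappa> = (\<lambda>g. f (matrix_inv \<kappa> ** g))" for \<kappa> :: "real^'a^'a"
  have "tr \<kappa> \<in> cfun.span S" if k: "\<kappa> \<in> K_grp s e" for \<kappa>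
  proof -
    obtain c :: "_ \<Rightarrow> complex" where "\<And>g. f (matrix_inv \<kappa> ** g) = (\<Sum>u\<in>S. c u * u g)" using S(2)[OF k] by blast
    then have "tr \<kappa> = (\<Sum>u\<in>S. (\<lambda>x. c u * u x))" by (auto simp: tr_def sum_apply_fun)
    also have "\<dots> \<in> cfun.span S" by (intro cfun.span_sum cfun.span_scale cfun.span_base)
    finally show ?thesis .
  qed
  then have sub: "tr ` K_grp s e \<subseteq> cfun.span S" by blast
  obtain B where B: "B \<subseteq> tr ` K_grp s e" "cfun.independent B" "tr ` K_grp s e \<subseteq> cfun.span B"
    using cfun.maximal_independent_subset by blast
  have fin: "finite B" using cfun.independent_span_bound[OF S(1) B(2)] B(1) sub by blast
  obtain T where T: "T \<subseteq> K_grp s e" "inj_on tr T" "B = tr ` T"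
    using B(1) by (auto simp: subset_image_inj)
  show thesis
  proof (rule that[of T])
    show "finite T" using fin T by (simp add: finite_image_iff)
    fix \<kappa> assume "\<kappa> \<in> K_grp s e"
    then have "tr \<kappa> \<in> cfun.span B" using B(3) by blast
    then obtain c where "tr \<kappa> = (\<Sum>v\<in>B. (\<lambda>x. c v * v x))" using cfun.span_finite[OF fin] by auto
    then have "tr \<kappa> g = (\<Sum>\<tau>\<in>T. c (tr \<tau>) * tr \<tau> g)" for g
      by (simp add: sum_apply_fun T(3) sum.reindex[OF T(2)])
    then show "\<exists>c. \<forall>g. f (matrix_inv \<kappa> ** g) = (\<Sum>\<tau>\<in>T. c \<tau> * f (matrix_inv \<tau> ** g))"
      unfolding tr_def by (intro exI[of _ "\<lambda>\<tau>. c (\<lambda>g. f (matrix_inv \<tau> ** g))"]) auto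
  qed (use T in auto)
qed

section \<open>The Lie algebra action on the principal series\<close>

lemma K_grp_G: "K_grp s e \<subseteq> G_grp s e" "M_grp s e \<subseteq> G_grp s e"
  by (auto simp: K_grp_def M_grp_def)

context group_setting
begin

lemma G_left_mult_iff: "h \<in> G \<Longrightarrow> h ** g \<in> G \<longleftrightarrow> g \<in> G"
proof
  assume h: "h \<in> G" and "h ** g \<in> G"
  then have "matrix_inv h ** (h ** g) \<in> G" using G_mult[OF G_inv_mem] by blast
  then show "g \<in> G" by (simp add: matrix_mul_assoc G_inv[OF h])
qed (rule G_mult)

text \<open>The value of the derivative of \<open>f\<close> along \<open>X\<close> at the point
  translated by \<open>\<kappa>\<close> is the derivative along the conjugate \<open>Y\<close> of
  \<open>X\<close> of a translate of \<open>f\<close>. That translate is a combination of finitely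
  many fixed ones, and \<open>Y\<close> is a combination of matrix units, so a family indexed by
  \<open>T \<times> UNIV\<close> serves for all \<open>\<kappa>\<close>.\<close>

lemma lie_act_K_finite:
  assumes f: "smooth_on_set G f" "K_finite s e f" "\<And>g. g \<notin> G \<Longrightarrow> f g = 0" and Z: "Z \<in> lie"
  shows "K_finite s e (lie_act s e Z f)"
proof -
  obtain T where T: "finite T" "T \<subseteq> K_grp s e"
    "\<And>\<kappa>. \<kappa> \<in> K_grp s e \<Longrightarrow> \<exists>c. \<forall>g. f (matrix_inv \<kappa> ** g) = (\<Sum>\<tau>\<in>T. c \<tau> * f (matrix_inv \<tau> ** g))"
    using K_finite_translates[OF f(2)] by blast
  \<comment> \<open>A matrix unit need not be tangent to \<open>G\<close>, so the derivative of
    \<open>f\<close> along curves in \<open>G\<close> is extended to a linear map on all matrices.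
    The extension is chosen once for each point and is independent of \<open>\<kappa>\<close> and
    \<open>X\<close>.\<close>
  define good where "good g D \<longleftrightarrow> linear D \<and> (\<forall>c v. c 0 = g \<longrightarrow> (\<forall>t. c t \<in> G) \<longrightarrow> (c has_vector_derivative v) (at 0) \<longrightarrow>
      ((\<lambda>t. f (c t)) has_vector_derivative D v) (at 0))" for g and D :: "real^'m^'m \<Rightarrow> complex"
  define D where "D g = (SOME D. good g D)" for g
  have D: "good g (D g)" if g: "g \<in> G" for g
  proof -
    obtain U F where U: "open U" "g \<in> U" "\<And>r. Ck_on r U F" "\<And>x. x \<in> U \<inter> G \<Longrightarrow> F x = f x"
      using smooth_on_setE[OF f(1) g] by blast
    have "linear (frechet_derivative F (at g))"
      using has_derivative_bounded_linear[OF Ck_on_has_derivative[OF U(1) U(3) U(2)]] bounded_linear.linear by blast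
    moreover have "((\<lambda>t. f (c t)) has_vector_derivative frechet_derivative F (at g) v) (at 0)"
      if "c 0 = g" "\<forall>t. c t \<in> G" "(c has_vector_derivative v) (at 0)" for c v
      using that by (intro curve_has_vector_derivative[OF U(1,2) U(3) U(4)]) auto
    ultimately have "good g (frechet_derivative F (at g))" unfolding good_def by blast
    then show ?thesis unfolding D_def by (rule someI[of "good g"])
  qed
  define u where "u = (\<lambda>(\<tau>, i, j) g. if g \<in> G then D (matrix_inv \<tau> ** g) (- (matrix_inv \<tau> ** axis i (axis j 1) ** g)) else 0)"
  have deriv: "\<exists>c. \<forall>g\<in>G. lie_deriv X f (matrix_inv \<kappa> ** g) = (\<Sum>p\<in>T \<times> UNIV. c p * u p g)"
    if \<kappa>: "\<kappa> \<in> K_grp s e" and X: "X \<in> g0 s e" for \<kappa> X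
  proof -
    obtain c where c: "\<And>g. f (matrix_inv \<kappa> ** g) = (\<Sum>\<tau>\<in>T. c \<tau> * f (matrix_inv \<tau> ** g))"
      using T(3)[OF \<kappa>] by blast
    define Y where "Y = \<kappa> ** X ** matrix_inv \<kappa>"
    have \<kappa>G: "\<kappa> \<in> G" using \<kappa> K_grp_G by blast
    have "lie_deriv X f (matrix_inv \<kappa> ** g) = (\<Sum>p\<in>T \<times> UNIV. (case p of (\<tau>, i, j) \<Rightarrow> c \<tau> * of_real (Y $ i $ j)) * u p g)"
      if g: "g \<in> G" for g
    proof -
      \<comment> \<open>A curve in \<open>G\<close> through \<open>g\<close> with velocity
        \<open>- (Y ** g)\<close>, common to all the translates.\<close>
      define h where "h t = \<kappa> ** (mexp (- t *\<^sub>R X) ** (matrix_inv \<kappa> ** g))" for t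
      have kg: "matrix_inv \<kappa> ** g \<in> G" by (intro G_mult G_inv_mem \<kappa>G g)
      have hG: "h t \<in> G" for t unfolding h_def by (intro G_mult mexp_G X \<kappa>G kg)
      have h0: "h 0 = g" using mexp_0[of X] by (simp add: h_def matrix_mul_assoc G_inv[OF \<kappa>G])
      have h': "(h has_vector_derivative - (Y ** g)) (at 0)"
        unfolding h_def using bounded_linear.has_vector_derivative[OF bounded_linear_matrix_mult_right[of \<kappa>] mexp_curve[of X "matrix_inv \<kappa> ** g"]]
        by (simp add: Y_def matrix_neg_mult matrix_mul_assoc)
      have eq: "f (mexp (- t *\<^sub>R X) ** (matrix_inv \<kappa> ** g)) = (\<Sum>\<tau>\<in>T. c \<tau> * f (matrix_inv \<tau> ** h t))" for t
        unfolding c[symmetric] by (simp add: h_def matrix_mul_assoc G_inv[OF \<kappa>G])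
      have tau: "((\<lambda>t. f (matrix_inv \<tau> ** h t)) has_vector_derivative
          D (matrix_inv \<tau> ** g) (- (matrix_inv \<tau> ** (Y ** g)))) (at 0)" if "\<tau> \<in> T" for \<tau>
      proof -
        have \<tau>G: "matrix_inv \<tau> \<in> G" using that T(2) K_grp_G G_inv_mem by blast
        have "((\<lambda>t. matrix_inv \<tau> ** h t) has_vector_derivative matrix_inv \<tau> ** (- (Y ** g))) (at 0)"
          by (rule bounded_linear.has_vector_derivative[OF bounded_linear_matrix_mult_right h'])
        then show ?thesis
          using D[OF G_mult[OF \<tau>G g]] G_mult[OF \<tau>G hG] h0 unfolding good_def by (simp add: matrix_neg_mult)
      qed
      have "lie_deriv X f (matrix_inv \<kappa> ** g) = (\<Sum>\<tau>\<in>T. c \<tau> * D (matrix_inv \<tau> ** g) (- (matrix_inv \<tau> ** (Y ** g))))"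
        unfolding lie_deriv_def eq
        by (intro vector_derivative_at has_vector_derivative_sum has_vector_derivative_mult_right tau)
      also have "\<dots> = (\<Sum>\<tau>\<in>T. \<Sum>(i,j)\<in>UNIV. c \<tau> * of_real (Y $ i $ j) * u (\<tau>, i, j) g)"
      proof (rule sum.cong[OF refl])
        fix \<tau> assume "\<tau> \<in> T"
        then have "matrix_inv \<tau> ** g \<in> G" using T(2) K_grp_G G_inv_mem G_mult g by blast
        then have lin: "linear (D (matrix_inv \<tau> ** g))" using D unfolding good_def by blast
        have Y: "Y = (\<Sum>(i,j)\<in>UNIV. (Y $ i $ j) *\<^sub>R axis i (axis j 1))"
        proof -
          have "Y $ x $ y = (\<Sum>i\<in>UNIV. \<Sum>j\<in>UNIV. if i = x \<and> j = y then Y $ i $ j else 0)" for x y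
            by (simp only: sum_delta2)
          moreover have "Y $ i $ j * (axis i (axis j 1) $ x $ y) = (if i = x \<and> j = y then Y $ i $ j else 0)" for x y i j
            by (auto simp: axis_def)
          ultimately show ?thesis
            by (simp add: vec_eq_iff sum.cartesian_product[symmetric] split_def)
              (simp add: sum.cartesian_product split_def)
        qed
        have eY: "- (matrix_inv \<tau> ** (Y ** g)) = (\<Sum>(i,j)\<in>UNIV. (Y $ i $ j) *\<^sub>R (- (matrix_inv \<tau> ** axis i (axis j 1) ** g)))"
          by (subst Y) (simp add: sum_matrix_mult matrix_mult_sum split_def scaleR_matrix_mult matrix_mult_scaleR
              matrix_mul_assoc sum_negf)
        have "D (matrix_inv \<tau> ** g) (- (matrix_inv \<tau> ** (Y ** g)))
            = (\<Sum>(i,j)\<in>UNIV. (Y $ i $ j) *\<^sub>R D (matrix_inv \<tau> ** g) (- (matrix_inv \<tau> ** axis i (axis j 1) ** g)))"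
          unfolding eY split_def linear_sum[OF lin] linear_scale[OF lin] by (rule refl)
        then show "c \<tau> * D (matrix_inv \<tau> ** g) (- (matrix_inv \<tau> ** (Y ** g)))
           = (\<Sum>(i,j)\<in>UNIV. c \<tau> * of_real (Y $ i $ j) * u (\<tau>, i, j) g)"
          using g by (simp add: split_def u_def scaleR_conv_of_real[where 'a=complex] sum_distrib_left mult.assoc)
      qed
      also have "\<dots> = (\<Sum>p\<in>T \<times> UNIV. (case p of (\<tau>, i, j) \<Rightarrow> c \<tau> * of_real (Y $ i $ j)) * u p g)"
        by (simp add: sum.cartesian_product split_def)
      finally show ?thesis .
    qed
    then show ?thesis by blast
  qed
  have u0: "u p g = 0" if "g \<notin> G" for p g using that by (simp add: u_def split_def)
  show ?thesis
  proof (rule K_finite_family[of "T \<times> UNIV" _ _ _ u])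
    show "finite (T \<times> (UNIV :: ('m \<times> 'm) set))" using T(1) by simp
    fix \<kappa> assume \<kappa>: "\<kappa> \<in> K_grp s e"
    have \<kappa>G: "matrix_inv \<kappa> \<in> G" using \<kappa> K_grp_G G_inv_mem by blast
    have m: "cmat_Re Z \<in> g0 s e" "cmat_Im Z \<in> g0 s e" using Z by (auto simp: lie_g_cpx g_cpx_def)
    obtain c where c: "\<And>g. g \<in> G \<Longrightarrow> lie_deriv (cmat_Re Z) f (matrix_inv \<kappa> ** g) = (\<Sum>p\<in>T \<times> UNIV. c p * u p g)"
      using deriv[OF \<kappa> m(1)] by blast
    obtain c' where c': "\<And>g. g \<in> G \<Longrightarrow> lie_deriv (cmat_Im Z) f (matrix_inv \<kappa> ** g) = (\<Sum>p\<in>T \<times> UNIV. c' p * u p g)"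
      using deriv[OF \<kappa> m(2)] by blast
    have "lie_act s e Z f (matrix_inv \<kappa> ** g) = (\<Sum>p\<in>T \<times> UNIV. (c p + \<i> * c' p) * u p g)" for g
    proof (cases "g \<in> G")
      case True
      then show ?thesis
        using G_left_mult_iff[OF \<kappa>G]
        by (simp add: lie_act_def c c' distrib_right sum.distrib sum_distrib_left mult.assoc)
    next
      case False
      then show ?thesis using G_left_mult_iff[OF \<kappa>G] by (simp add: lie_act_def u0)
    qed
    then show "\<exists>c. \<forall>g. lie_act s e Z f (matrix_inv \<kappa> ** g) = (\<Sum>p\<in>T \<times> UNIV. c p * u p g)"
      by (intro exI[of _ "\<lambda>p. c p + \<i> * c' p"] allI)
  qed
qed

lemma g0_span: "S \<subseteq> g0 s e \<Longrightarrow> span S \<subseteq> g0 s e"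
proof (rule span_minimal)
  have "cmat_scale 0 (proj 0) = cmat_of 0" by (simp add: vec_eq_iff cmat_of_def)
  then have "0 \<in> g0 s e" unfolding g0_lie using lie_scale[OF proj_lie] by metis
  moreover have "x + y \<in> g0 s e" if "x \<in> g0 s e" "y \<in> g0 s e" for x y
    using g0_comb[OF that, of 1 1] by simp
  moreover have "c *\<^sub>R x \<in> g0 s e" if "x \<in> g0 s e" for c x
    using g0_comb[OF that that, of c 0] by simp
  ultimately show "subspace (g0 s e)" by (rule subspaceI)
qed

lemma N_grp_G: "N_grp s e \<subseteq> G"
proof -
  have "span (\<Union>l\<in>pos_roots s e. root_space s e l) \<subseteq> g0 s e"
    by (intro g0_span) (auto simp: root_space_def)
  then have "mexp (1 *\<^sub>R X) \<in> G" if "X \<in> span (\<Union>l\<in>pos_roots s e. root_space s e l)" for X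
    using that by (intro mexp_G) blast
  then show ?thesis by (auto simp: N_grp_def)
qed

lemma a_vec_G: "valid_setting s \<Longrightarrow> mexp (a_vec s e h) \<in> G"
proof -
  assume v: "valid_setting s"
  have "a_vec s e h \<in> span (a_elt s e ` {1..real_rank s})"
    unfolding a_vec_def by (intro span_sum span_scale span_base imageI)
  moreover have "a_elt s e ` {1..real_rank s} \<subseteq> g0 s e" using a_elt_g0 v by blast
  ultimately have "mexp (1 *\<^sub>R a_vec s e h) \<in> G" using g0_span by (intro mexp_G) blast
  then show ?thesis by simp
qed

lemma ps_spaceD:
  assumes "f \<in> ps_space s e k \<nu>"
  shows "\<And>g. g \<notin> G \<Longrightarrow> f g = 0" "smooth_on_set G f" "K_finite s e f"
    "\<And>g m h u. \<lbrakk>g \<in> G; m \<in> M_grp s e; u \<in> N_grp s e\<rbrakk> \<Longrightarrow> f (g ** m ** mexp (a_vec s e h) ** u) =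
          inverse (delta s e k m) * exp (- (\<Sum>i=1..real_rank s. (\<nu> i + complex_of_real (rho s e i)) * complex_of_real (h i))) * f g"
  using assms unfolding ps_space_def by blast+

text \<open>The Lie algebra acts by left translation and the equivariance is on the right, so the
  factor \<open>x\<close> passes through the derivative.\<close>

lemma lie_act_ps:
  assumes f: "f \<in> ps_space s e k \<nu>" and Z: "Z \<in> lie" and v: "valid_setting s"
  shows "lie_act s e Z f \<in> ps_space s e k \<nu>"
proof -
  note fD = ps_spaceD[OF f]
  have R: "cmat_Re Z \<in> g0 s e" "cmat_Im Z \<in> g0 s e" using Z by (auto simp: lie_g_cpx g_cpx_def)
  have "lie_act s e Z f (g ** m ** mexp (a_vec s e h) ** u) =
          inverse (delta s e k m) * exp (- (\<Sum>i=1..real_rank s. (\<nu> i + complex_of_real (rho s e i)) * complex_of_real (h i))) * lie_act s e Z f g"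
    if g: "g \<in> G" and m: "m \<in> M_grp s e" and u: "u \<in> N_grp s e" for g m h u
  proof -
    define x where "x = inverse (delta s e k m) * exp (- (\<Sum>i=1..real_rank s. (\<nu> i + complex_of_real (rho s e i)) * complex_of_real (h i)))"
    define n where "n = m ** mexp (a_vec s e h) ** u"
    have gn: "g ** m ** mexp (a_vec s e h) ** u = g ** n" by (simp add: n_def matrix_mul_assoc)
    have nG: "g ** n \<in> G"
      unfolding n_def
      by (intro G_mult g a_vec_G v K_grp_G(2)[THEN subsetD, OF m] N_grp_G[THEN subsetD, OF u])
    have d: "lie_deriv X f (g ** n) = x * lie_deriv X f g" if X: "X \<in> g0 s e" for X
    proof -
      have eq: "f (mexp (- t *\<^sub>R X) ** (g ** n)) = x * f (mexp (- t *\<^sub>R X) ** g)" for t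
        using fD(4)[OF G_mult[OF mexp_G[OF X, of "- t"] g] m u, of h]
        by (simp add: n_def x_def matrix_mul_assoc)
      show ?thesis
        unfolding lie_deriv_def[of X f "g ** n"] eq
        by (intro vector_derivative_at has_vector_derivative_mult_right lie_deriv_has_derivative fD X g)
    qed
    show ?thesis
      unfolding gn x_def[symmetric] using nG g by (simp add: lie_act_def d R algebra_simps)
  qed
  then show ?thesis
    unfolding ps_space_def using lie_act_smooth[OF fD(2) Z] lie_act_K_finite[OF fD(2,3,1) Z]
    by (auto simp: lie_act_def)
qed

lemma fun_subspace_ps: "fun_subspace (ps_space s e k \<nu>)"
  unfolding fun_subspace_def
proof (intro conjI ballI allI)
  have "Ck_on r UNIV (\<lambda>_ :: real^'m^'m. 0)" for r by (rule Ck_on_const) simp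
  then have "smooth_on_set G 0"
    unfolding smooth_on_set_def by (intro ballI exI[of _ UNIV] exI[of _ "\<lambda>_. 0"]) auto
  moreover have "K_finite s e 0" unfolding K_finite_def by (intro exI[of _ "{}"]) auto
  ultimately show "0 \<in> ps_space s e k \<nu>" by (simp add: ps_space_def)
  fix f f' a b
  assume f: "f \<in> ps_space s e k \<nu>" "f' \<in> ps_space s e k \<nu>"
  note fD = ps_spaceD[OF f(1)] and f'D = ps_spaceD[OF f(2)]
  show "(\<lambda>x. a * f x + b * f' x) \<in> ps_space s e k \<nu>"
    unfolding ps_space_def using fD f'D
    by (auto intro: smooth_on_set_comb K_finite_comb simp: algebra_simps)
qed

end

section \<open>Adjoints with respect to the form on V\<close>

context group_setting
begin

lemma xi_commute: "J ** A = A ** J \<Longrightarrow> xi s e ** cmat_of A = cmat_of A ** xi s e"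
  using xi_scale by (auto simp: cmat_scale_mult cmat_of_mult[symmetric])

text \<open>\<open>xi\<close> is a scalar multiple of \<open>J\<close>, so the invariance of
  \<open>hV\<close> under \<open>K\<close> reaches \<open>xi\<close> through this element.\<close>

lemma J_K: "J \<in> K_grp s e"
proof -
  have "transpose J ** J ** J = J"
    unfolding form_transpose by (simp add: scaleR_matrix_mult form_square form_sign_square)
  then show ?thesis using xi_commute by (simp add: K_grp_def G_grp_def)
qed

lemma J_inverse: "matrix_inv J = \<epsilon> *\<^sub>R J"
  by (rule matrix_inv_eq) (simp add: scaleR_matrix_mult form_square form_sign_square)

lemma mexp_K:
  assumes "X \<in> g0 s e" "transpose X = - X"
  shows "mexp (t *\<^sub>R X) \<in> K_grp s e"
proof -
  have "J ** X = X ** J" using assms by (simp add: g0_def matrix_neg_mult)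
  then show ?thesis
    using xi_commute[OF mexp_commute] mexp_G[OF assms(1)] by (simp add: K_grp_def)
qed

lemma g0_transpose: "X \<in> g0 s e \<Longrightarrow> transpose X \<in> g0 s e"
  by (simp add: g0_lie cmat_of_transpose transpose_lie)

context
  fixes hV :: "complex^'m \<Rightarrow> complex^'m \<Rightarrow> complex"
  assumes hV: "is_V_form s e hV"
begin

lemma hV_linear:
  "hV (a *s x + b *s y) z = a * hV x z + b * hV y z" "hV z (a *s x + b *s y) = cnj a * hV z x + cnj b * hV z y"
  using hV unfolding is_V_form_def hermitian_form_def by (simp_all add: V_rep_def)

lemma hV_add: "hV (x + y) z = hV x z + hV y z" "hV z (x + y) = hV z x + hV z y"
  using hV_linear[where a=1 and b=1 and x=x and y=y and z=z] by simp_all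

lemma hV_scale: "hV (a *s x) z = a * hV x z" "hV z (a *s x) = cnj a * hV z x"
  using hV_linear[where a=a and b=0 and x=x and y=x and z=z] by simp_all

lemma hV_bilinear: "bounded_bilinear hV"
proof -
  have "r *\<^sub>R x = of_real r *s (x :: complex^'m)" for r x by (simp add: vec_eq_iff scaleR_conv_of_real[where 'a=complex])
  then show ?thesis
    unfolding bilinear_conv_bounded_bilinear[symmetric] bilinear_def
    by (auto intro!: linearI simp: hV_add hV_scale scaleR_conv_of_real[where 'a=complex])
qed

text \<open>Invariance is assumed for the group \<open>K\<close>; differentiating it at
  \<open>t = 0\<close> along the exponential of a skew-symmetric \<open>X\<close> gives the
  infinitesimal form.\<close>

lemma hV_skew:
  assumes X: "X \<in> g0 s e" "transpose X = - X"
  shows "hV (cmat_of X *v v) w + hV v (cmat_of X *v w) = 0"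
proof -
  let ?M = "\<lambda>t. mexp (t *\<^sub>R X)"
  have lin: "bounded_linear (\<lambda>A. cmat_of A *v u)" for u :: "complex^'m"
    unfolding linear_conv_bounded_linear[symmetric]
    by (rule linearI) (simp_all add: vec_eq_iff matrix_vector_mult_def cmat_of_def distrib_right sum.distrib
        scaleR_conv_of_real[where 'a=complex] sum_distrib_left mult.assoc)
  have "((\<lambda>t. hV (cmat_of (?M t) *v v) (cmat_of (?M t) *v w)) has_vector_derivative
      hV (cmat_of (?M 0) *v v) (cmat_of (X ** ?M 0) *v w) + hV (cmat_of (X ** ?M 0) *v v) (cmat_of (?M 0) *v w)) (at 0)"
    by (intro bounded_bilinear.has_vector_derivative[OF hV_bilinear]
        bounded_linear.has_vector_derivative[OF lin] mexp_has_vector_derivative)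
  moreover have "hV (cmat_of (?M t) *v v) (cmat_of (?M t) *v w) = hV v w" for t
  proof -
    have K: "?M t \<in> K_grp s e" by (rule mexp_K[OF X])
    then have "hV (cmat_of (?M t) *v v) (cmat_of (?M t) *v w)
        = hV v (cmat_of (matrix_inv (?M t)) *v (cmat_of (?M t) *v w))"
      using hV unfolding is_V_form_def by blast
    also have "cmat_of (matrix_inv (?M t)) *v (cmat_of (?M t) *v w) = w"
      using G_inv(1)[OF K_grp_G(1)[THEN subsetD, OF K]]
      by (simp add: matrix_vector_mul_assoc cmat_of_mult[symmetric] cmat_of_mat_1)
    finally show ?thesis .
  qed
  ultimately have "((\<lambda>t. hV v w) has_vector_derivative
      hV v (cmat_of X *v w) + hV (cmat_of X *v v) w) (at 0)"
    by (simp add: mexp_0[of X, simplified] cmat_of_mat_1)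
  then show ?thesis
    using vector_derivative_unique_at[OF has_vector_derivative_const] by (metis add.commute)
qed

text \<open>The symmetric and the skew-symmetric part of \<open>X\<close> are its Cartan components:
  the first lies in \<open>p0\<close> and is self-adjoint by assumption, the second is skew-adjoint
  by \<open>hV_skew\<close>. Transposition has the same two signs.\<close>

lemma hV_adjoint:
  assumes X: "X \<in> g0 s e"
  shows "hV (cmat_of X *v v) w = hV v (transpose (cmat_of X) *v w)"
proof -
  let ?p = "(1/2) *\<^sub>R X + (1/2) *\<^sub>R transpose X" and ?k = "(1/2) *\<^sub>R X + (- 1/2) *\<^sub>R transpose X"
  have tr: "transpose ?p = ?p" "transpose ?k = - ?k"
    by (simp_all add: vec_eq_iff transpose_def)
  have p: "?p \<in> g0 s e" and k: "?k \<in> g0 s e"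
    by (intro g0_comb X g0_transpose)+
  have "xi s e ** cmat_of ?p ** xi s e = - cmat_of ?p"
    using xi_conj[of "cmat_of ?p"] p by (simp add: g0_lie cmat_of_transpose[symmetric] tr)
  then have "xi s e ** cmat_of ?p ** xi s e ** xi s e = - cmat_of ?p ** xi s e" by simp
  then have "xi s e ** cmat_of ?p = - (cmat_of ?p ** xi s e)"
    by (simp add: matrix_mul_assoc[symmetric] xi_square matrix_neg_mult)
  then have "?p \<in> p0 s e" using p by (simp add: p0_def)
  then have P: "hV (cmat_of ?p *v v) w = hV v (cmat_of ?p *v w)"
    using hV unfolding is_V_form_def by blast
  have K: "hV (cmat_of ?k *v v) w = - hV v (cmat_of ?k *v w)"
    using hV_skew[OF k tr(2), of v w] by (simp add: eq_neg_iff_add_eq_0)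
  have X1: "cmat_of X = cmat_of ?p + cmat_of ?k" "transpose (cmat_of X) = cmat_of ?p - cmat_of ?k"
    by (simp_all add: vec_eq_iff cmat_of_def transpose_def field_simps)
  have minus: "hV v (x - y) = hV v x - hV v y" for x y
    using hV_linear(2)[where a=1 and b="- 1" and x=x and y=y and z=v] by simp
  show ?thesis
    unfolding X1(2) unfolding X1(1) matrix_vector_mult_add_rdistrib matrix_vector_mult_diff_rdistrib hV_add minus P K by simp
qed

lemma hV_xi: "hV (xi s e *v v) w = hV v (xi s e *v w)"
proof -
  obtain \<theta> where \<theta>: "xi s e = cmat_scale \<theta> (cmat_of J)" "cnj \<theta> = \<theta> * of_real \<epsilon>" using xi_scale by blast
  have sc: "cmat_scale a Z *v u = a *s (Z *v u)" for a Z and u :: "complex^'m"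
    by (simp add: vec_eq_iff cmat_scale_def matrix_vector_mult_def sum_distrib_left mult.assoc)
  have "hV (cmat_of J *v v) w = hV v (cmat_of (matrix_inv J) *v w)"
    using hV J_K unfolding is_V_form_def by blast
  also have "\<dots> = of_real \<epsilon> * hV v (cmat_of J *v w)"
    by (simp add: J_inverse cmat_of_scaleR sc hV_scale)
  finally show ?thesis by (simp add: \<theta> sc hV_scale)
qed

end

end

section \<open>Adjoints on the principal series tensored with powers of \<open>V\<close>\<close>

lemma V_leg_scale: "V_leg i (cmat_scale a Z) t J g = a * V_leg i Z t J g"
  by (simp add: V_leg_def cmat_scale_nth sum_distrib_left mult.assoc)

lemma V_leg_add_mat: "V_leg i (Z + W) t J g = V_leg i Z t J g + V_leg i W t J g"
  by (simp add: V_leg_def distrib_right sum.distrib)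

text \<open>Instantiated both with the given form on the principal series and with the pulled-back
  semidefinite one, so it carries neither positivity nor symmetry of \<open>h\<close>.\<close>

locale functor_forms = group_setting s e + tensor_forms "ps_space s e k \<nu>" l h hV
  for s and e :: "nat \<Rightarrow> 'm::finite" and k \<nu> l h hV +
  assumes valid: "valid_setting s"
    and inv: "\<And>Z x y. \<lbrakk>Z \<in> g_cpx s e; x \<in> ps_space s e k \<nu>; y \<in> ps_space s e k \<nu>\<rbrakk> \<Longrightarrow>
      h (lie_act s e Z x) y = h x (lie_act s e (g_star Z) y)"
    and V: "is_V_form s e hV"
begin

abbreviation "PS \<equiv> ps_space s e k \<nu>"
abbreviation "Xi \<equiv> all_legs (xi s e) l"

lemma T_ps: "t \<in> T \<Longrightarrow> t K \<in> PS"
  using X by (cases "length K = l") (auto simp: tensors_def fun_subspace_def)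

lemma Xi_mem: "t \<in> T \<Longrightarrow> Xi t \<in> T"
  by (rule all_legs_mem[OF X])

lemma Xi_Xi: "t \<in> T \<Longrightarrow> Xi (Xi t) = t"
  by (rule all_legs_all_legs[OF xi_square X]) auto

lemma leg_mem: "\<lbrakk>Z \<in> lie; t \<in> T\<rbrakk> \<Longrightarrow> leg s e i Z t \<in> T"
proof (cases i)
  case 0
  assume Z: "Z \<in> lie" and t: "t \<in> T"
  have "lie_act s e Z 0 = 0"
    by (intro ext) (simp add: lie_act_def lie_deriv_def)
  then show ?thesis using 0 t lie_act_ps[OF T_ps[OF t] Z valid] by (simp add: leg_def tensors_def)
next
  case (Suc i')
  then show "t \<in> T \<Longrightarrow> ?thesis" by (simp add: leg_def V_leg_mem[OF X])
qed

lemma leg_comb: "\<lbrakk>Z \<in> lie; t \<in> T; t' \<in> T\<rbrakk> \<Longrightarrow>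
  leg s e i Z (\<lambda>K g. a * t K g + b * t' K g) = (\<lambda>K g. a * leg s e i Z t K g + b * leg s e i Z t' K g)"
  using lie_act_comb[OF ps_spaceD(2)[OF T_ps] ps_spaceD(2)[OF T_ps]]
  by (auto simp: leg_def V_leg_comb fun_eq_iff)

lemma leg_add: "\<lbrakk>Z \<in> lie; W \<in> lie; t \<in> T\<rbrakk> \<Longrightarrow> leg s e i (Z + W) t K g = leg s e i Z t K g + leg s e i W t K g"
  by (simp add: leg_def V_leg_add_mat lie_act_add[OF ps_spaceD(2)[OF T_ps]])

lemma leg_scale: "\<lbrakk>Z \<in> lie; t \<in> T\<rbrakk> \<Longrightarrow> leg s e i (cmat_scale a Z) t K g = a * leg s e i Z t K g"
  by (simp add: leg_def V_leg_scale lie_act_scale[OF ps_spaceD(2)[OF T_ps]])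

lemma lie_act_sum_ps:
  assumes "Z \<in> lie" "finite A" "\<And>a. a \<in> A \<Longrightarrow> f a \<in> PS"
  shows "lie_act s e Z (\<lambda>x. \<Sum>a\<in>A. c a * f a x) = (\<lambda>x. \<Sum>a\<in>A. c a * lie_act s e Z (f a) x)"
  using assms(2,3)
proof (induction A rule: finite_induct)
  case empty
  show ?case by (intro ext) (simp add: lie_act_def lie_deriv_def)
next
  case (insert a A)
  have "(\<lambda>x. \<Sum>a\<in>A. c a * f a x) \<in> PS" using insert by (intro fun_subspace_sum[OF X]) auto
  then show ?case
    using insert lie_act_comb[OF ps_spaceD(2) ps_spaceD(2) assms(1), of "f a" k \<nu> "\<lambda>x. \<Sum>a\<in>A. c a * f a x" k \<nu> "c a" 1]
    by simp
qed

lemma leg_0_V_leg: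
  assumes "Z \<in> lie" "t \<in> T"
  shows "leg s e 0 Z (V_leg i W t) = V_leg i W (leg s e 0 Z t)"
proof (intro ext)
  fix K g
  show "leg s e 0 Z (V_leg i W t) K g = V_leg i W (leg s e 0 Z t) K g"
    unfolding leg_def V_leg_def[abs_def]
    using lie_act_sum_ps[OF assms(1) finite_class.finite_UNIV, of "\<lambda>a. t (K[i - 1 := a])" "\<lambda>a. W $ (K ! (i - 1)) $ a"] T_ps[OF assms(2)]
    by simp
qed

lemma all_legs_leg_0: "Z \<in> lie \<Longrightarrow> t \<in> T \<Longrightarrow> all_legs x m (leg s e 0 Z t) = leg s e 0 Z (all_legs x m t)"
  by (induction m arbitrary: t) (simp_all add: leg_0_V_leg[symmetric] V_leg_mem[OF X])

lemma V_leg_neg: "V_leg i (- Z) t = - V_leg i Z t" "V_leg i Z (- t) = - V_leg i Z t"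
  by (simp_all add: V_leg_def fun_eq_iff sum_negf)

text \<open>Taking adjoints amounts to conjugating by \<open>w\<^sub>0\<close>, which acts as \<open>\<xi>\<close> on all factors of \<open>V\<close>.\<close>

lemma leg_leg_adjoint:
  assumes A: "A \<in> g0 s e" and C: "C \<in> g0 s e" and ij: "j < i" "i \<le> l" and t: "t \<in> T" "t' \<in> T"
  shows "tf (leg s e j (cmat_of A) (leg s e i (cmat_of C) t)) t'
    = tf t (Xi (leg s e j (cmat_of A) (leg s e i (cmat_of C) (Xi t'))))"
proof -
  let ?A = "cmat_of A" and ?C = "cmat_of C"
  have AC: "?A \<in> lie" "?C \<in> lie" using A C by (simp_all add: g0_lie)
  have i: "i \<in> {1..l}" "leg s e i Z = V_leg i Z" for Z using ij by (auto simp: leg_def)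
  have Ct: "V_leg i ?C t \<in> T" "V_leg i ?C (Xi t') \<in> T" "Xi t' \<in> T"
    using t Xi_mem V_leg_mem[OF X] by auto
  have XiC: "Xi (V_leg i Z u) = V_leg i (xi s e ** Z ** xi s e) (Xi u)" if "u \<in> T" for Z u
    using all_legs_V_leg[OF xi_square X that i(1), of l Z] ij by simp
  have tC: "transpose ?C = - (xi s e ** ?C ** xi s e)" "transpose ?A = - (xi s e ** ?A ** xi s e)"
    using xi_conj AC by simp_all
  show ?thesis
  proof (cases "j = 0")
    case True
    \<comment> \<open>On \<open>X\<close> the adjoint of a real \<open>A\<close> is
      \<open>- A\<close>; this sign cancels the one in
      \<open>transpose ?C = - (xi s e ** ?C ** xi s e)\<close>.\<close>
    have gs: "g_star ?A = cmat_scale (- 1) ?A"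
      by (simp add: vec_eq_iff g_star_def cmat_cnj_def cmat_of_def cmat_scale_def)
    have "tf (leg s e 0 ?A (V_leg i ?C t)) t' = tf (V_leg i ?C t) (leg s e 0 (g_star ?A) t')"
      unfolding leg_def using AC by (simp, intro X_op_adjoint inv Ct t) (auto simp: lie_g_cpx)
    also have "leg s e 0 (g_star ?A) t' = - leg s e 0 ?A t'"
    proof (intro ext)
      fix K g
      have "leg s e 0 (cmat_scale (- 1) ?A) t' K g = - 1 * leg s e 0 ?A t' K g"
        by (rule leg_scale[OF AC(1) t(2)])
      then show "leg s e 0 (g_star ?A) t' K g = (- leg s e 0 ?A t') K g"
        unfolding gs by (rule trans) simp
    qed
    also have "tf (V_leg i ?C t) (- leg s e 0 ?A t') = tf t (V_leg i (transpose ?C) (- leg s e 0 ?A t'))"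
    proof (rule V_leg_adjoint[OF _ i(1) t(1)])
      show "hV (?C *v v) w = hV v (transpose ?C *v w)" for v w by (rule hV_adjoint[OF V C])
      have "- leg s e 0 ?A t' = (\<lambda>K g. - 1 * leg s e 0 ?A t' K g + 0 * t' K g)" by (intro ext) simp
      also have "\<dots> \<in> T" by (rule tensors_comb[OF X leg_mem[OF AC(1) t(2)] t(2)])
      finally show "- leg s e 0 ?A t' \<in> T" .
    qed
    also have "V_leg i (transpose ?C) (- leg s e 0 ?A t') = V_leg i (xi s e ** ?C ** xi s e) (leg s e 0 ?A t')"
      unfolding tC V_leg_neg by simp
    also have "\<dots> = Xi (leg s e 0 ?A (V_leg i ?C (Xi t')))"
      using Ct t AC by (simp add: all_legs_leg_0 XiC Xi_Xi leg_0_V_leg leg_mem)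
    finally show ?thesis using True by (simp add: i)
  next
    case False
    \<comment> \<open>With both legs on copies of \<open>V\<close> the signs of the two transposes
      cancel each other.\<close>
    then have j: "j \<in> {1..l}" "leg s e j Z = V_leg j Z" for Z using ij by (auto simp: leg_def)
    have XiA: "Xi (V_leg j Z u) = V_leg j (xi s e ** Z ** xi s e) (Xi u)" if "u \<in> T" for Z u
      using all_legs_V_leg[OF xi_square X that j(1), of l Z] ij by simp
    have "tf (V_leg j ?A (V_leg i ?C t)) t' = tf (V_leg i ?C t) (V_leg j (transpose ?A) t')"
      by (rule V_leg_adjoint[OF hV_adjoint[OF V A] j(1) Ct(1) t(2)])
    also have "\<dots> = tf t (V_leg i (transpose ?C) (V_leg j (transpose ?A) t'))"
      by (rule V_leg_adjoint[OF hV_adjoint[OF V C] i(1) t(1) V_leg_mem[OF X t(2)]])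
    also have "V_leg i (transpose ?C) (V_leg j (transpose ?A) t')
        = V_leg i (xi s e ** ?C ** xi s e) (V_leg j (xi s e ** ?A ** xi s e) t')"
      unfolding tC V_leg_neg by simp
    also have "\<dots> = V_leg j (xi s e ** ?A ** xi s e) (V_leg i (xi s e ** ?C ** xi s e) t')"
      using ij j i by (intro V_leg_commute) auto
    also have "\<dots> = Xi (V_leg j ?A (V_leg i ?C (Xi t')))"
      using Ct t by (simp add: XiA XiC Xi_Xi)
    finally show ?thesis by (simp add: i j)
  qed
qed

context
  fixes nm :: normalization and B :: "(complex^'m^'m) set"
  assumes B: "is_lie_basis s e B"
begin

text \<open>The factor between the scaled Killing form and the trace form, taken as a real number
  because its reality enters \<open>Omega_adjoint\<close>.\<close>

definition kappa :: real where
  "kappa = Re (form_scale nm s) * (real CARD('m) - 2 * \<epsilon>)"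

text \<open>For \<open>O(p,q)\<close> parity excludes \<open>p + q = 2\<close>, where the form would
  degenerate; for the symplectic group the second factor is positive.\<close>

lemma kappa: "of_real kappa = form_scale nm s * (of_nat CARD('m) - 2 * of_real \<epsilon>)" "kappa \<noteq> 0"
proof -
  have "form_scale nm s = of_real (Re (form_scale nm s)) \<and> Re (form_scale nm s) \<noteq> 0"
  proof (cases nm; cases s)
    fix n assume "nm = Consistent" "s = Sp n"
    moreover have "1 / (4 * (complex_of_nat n + 1)) = of_real (1 / (4 * (real n + 1)))" by simp
    ultimately show ?thesis by (simp del: of_real_divide) 
  next
    fix p q assume s: "nm = Consistent" "s = O1 p q"
    then have "odd (p + q)" using valid by simp
    then have "p + q \<noteq> 2" by presburger
    then have "real p + real q - 2 \<noteq> 0" by linarith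
    moreover have "1 / (2 * (complex_of_nat p + of_nat q - 2)) = of_real (1 / (2 * (real p + real q - 2)))" by simp
    ultimately show ?thesis using s by (simp del: of_real_divide)
  next
    fix p q assume s: "nm = Consistent" "s = O2 p q"
    then have "odd (p + q)" using valid by simp
    then have "p + q \<noteq> 2" by presburger
    then have "real p + real q - 2 \<noteq> 0" by linarith
    moreover have "1 / (2 * (complex_of_nat p + of_nat q - 2)) = of_real (1 / (2 * (real p + real q - 2)))" by simp
    ultimately show ?thesis using s by (simp del: of_real_divide)
  qed auto
  moreover have "real CARD('m) - 2 * \<epsilon> \<noteq> 0"
  proof (cases s)
    case (Sp n)
    then show ?thesis by (simp add: CARD_N; linarith)
  next
    case (O1 p q)
    then have "odd (p + q)" using valid by simp
    then have "p + q \<noteq> 2" by presburger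
    then show ?thesis unfolding CARD_N O1 by (simp; linarith)
  next
    case (O2 p q)
    then have "odd (p + q)" using valid by simp
    then have "p + q \<noteq> 2" by presburger
    then show ?thesis unfolding CARD_N O2 by (simp; linarith)
  qed
  ultimately show "of_real kappa = form_scale nm s * (of_nat CARD('m) - 2 * of_real \<epsilon>)" "kappa \<noteq> 0"
    by (auto simp: kappa_def)
qed

abbreviation "P i j \<equiv> proj (unit_mat i j)"

text \<open>\<open>casimir_sum\<close> trades the basis \<open>B\<close>, which may be complex, for
  the real matrices \<open>P i j\<close>. The summand with factor 0 gives the right side the shape
  expected by \<open>tensors_comb\<close>, \<open>tf_comb\<close> and
  \<open>all_legs_comb\<close>.\<close>

lemma Omega_unit:
  assumes "j < i" "t \<in> T"
  shows "Omega nm s e B j i t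
    = (\<lambda>K g. (1 / of_real kappa) * (\<Sum>p\<in>UNIV. leg s e j (P (fst p) (snd p)) (leg s e i (P (snd p) (fst p)) t)) K g + 0 * t K g)"
proof (intro ext)
  fix K g
  have B': "finite B" "cmat.independent B" "cmat.span B = lie"
    using B unfolding is_lie_basis_def lie_g_cpx by auto
  have kap: "complex_of_real kappa \<noteq> 0" using kappa(2) by simp
  have "Omega nm s e B j i t K g = (\<Sum>b\<in>B. leg s e j b (leg s e i (dual_elt nm s e B b) t) K g)"
    unfolding Omega_def by (simp add: sum_apply_fun)
  also have "\<dots> = (\<Sum>b\<in>B. leg s e j b (leg s e i (cmat_scale (1 / of_real kappa) (dual_vec B b)) t) K g)"
    by (intro sum.cong refl, subst dual_elt_dual_vec[OF B' lie_g_cpx kappa(1) kap]) auto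
  also have "\<dots> = (1 / of_real kappa) * (\<Sum>x\<in>UNIV. \<Sum>y\<in>UNIV. leg s e j (P x y) (leg s e i (P y x) t) K g)"
  proof (rule casimir_sum[where \<beta>="\<lambda>b c. leg s e j b (leg s e i c t) K g"])
    fix x y w a
    assume m: "x \<in> lie" "y \<in> lie" "w \<in> lie"
    have "leg s e i (x + y) t = (\<lambda>K g. 1 * leg s e i x t K g + 1 * leg s e i y t K g)"
      using m assms by (intro ext) (simp add: leg_add)
    then show "leg s e j w (leg s e i (x + y) t) K g = leg s e j w (leg s e i x t) K g + leg s e j w (leg s e i y t) K g"
      using leg_comb[OF m(3) leg_mem[OF m(1) assms(2)] leg_mem[OF m(2) assms(2)], of j 1 i 1 i] by simp
  next
    fix x w a
    assume m: "x \<in> lie" "w \<in> lie"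
    have "leg s e i (cmat_scale a x) t = (\<lambda>K g. a * leg s e i x t K g + 0 * leg s e i x t K g)"
      using m assms by (intro ext) (simp add: leg_scale)
    then show "leg s e j w (leg s e i (cmat_scale a x) t) K g = a * leg s e j w (leg s e i x t) K g"
      using leg_comb[OF m(2) leg_mem[OF m(1) assms(2)] leg_mem[OF m(1) assms(2)], of j a i 0 i] by simp
  qed (use B' assms leg_mem leg_add leg_scale in auto)
  finally show "Omega nm s e B j i t K g = (1 / of_real kappa) *
      (\<Sum>p\<in>UNIV. leg s e j (P (fst p) (snd p)) (leg s e i (P (snd p) (fst p)) t)) K g + 0 * t K g"
    by (simp add: sum_apply_fun sum.cartesian_product split_def)
qed

lemma leg_leg_sum_mem: "t \<in> T \<Longrightarrow> (\<Sum>p\<in>UNIV. leg s e j (P (fst p) (snd p)) (leg s e i (P (snd p) (fst p)) t)) \<in> T"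
  by (intro tensors_sum[OF X] leg_mem proj_lie) auto

lemma Omega_mem: "\<lbrakk>j < i; t \<in> T\<rbrakk> \<Longrightarrow> Omega nm s e B j i t \<in> T"
  unfolding Omega_unit by (intro tensors_comb[OF X] leg_leg_sum_mem)

text \<open>\<open>leg_leg_adjoint\<close> applies to real matrices, and
  \<open>proj_unit_real\<close> makes every term qualify. The real factor \<open>1 / kappa\<close>
  survives conjugation in the second variable.\<close>

lemma Omega_adjoint:
  assumes "j < i" "i \<le> l" and t: "t \<in> T" "t' \<in> T"
  shows "tf (Omega nm s e B j i t) t' = tf t (Xi (Omega nm s e B j i (Xi t')))"
proof -
  let ?S = "\<lambda>t. (\<Sum>p\<in>UNIV. leg s e j (P (fst p) (snd p)) (leg s e i (P (snd p) (fst p)) t))"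
  have g0: "cmat_Re (P x y) \<in> g0 s e" for x y using proj_lie[of "unit_mat x y"] by (simp add: lie_g_cpx g_cpx_def)
  have adj: "tf (leg s e j (P x y) (leg s e i (P y x) t)) t' = tf t (Xi (leg s e j (P x y) (leg s e i (P y x) (Xi t'))))" for x y
    using leg_leg_adjoint[OF g0[of x y] g0[of y x] assms] proj_unit_real by metis
  have "tf (?S t) t' = tf t (Xi (?S (Xi t')))"
    unfolding all_legs_sum
    by (subst tf_sum(1), simp, intro leg_mem proj_lie t, rule t, subst tf_sum(2), simp,
        intro Xi_mem leg_mem proj_lie t, rule t, simp add: adj)
  moreover have "tf (Omega nm s e B j i t) t' = (1 / of_real kappa) * tf (?S t) t'"
    unfolding Omega_unit[OF assms(1) t(1)] by (subst tf_comb(1)[OF leg_leg_sum_mem[OF t(1)] t(1) t(2)]) simp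
  moreover have "tf t (Xi (Omega nm s e B j i (Xi t'))) = (1 / of_real kappa) * tf t (Xi (?S (Xi t')))"
    unfolding Omega_unit[OF assms(1) Xi_mem[OF t(2)]] all_legs_comb
    by (subst tf_comb(2)[OF Xi_mem[OF leg_leg_sum_mem[OF Xi_mem[OF t(2)]]] Xi_mem[OF Xi_mem[OF t(2)]] t(1)]) simp
  ultimately show ?thesis by simp
qed

lemma z_mem: "t \<in> T \<Longrightarrow> z_op nm s e B i t \<in> T"
  unfolding z_op_def by (intro tensors_sum[OF X] Omega_mem) auto

lemma z_adjoint:
  assumes "i \<in> {1..l}" "t \<in> T" "t' \<in> T"
  shows "tf (z_op nm s e B i t) t' = tf t (Xi (z_op nm s e B i (Xi t')))"
proof -
  have "tf (z_op nm s e B i t) t' = (\<Sum>j<i. tf (Omega nm s e B j i t) t')"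
    unfolding z_op_def by (rule tf_sum(1)) (use assms in \<open>auto intro: Omega_mem\<close>)
  also have "\<dots> = (\<Sum>j<i. tf t (Xi (Omega nm s e B j i (Xi t'))))"
    using assms by (intro sum.cong refl Omega_adjoint) auto
  also have "\<dots> = tf t (\<Sum>j<i. Xi (Omega nm s e B j i (Xi t')))"
    by (rule tf_sum(2)[symmetric]) (use assms in \<open>auto intro: Omega_mem Xi_mem\<close>)
  finally show ?thesis unfolding z_op_def all_legs_sum .
qed

end

end

section \<open>Positive semidefinite forms\<close>

lemma (in cspace) rep_span_insert:
  assumes "insert v S \<subseteq> vecs Y" "x \<in> rep_span Y (insert v S)"
  shows "\<exists>a. \<exists>s\<in>rep_span Y S. x = vadd Y (vscale Y a v) s"
  using assms(2)
proof (induction rule: rep_span_induct)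
  have v: "v \<in> vecs Y" using assms by auto
  note S = csubspace_rep_span[of S]
  have SS: "rep_span Y S \<subseteq> vecs Y" using csubspace.sub[OF S] assms by auto
  {
    case (base x)
    show ?case
    proof (cases "x = v")
      case True
      then show ?thesis
        using v by (intro exI[of _ 1] bexI[of _ "vzero Y"]) (auto simp: scale_one add_zero rep_span_zero)
    next
      case False
      then show ?thesis
        using base rep_span_superset[of S Y] v SS
        by (intro exI[of _ 0] bexI[of _ x]) (auto simp: scale_zero zero_add)
    qed
  next
    case zero
    show ?case
      by (intro exI[of _ 0] bexI[of _ "vzero Y"]) (auto simp: scale_zero v add_zero zero_mem rep_span_zero)
  next
    case (comb a b x y)
    then obtain c s d t where st: "s \<in> rep_span Y S" "x = vadd Y (vscale Y c v) s" "t \<in> rep_span Y S" "y = vadd Y (vscale Y d v) t"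
      by blast
    then have m: "s \<in> vecs Y" "t \<in> vecs Y" using SS by auto
    have "vadd Y (vscale Y a x) (vscale Y b y)
        = vadd Y (vadd Y (vscale Y (a * c) v) (vscale Y a s)) (vadd Y (vscale Y (b * d) v) (vscale Y b t))"
      using v m by (simp add: st scale_add scale_scale scale_mem)
    also have "\<dots> = vadd Y (vadd Y (vscale Y (a * c) v) (vscale Y (b * d) v)) (vadd Y (vscale Y a s) (vscale Y b t))"
      by (intro add_add_swap scale_mem v m)
    also have "\<dots> = vadd Y (vscale Y (a * c + b * d) v) (vadd Y (vscale Y a s) (vscale Y b t))"
      by (simp add: add_scale v)
    finally have eq: "vadd Y (vscale Y a x) (vscale Y b y)
        = vadd Y (vscale Y (a * c + b * d) v) (vadd Y (vscale Y a s) (vscale Y b t))" .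
    show ?case
      by (intro exI[of _ "a * c + b * d"] bexI[of _ "vadd Y (vscale Y a s) (vscale Y b t)"] eq rep_span_comb st)
  }
qed

locale psd_space = cspace Y for Y :: "('h, 'v) rep" +
  fixes P :: "'v \<Rightarrow> 'v \<Rightarrow> complex"
  assumes herm: "hermitian_form Y P"
    and psd: "x \<in> vecs Y \<Longrightarrow> P x x \<in> \<real> \<and> 0 \<le> Re (P x x)"
begin

lemma comb_mem: "\<lbrakk>x \<in> vecs Y; y \<in> vecs Y\<rbrakk> \<Longrightarrow> vadd Y (vscale Y a x) (vscale Y b y) \<in> vecs Y"
  by (simp add: add_mem scale_mem)

lemma P_comb:
  assumes "x \<in> vecs Y" "y \<in> vecs Y" "z \<in> vecs Y"
  shows "P (vadd Y (vscale Y a x) (vscale Y b y)) z = a * P x z + b * P y z"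
    and "P z (vadd Y (vscale Y a x) (vscale Y b y)) = cnj a * P z x + cnj b * P z y"
  using herm assms unfolding hermitian_form_def by blast+

lemma P_add:
  assumes "x \<in> vecs Y" "y \<in> vecs Y" "z \<in> vecs Y"
  shows "P (vadd Y x y) z = P x z + P y z" "P z (vadd Y x y) = P z x + P z y"
  using P_comb[OF assms, of 1 1] assms by (simp_all add: scale_one)

lemma P_scale:
  assumes "x \<in> vecs Y" "z \<in> vecs Y"
  shows "P (vscale Y a x) z = a * P x z" "P z (vscale Y a x) = cnj a * P z x"
  using P_comb[OF assms(1,1,2), of a 0] assms by (simp_all add: scale_zero add_zero scale_mem)

lemma P_zero: "z \<in> vecs Y \<Longrightarrow> P (vzero Y) z = 0" "z \<in> vecs Y \<Longrightarrow> P z (vzero Y) = 0"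
  using P_scale[of "vzero Y" z 0] by (simp_all add: scale_vzero zero_mem)

text \<open>Polarization: \<open>P\<close> is real on the diagonal at \<open>x + y\<close> and at
  \<open>\<i> x + y\<close>.\<close>

lemma P_symmetric:
  assumes x: "x \<in> vecs Y" and y: "y \<in> vecs Y"
  shows "P x y = cnj (P y x)"
proof -
  have r: "Im (P z z) = 0" if "z \<in> vecs Y" for z using psd[OF that] by (auto elim: Reals_cases)
  have e: "P (vadd Y (vscale Y a x) y) (vadd Y (vscale Y a x) y)
      = a * cnj a * P x x + a * P x y + cnj a * P y x + P y y" for a
    using x y by (simp add: P_add P_scale add_mem scale_mem algebra_simps)
  have "Im (a * cnj a * P x x + a * P x y + cnj a * P y x + P y y) = 0" for a
    using r[OF add_mem[OF scale_mem[OF x, of a] y]] unfolding e .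
  from this[of 1] this[of \<i>] show ?thesis
    using r[OF x] r[OF y] by (simp add: complex_eq_iff)
qed

text \<open>If \<open>P x y\<close> were nonzero, adding a large multiple of the null vector
  \<open>x\<close> to \<open>y\<close> would make the form negative.\<close>

lemma P_null:
  assumes x: "x \<in> vecs Y" and y: "y \<in> vecs Y" and 0: "P x x = 0"
  shows "P x y = 0" "P y x = 0"
proof -
  define z where "z = P x y"
  have yx: "P y x = cnj z" using P_symmetric[OF y x] by (simp add: z_def)
  have "0 \<le> Re (P y y) - 2 * t * (cmod z)\<^sup>2" for t :: real
  proof -
    let ?a = "- of_real t * cnj z"
    have "P (vadd Y (vscale Y ?a x) y) (vadd Y (vscale Y ?a x) y) = ?a * z + cnj ?a * cnj z + P y y"
      using x y by (simp add: P_add P_scale add_mem scale_mem 0 z_def[symmetric] yx)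
    moreover have "Re (?a * z + cnj ?a * cnj z + P y y) = Re (P y y) - 2 * t * (cmod z)\<^sup>2"
      unfolding cmod_power2 by (simp add: power2_eq_square algebra_simps)
    ultimately show ?thesis using psd[OF add_mem[OF scale_mem[OF x, of ?a] y]] by simp
  qed
  \<comment> \<open>For this \<open>t\<close> the lower bound would read
    \<open>0 \<le> - 1\<close>.\<close>
  from this[of "(Re (P y y) + 1) / (2 * (cmod z)\<^sup>2)"] have "z = 0"
    by (cases "z = 0") (auto simp: field_simps)
  then show "P x y = 0" "P y x = 0" using yx by (auto simp: z_def)
qed

text \<open>Subtracting its projection to \<open>R\<close> from \<open>r\<^sub>0\<close>, one may project to \<open>R + \<complex> r\<^sub>0\<close>.\<close>

lemma projection_extend:
  assumes R: "R \<subseteq> vecs Y" "\<And>x y a b. \<lbrakk>x \<in> R; y \<in> R\<rbrakk> \<Longrightarrow> vadd Y (vscale Y a x) (vscale Y b y) \<in> R"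
    and pr: "\<And>x. x \<in> vecs Y \<Longrightarrow> \<exists>r\<in>R. \<forall>r'\<in>R. P (minus x r) r' = 0"
    and r0: "r0 \<in> vecs Y" and x: "x \<in> vecs Y"
  obtains r a where "r \<in> R" "\<And>r'. r' \<in> R \<Longrightarrow> P (minus x (vadd Y (vscale Y a r0) r)) r' = 0"
    "P (minus x (vadd Y (vscale Y a r0) r)) r0 = 0"
proof -
  obtain p where p: "p \<in> R" "\<And>r'. r' \<in> R \<Longrightarrow> P (minus r0 p) r' = 0" using pr[OF r0] by blast
  obtain q where q: "q \<in> R" "\<And>r'. r' \<in> R \<Longrightarrow> P (minus x q) r' = 0" using pr[OF x] by blast
  define v where "v = minus r0 p"
  \<comment> \<open>If \<open>v\<close> is null, this is 0 by the convention for division, and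
    \<open>P_null\<close> makes all values against \<open>v\<close> vanish.\<close>
  define a where "a = P (minus x q) v / P v v"
  have m: "p \<in> vecs Y" "q \<in> vecs Y" using p q R by auto
  have v: "v \<in> vecs Y" unfolding v_def by (intro minus_mem r0 m)
  define r where "r = vadd Y (vscale Y 1 q) (vscale Y (- a) p)"
  have rR: "r \<in> R" unfolding r_def by (intro R(2) p q)
  define d where "d = minus x (vadd Y (vscale Y a r0) r)"
  have d: "P d z = P (minus x q) z - a * P v z" if "z \<in> vecs Y" for z
    unfolding d_def r_def v_def using that x r0 m
    by (simp add: P_add P_scale add_mem scale_mem algebra_simps)
  have dR: "P d r' = 0" if "r' \<in> R" for r'
    using that d[of r'] p(2) q(2) R(1) by (auto simp: v_def)
  have "P d v = 0"
  proof (cases "P v v = 0")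
    case True
    then show ?thesis using d[OF v] P_null(2)[OF v minus_mem[OF x m(2)]] by simp
  next
    case False
    then show ?thesis using d[OF v] by (simp add: a_def)
  qed
  moreover have "d \<in> vecs Y" unfolding d_def by (intro minus_mem add_mem scale_mem x r0) (use rR R in auto)
  ultimately have "P d r0 = 0"
    using dR[OF p(1)] r0 m by (simp add: v_def P_add P_scale scale_mem)
  then show thesis using that[of r a] rR dR unfolding d_def by blast
qed

text \<open>Removing one spanning vector \<open>v\<close>, the subspace
  \<open>R \<inter> rep_span Y S\<close> has codimension at most one in \<open>R\<close>. Any
  \<open>r0\<close> in \<open>R\<close> outside \<open>rep_span Y S\<close> fills the gap, and
  \<open>projection_extend\<close> adds it.\<close>

lemma projection:
  assumes "finite S" "S \<subseteq> vecs Y" "csubspace Y R" "R \<subseteq> rep_span Y S" "x \<in> vecs Y"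
  shows "\<exists>r\<in>R. \<forall>r'\<in>R. P (minus x r) r' = 0"
  using assms
proof (induction S arbitrary: R x rule: finite_induct)
  case empty
  have "r = vzero Y" if "r \<in> rep_span Y {}" for r
    using that by (induction rule: rep_span_induct) (auto simp: scale_vzero add_zero zero_mem)
  then have "\<forall>r'\<in>R. r' = vzero Y" using empty by blast
  then show ?case
    using csubspace.sub_zero[OF empty(2)] P_zero(2) minus_mem empty zero_mem by (metis)
next
  case (insert v S)
  interpret R: csubspace Y R by fact
  show ?case
  proof (cases "R \<subseteq> rep_span Y S")
    case True
    then show ?thesis using insert by blast
  next
    case False
    then obtain r0 where r0: "r0 \<in> R" "r0 \<notin> rep_span Y S" by blast
    interpret S: csubspace Y "rep_span Y S" using insert by (intro csubspace_rep_span) auto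
    have v: "v \<in> vecs Y" using insert by auto
    obtain b s where b: "s \<in> rep_span Y S" "r0 = vadd Y (vscale Y b v) s"
      using rep_span_insert[of v S r0] insert r0 by blast
    have b0: "b \<noteq> 0"
      using r0 b S.sub_mem v by (auto simp: scale_zero zero_add)
    let ?R = "R \<inter> rep_span Y S"
    have sub: "csubspace Y ?R"
      by unfold_locales (auto intro: R.sub_mem R.sub_zero S.sub_zero R.sub_comb S.sub_comb)
    have IH: "\<exists>r\<in>?R. \<forall>r'\<in>?R. P (minus x r) r' = 0" if "x \<in> vecs Y" for x
      using insert.IH[OF _ sub _ that] insert.prems by blast
    obtain r a where r: "r \<in> ?R" "\<And>r'. r' \<in> ?R \<Longrightarrow> P (minus x (vadd Y (vscale Y a r0) r)) r' = 0"
      "P (minus x (vadd Y (vscale Y a r0) r)) r0 = 0"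
      using projection_extend[of ?R r0 x] IH insert.prems r0 R.sub_mem csubspace.sub_comb[OF sub] by blast
    let ?q = "vadd Y (vscale Y a r0) r"
    have q: "?q \<in> R" using r r0 by (intro R.sub_add R.sub_scale) auto
    have d: "minus x ?q \<in> vecs Y" using q insert.prems by (intro minus_mem[OF _ R.sub_mem[OF q]])
    have "P (minus x ?q) r' = 0" if r': "r' \<in> R" for r'
    proof -
      obtain c t where c: "t \<in> rep_span Y S" "r' = vadd Y (vscale Y c v) t"
        using rep_span_insert[of v S r'] insert r' by blast
      \<comment> \<open>The multiple \<open>c / b\<close> of \<open>r0\<close> has the same
        coordinate along \<open>v\<close> as \<open>r'\<close>, so the difference falls into
        \<open>rep_span Y S\<close>.\<close>
      define u where "u = vadd Y (vscale Y 1 r') (vscale Y (- (c / b)) r0)"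
      have m: "s \<in> vecs Y" "t \<in> vecs Y" "r0 \<in> vecs Y" "r' \<in> vecs Y"
        using b c r0 r' by (auto intro: S.sub_mem R.sub_mem)
      have "u = vadd Y (vadd Y (vscale Y c v) t) (vadd Y (vscale Y (- c) v) (vscale Y (- (c / b)) s))"
        unfolding u_def b(2) c(2) using v m b0 by (simp add: scale_one add_mem scale_mem scale_add scale_scale)
      also have "\<dots> = vadd Y (vscale Y 1 t) (vscale Y (- (c / b)) s)"
        using v m by (subst add_add_swap) (auto simp: add_scale scale_zero zero_add scale_mem add_mem scale_one)
      also have "\<dots> \<in> rep_span Y S" by (intro S.sub_comb b c)
      finally have "u \<in> ?R" unfolding u_def using R.sub_comb r' r0 by blast
      then have "P (minus x ?q) u = 0" by (rule r(2))
      moreover have "P (minus x ?q) u = P (minus x ?q) r' + cnj (- (c / b)) * P (minus x ?q) r0"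
        unfolding u_def using P_comb(2)[OF m(4,3) d] by simp
      ultimately show ?thesis using r(3) by simp
    qed
    then show ?thesis using q by blast
  qed
qed

text \<open>Gram-Schmidt for a semidefinite form: \<open>w\<close> is \<open>v\<close> minus its
  projection, and the coordinate along \<open>w\<close>, scaled by the square root of
  \<open>P w w\<close>, is the new function. Since only the values of \<open>m\<close> matter,
  linearity is not claimed.\<close>

lemma gram_decomposition:
  assumes "finite S" "S \<subseteq> vecs Y"
  shows "\<exists>(n::nat) m. \<forall>x\<in>rep_span Y S. \<forall>y\<in>rep_span Y S. P x y = (\<Sum>i<n. m i x * cnj (m i y))"
  using assms
proof (induction S rule: finite_induct)
  case empty
  have "r = vzero Y" if "r \<in> rep_span Y {}" for r
    using that by (induction rule: rep_span_induct) (auto simp: scale_vzero add_zero zero_mem)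
  note null = this
  show ?case
  proof (rule exI[of _ 0], rule exI[of _ "\<lambda>_ _. 0"], intro ballI)
    fix x y assume "x \<in> rep_span Y {}" "y \<in> rep_span Y {}"
    then have "x = vzero Y" "y = vzero Y" by (auto dest: null)
    then show "P x y = (\<Sum>i<(0::nat). 0 * cnj 0)" using P_zero(1)[OF zero_mem] by simp
  qed
next
  case (insert v S)
  from insert.prems have v: "v \<in> vecs Y" and S: "S \<subseteq> vecs Y" by auto
  interpret S: csubspace Y "rep_span Y S" using S by (rule csubspace_rep_span)
  interpret I: csubspace Y "rep_span Y (insert v S)" using v S by (intro csubspace_rep_span) auto
  obtain n m where nm: "\<forall>x\<in>rep_span Y S. \<forall>y\<in>rep_span Y S. P x y = (\<Sum>i<(n::nat). m i x * cnj (m i y))"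
    using insert.IH[OF S] by (elim exE)
  obtain p where p: "p \<in> rep_span Y S" "\<And>r. r \<in> rep_span Y S \<Longrightarrow> P (minus v p) r = 0"
    using projection[OF insert(1) S S.csubspace_axioms subset_refl v] by blast
  define w where "w = minus v p"
  have w: "w \<in> vecs Y" unfolding w_def by (intro minus_mem v S.sub_mem p)
  have ex: "\<exists>c. \<exists>s\<in>rep_span Y S. x = vadd Y (vscale Y c w) s" if x: "x \<in> rep_span Y (insert v S)" for x
  proof -
    obtain c t where c: "t \<in> rep_span Y S" "x = vadd Y (vscale Y c v) t"
      using rep_span_insert[of v S x] v S x by blast
    have m: "t \<in> vecs Y" "p \<in> vecs Y" using c p S.sub_mem by auto
    have "vadd Y (vscale Y c w) (vadd Y (vscale Y c p) (vscale Y 1 t))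
        = vadd Y (vscale Y c v) (vadd Y (vadd Y (vscale Y (- c) p) (vscale Y c p)) t)"
      using m v by (simp add: w_def scale_add scale_scale scale_mem add_mem scale_one add_assoc)
    also have "\<dots> = x"
      using m v by (simp add: c add_scale scale_zero zero_add)
    finally have "x = vadd Y (vscale Y c w) (vadd Y (vscale Y c p) (vscale Y 1 t))" ..
    then show ?thesis
      by (intro exI[of _ c] bexI[of _ "vadd Y (vscale Y c p) (vscale Y 1 t)"] S.sub_comb[OF p(1) c(1)])
  qed
  \<comment> \<open>The coordinate along \<open>w\<close> may be ambiguous when \<open>v\<close>
    lies in the span of \<open>S\<close>; the identity below holds for whichever one is
    chosen.\<close>
  define cc where "cc x = (SOME c. \<exists>s\<in>rep_span Y S. x = vadd Y (vscale Y c w) s)" for x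
  define ss where "ss x = (SOME s. s \<in> rep_span Y S \<and> x = vadd Y (vscale Y (cc x) w) s)" for x
  have ss: "ss x \<in> rep_span Y S \<and> x = vadd Y (vscale Y (cc x) w) (ss x)" if "x \<in> rep_span Y (insert v S)" for x
  proof -
    have "\<exists>s\<in>rep_span Y S. x = vadd Y (vscale Y (cc x) w) s"
      unfolding cc_def using ex[OF that] by (rule someI_ex)
    then have "\<exists>s. s \<in> rep_span Y S \<and> x = vadd Y (vscale Y (cc x) w) s" by blast
    then show ?thesis unfolding ss_def by (rule someI_ex)
  qed
  define k where "k = complex_of_real (sqrt (Re (P w w)))"
  have k: "k * cnj k = P w w"
  proof -
    have "P w w = of_real (Re (P w w))" using psd[OF w] by (simp add: complex_is_Real_iff complex_eq_iff)
    moreover have "sqrt (Re (P w w)) * sqrt (Re (P w w)) = Re (P w w)" using psd[OF w] by simp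
    ultimately show ?thesis unfolding k_def by (metis complex_cnj_complex_of_real of_real_mult)
  qed
  have "P x y = (\<Sum>i<Suc n. (if i = n then cc x * k else m i (ss x)) * cnj (if i = n then cc y * k else m i (ss y)))"
    if "x \<in> rep_span Y (insert v S)" "y \<in> rep_span Y (insert v S)" for x y
  proof -
    note sR = conjunct1[OF ss[OF that(1)]] conjunct1[OF ss[OF that(2)]]
    have s: "ss x \<in> vecs Y" "ss y \<in> vecs Y" by (intro S.sub_mem sR)+
    have w0: "P w (ss y) = 0" "P (ss x) w = 0"
      using p(2)[OF sR(1)] p(2)[OF sR(2)] P_symmetric[OF s(1) w] by (auto simp: w_def)
    have "P x y = P (vadd Y (vscale Y (cc x) w) (ss x)) (vadd Y (vscale Y (cc y) w) (ss y))"
      by (rule arg_cong2[where f=P, OF conjunct2[OF ss[OF that(1)]] conjunct2[OF ss[OF that(2)]]])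
    also have "\<dots> = cc x * cnj (cc y) * P w w + P (ss x) (ss y)"
      using s w w0 by (simp add: P_add P_scale add_mem scale_mem)
    also have "P (ss x) (ss y) = (\<Sum>i<n. m i (ss x) * cnj (m i (ss y)))"
      by (intro nm[rule_format] sR)
    finally show ?thesis by (simp add: k[symmetric] mult_ac)
  qed
  then show ?case
    by (intro exI[of _ "Suc n"] exI[of _ "\<lambda>i x. if i = n then cc x * k else m i (ss x)"] ballI)
qed

text \<open>Two representatives orthogonal to \<open>R\<close> differ by a vector that lies in
  \<open>R\<close> and is orthogonal to \<open>R\<close>, hence null, so \<open>P\<close> on such
  representatives is well defined. The complement is stable under the action because
  \<open>R\<close> is and \<open>A\<close> is closed under \<open>star\<close>. Definiteness holds
  because null vectors lie in \<open>R\<close>.\<close>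

lemma unitary_quotient:
  assumes inv: "invariant_form A star Y P" and R: "csubspace Y R"
    and null: "\<And>x. \<lbrakk>x \<in> vecs Y; P x x = 0\<rbrakk> \<Longrightarrow> x \<in> R"
    and act_mem: "\<And>h x. \<lbrakk>h \<in> A; x \<in> vecs Y\<rbrakk> \<Longrightarrow> vact Y h x \<in> vecs Y"
    and act_add: "\<And>h x y. \<lbrakk>h \<in> A; x \<in> vecs Y; y \<in> vecs Y\<rbrakk> \<Longrightarrow> vact Y h (vadd Y x y) = vadd Y (vact Y h x) (vact Y h y)"
    and act_sub: "\<And>h x. \<lbrakk>h \<in> A; x \<in> R\<rbrakk> \<Longrightarrow> vact Y h x \<in> R"
    and star: "\<And>h. h \<in> A \<Longrightarrow> star h \<in> A"
    and pr: "\<And>x. x \<in> vecs Y \<Longrightarrow> \<exists>r\<in>R. \<forall>r'\<in>R. P (minus x r) r' = 0"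
  shows "unitary A star (quotient_rep Y R)"
proof -
  interpret R: csubspace Y R by fact
  define good where "good C x \<longleftrightarrow> x \<in> vecs Y \<and> coset Y R x = C \<and> (\<forall>r\<in>R. P x r = 0)" for C x
  define pick where "pick C = (SOME x. good C x)" for C
  have pick: "good (coset Y R x) (pick (coset Y R x))" if x: "x \<in> vecs Y" for x
  proof -
    obtain r where r: "r \<in> R" "\<forall>r'\<in>R. P (minus x r) r' = 0" using pr[OF x] by blast
    have "coset Y R (minus x r) = coset Y R x"
      using r x by (intro R.coset_add_right R.sub_scale)
    then have "good (coset Y R x) (minus x r)"
      using r x by (simp add: good_def minus_mem R.sub_mem)
    then show ?thesis unfolding pick_def by (rule someI)
  qed
  have unique: "P x z = P y z" "P z x = P z y" if "good C x" "good C y" "z \<in> vecs Y" for C x y z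
  proof -
    have m: "x \<in> vecs Y" "y \<in> vecs Y" using that by (auto simp: good_def)
    have d: "minus x y \<in> R" "minus x y \<in> vecs Y"
      using that m R.coset_eq_iff[OF m] by (auto simp: good_def minus_mem)
    have "P (minus x y) (minus x y) = 0"
    proof -
      have "P x (minus x y) = 0" "P y (minus x y) = 0" using that d by (auto simp: good_def)
      then show ?thesis using m d by (simp add: P_add P_scale scale_mem)
    qed
    from P_null[OF d(2) that(3) this] show "P x z = P y z" "P z x = P z y"
      using m that by (simp_all add: P_add P_scale scale_mem)
  qed
  define Q where "Q C D = P (pick C) (pick D)" for C D
  have Q: "Q C D = P x y" if "good C x" "good D y" for C D x y
  proof -
    have m: "x \<in> vecs Y" "y \<in> vecs Y" "C = coset Y R x" "D = coset Y R y" using that by (auto simp: good_def)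
    have g: "good C (pick C)" "good D (pick D)" using pick m by simp_all
    have "P (pick C) (pick D) = P x (pick D)" using g by (intro unique(1)[OF g(1) that(1)]) (simp add: good_def)
    also have "\<dots> = P x y" using m by (intro unique(2)[OF g(2) that(2)])
    finally show ?thesis by (simp add: Q_def)
  qed
  have good_ex: "\<exists>x. good C x" if "C \<in> vecs R.Q" for C using that pick by (auto simp: R.vecs_quotient)
  have good_comb: "good (vadd R.Q (vscale R.Q a C) (vscale R.Q b D)) (vadd Y (vscale Y a x) (vscale Y b y))"
    if "good C x" "good D y" for a b C D x y
    using that by (auto simp: good_def comb_mem R.vadd_quotient[symmetric] R.vscale_quotient[symmetric] scale_mem P_comb R.sub_mem)
  have good_act: "good (vact R.Q h C) (vact Y h x)" if "good C x" "h \<in> A" for h C x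
    unfolding good_def
  proof (intro conjI ballI)
    have x: "x \<in> vecs Y" "coset Y R x = C" using that by (auto simp: good_def)
    show "vact Y h x \<in> vecs Y" using act_mem that x by blast
    show "coset Y R (vact Y h x) = vact R.Q h C"
      using R.vact_quotient[OF x(1), of h] act_mem act_add act_sub that(2) x by simp
    fix r assume r: "r \<in> R"
    have "P (vact Y h x) r = P x (vact Y (star h) r)"
      using inv that(2) x r R.sub_mem unfolding invariant_form_def by blast
    also have "\<dots> = 0" using act_sub[OF star[OF that(2)] r] that(1) by (simp add: good_def)
    finally show "P (vact Y h x) r = 0" .
  qed
  have "hermitian_form R.Q Q"
    unfolding hermitian_form_def
  proof (intro ballI allI)
    fix C D E a b assume "C \<in> vecs R.Q" "D \<in> vecs R.Q" "E \<in> vecs R.Q"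
    then obtain x y z where g: "good C x" "good D y" "good E z" using good_ex by meson
    then have m: "x \<in> vecs Y" "y \<in> vecs Y" "z \<in> vecs Y" by (auto simp: good_def)
    show "Q (vadd R.Q (vscale R.Q a C) (vscale R.Q b D)) E = a * Q C E + b * Q D E \<and>
        Q E (vadd R.Q (vscale R.Q a C) (vscale R.Q b D)) = cnj a * Q E C + cnj b * Q E D"
      using P_comb[OF m] Q[OF good_comb[OF g(1,2)] g(3)] Q[OF g(3) good_comb[OF g(1,2)]] Q g by simp
  qed
  moreover have "invariant_form A star R.Q Q"
    unfolding invariant_form_def
  proof (intro ballI)
    fix h C D assume h: "h \<in> A" and "C \<in> vecs R.Q" "D \<in> vecs R.Q"
    then obtain x y where g: "good C x" "good D y" using good_ex by meson
    have "P (vact Y h x) y = P x (vact Y (star h) y)"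
      using inv h g unfolding invariant_form_def good_def by blast
    then show "Q (vact R.Q h C) D = Q C (vact R.Q (star h) D)"
      using Q[OF good_act[OF g(1) h] g(2)] Q[OF g(1) good_act[OF g(2) star[OF h]]] by simp
  qed
  moreover have "positive_definite R.Q Q"
    unfolding positive_definite_def
  proof (intro ballI impI)
    fix C assume C: "C \<in> vecs R.Q" "C \<noteq> vzero R.Q"
    then obtain x where g: "good C x" using good_ex by blast
    then have x: "x \<in> vecs Y" by (simp add: good_def)
    have "x \<notin> R" using C g R.coset_eq_zero_iff[OF x] by (auto simp: good_def R.vzero_quotient R.coset_zero)
    then have "P x x \<noteq> 0" using null x by blast
    then have "Re (P x x) \<noteq> 0" using psd[OF x] by (auto elim: Reals_cases)
    then show "Q C C \<in> \<real> \<and> 0 < Re (Q C C)" using psd[OF x] Q[OF g g] by auto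
  qed
  ultimately show ?thesis unfolding unitary_def by blast
qed

end

lemma (in cspace) csubspace_form_radical:
  assumes f: "hermitian_form Y f"
  shows "csubspace Y (form_radical Y f)"
proof
  have lin: "f (vadd Y (vscale Y a x) (vscale Y b y)) z = a * f x z + b * f y z"
    if "x \<in> vecs Y" "y \<in> vecs Y" "z \<in> vecs Y" for a b x y z
    using f that unfolding hermitian_form_def by blast
  show "form_radical Y f \<subseteq> vecs Y" by (auto simp: form_radical_def)
  have "f (vzero Y) y = 0" if "y \<in> vecs Y" for y
    using lin[OF zero_mem zero_mem that, of 0 0] by (simp add: scale_vzero add_zero zero_mem)
  then show "vzero Y \<in> form_radical Y f" by (simp add: form_radical_def zero_mem)
  show "vadd Y (vscale Y a x) (vscale Y b y) \<in> form_radical Y f"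
    if "x \<in> form_radical Y f" "y \<in> form_radical Y f" for a b x y
    using that lin by (auto simp: form_radical_def add_mem scale_mem)
qed

lemma principal_series_sel [simp]:
  "vecs (principal_series s e k \<nu>) = ps_space s e k \<nu>" "vzero (principal_series s e k \<nu>) = 0"
  "vadd (principal_series s e k \<nu>) = (+)" "vscale (principal_series s e k \<nu>) = (\<lambda>c f g. c * f g)"
  "vact (principal_series s e k \<nu>) = lie_act s e"
  by (simp_all add: principal_series_def)

lemma sesquilinear_principal_series:
  "hermitian_form (principal_series s e k \<nu>) h \<Longrightarrow> sesquilinear_on (ps_space s e k \<nu>) h"
  unfolding hermitian_form_def sesquilinear_on_def by (simp add: plus_fun_def)

lemma (in group_setting) cspace_principal_series: "cspace (principal_series s e k \<nu>)"
  using fun_subspace_ps[of k \<nu>]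
  by unfold_locales
    (simp_all add: fun_subspace_def fun_subspace_add[OF fun_subspace_ps] fun_subspace_scale[OF fun_subspace_ps]
      add.assoc add.commute, simp_all add: fun_eq_iff distrib_left distrib_right mult.assoc)

section \<open>Transport of the forms to the Hecke module\<close>

context functor_forms
begin

context
  fixes nm :: normalization and B :: "(complex^'m^'m) set" and \<mu> :: "real^'m^'m \<Rightarrow> complex"
    and c :: complex and \<nu>' :: "nat \<Rightarrow> complex" and \<Phi> :: "fa set set \<Rightarrow> complex \<Rightarrow> 'm tens"
  assumes B: "is_lie_basis s e B" and iso: "hecke_iso nm s e B PS \<mu> c l \<nu>' \<Phi>" and c: "cnj c = c"
begin

private abbreviation "b \<equiv> braid_const nm"
private abbreviation "Y \<equiv> induced_module b c l \<nu>'"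

lemma Phi_T: "x \<in> vecs Y \<Longrightarrow> \<Phi> x 1 \<in> T"
  using iso bij_betwE[of \<Phi> "vecs Y"] unfolding hecke_iso_def Let_def F_hom_def by blast

lemma Phi_comb: "\<lbrakk>x \<in> vecs Y; y \<in> vecs Y\<rbrakk> \<Longrightarrow>
  \<Phi> (vadd Y (vscale Y a x) (vscale Y a' y)) 1 = (\<lambda>J g. a * \<Phi> x 1 J g + a' * \<Phi> y 1 J g)"
  using iso unfolding hecke_iso_def Let_def by simp

lemma Phi_eps: "\<lbrakk>x \<in> vecs Y; i \<in> {1..l}\<rbrakk> \<Longrightarrow>
  \<Phi> (vact Y (hecke_eps b c l i) x) 1 = (\<lambda>J g. 1 * z_op nm s e B i (\<Phi> x 1) J g + (- r_const nm s) * \<Phi> x 1 J g)"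
  using iso unfolding hecke_iso_def Let_def by simp

lemma Phi_adj: "\<lbrakk>x \<in> vecs Y; i \<in> {1..<l}\<rbrakk> \<Longrightarrow> \<Phi> (vact Y (hecke_grp b c l (s_adj i)) x) 1 = flip_op i (\<Phi> x 1)"
  using iso unfolding hecke_iso_def Let_def by simp

lemma Phi_seps: "\<lbrakk>x \<in> vecs Y; i \<in> {1..l}\<rbrakk> \<Longrightarrow> \<Phi> (vact Y (hecke_grp b c l (s_eps i)) x) 1 = V_leg i (xi s e) (\<Phi> x 1)"
  using iso unfolding hecke_iso_def Let_def by simp

text \<open>\<open>hecke_iso\<close> describes sign changes one at a time, so the longest element is
  peeled off factor by factor.\<close>

lemma Phi_w_longest: "\<lbrakk>m \<le> l; x \<in> vecs Y\<rbrakk> \<Longrightarrow>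
  \<Phi> (vact Y (hecke_grp b c l (w_longest m)) x) 1 = all_legs (xi s e) m (\<Phi> x 1)"
proof (induction m arbitrary: x)
  case 0
  have w0: "w_longest 0 = id" by (simp add: w_longest_def)
  show ?case unfolding hecke_grp_def w0 vact_Grp_id[OF 0(2)] all_legs.simps ..
next
  case (Suc m)
  have s: "s_eps (Suc m) \<in> W_grp l" using Suc.prems by (intro s_eps_W) auto
  have y: "vact Y (hecke_grp b c l (s_eps (Suc m))) x \<in> vecs Y"
    unfolding hecke_grp_def using Suc.prems s by (intro vact_ind_mem fa_word_Grp)
  have "vact Y (hecke_grp b c l (w_longest (Suc m))) x
      = vact Y (hecke_grp b c l (w_longest m)) (vact Y (hecke_grp b c l (s_eps (Suc m))) x)"
    unfolding hecke_grp_def w_longest_Suc using Suc.prems s by (intro vact_Grp_comp w_longest_W_le) auto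
  then show ?case using Suc.IH[OF _ y] Suc.prems Phi_seps[OF Suc.prems(2), of "Suc m"] by simp
qed

definition form where "form x y = F_form l h hV (\<Phi> x) (\<Phi> y)"

lemma form_tf: "form x y = tf (\<Phi> x 1) (\<Phi> y 1)"
  by (simp add: form_def F_form_def)

lemma form_hermitian: "hermitian_form Y form"
  unfolding hermitian_form_def form_tf by (simp add: Phi_comb tf_comb Phi_T)

lemma form_invariant: "invariant_form (hecke_alg b c l) (hecke_star b c l) Y form"
proof (rule invariant_form_generators[OF _ c form_hermitian])
  show "cnj b = b" by (cases nm) auto
  fix i x y assume xy: "x \<in> vecs Y" "y \<in> vecs Y"
  note t = Phi_T[OF xy(1)] Phi_T[OF xy(2)]
  { assume i: "i \<in> {1..<l}"
    show "form (vact Y (hecke_grp b c l (s_adj i)) x) y = form x (vact Y (hecke_grp b c l (s_adj i)) y)"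
      unfolding form_tf Phi_adj[OF xy(1) i] Phi_adj[OF xy(2) i] by (rule flip_adjoint[OF i]) }
  { assume i: "i \<in> {1..l}"
    show "form (vact Y (hecke_grp b c l (s_eps i)) x) y = form x (vact Y (hecke_grp b c l (s_eps i)) y)"
      unfolding form_tf Phi_seps[OF xy(1) i] Phi_seps[OF xy(2) i]
      by (rule V_leg_adjoint[OF hV_xi[OF V] i t]) }
  { assume i: "i \<in> {1..l}"
    let ?w = "hecke_grp b c l (w_longest l)" and ?r = "r_const nm s"
    \<comment> \<open>The shift by \<open>r\<close> commutes with conjugation by \<open>Xi\<close>,
      but in the second variable it appears conjugated.\<close>
    have r: "cnj ?r = ?r" by (cases s; cases nm) (simp_all add: r_orth_def)
    have w: "vact Y ?w z \<in> vecs Y" "\<Phi> (vact Y ?w z) 1 = Xi (\<Phi> z 1)" if "z \<in> vecs Y" for z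
      using that Phi_w_longest[OF order_refl that] unfolding hecke_grp_def
      by (auto intro: vact_ind_mem fa_word_Grp w_longest_W)
    have e: "vact Y (hecke_eps b c l i) z \<in> vecs Y" if "z \<in> vecs Y" for z
      using that i unfolding hecke_eps_def by (intro vact_ind_mem fa_word_Eps)
    have "form x (vact Y ?w (vact Y (hecke_eps b c l i) (vact Y ?w y)))
        = tf (\<Phi> x 1) (\<lambda>J g. 1 * Xi (z_op nm s e B i (Xi (\<Phi> y 1))) J g + (- ?r) * Xi (Xi (\<Phi> y 1)) J g)"
      unfolding form_tf w(2)[OF e[OF w(1)[OF xy(2)]]] Phi_eps[OF w(1)[OF xy(2)] i] w(2)[OF xy(2)] all_legs_comb ..
    also have "\<dots> = cnj 1 * tf (\<Phi> x 1) (Xi (z_op nm s e B i (Xi (\<Phi> y 1)))) + cnj (- ?r) * tf (\<Phi> x 1) (Xi (Xi (\<Phi> y 1)))"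
      by (intro tf_comb Xi_mem z_mem[OF B] t)
    also have "\<dots> = 1 * tf (z_op nm s e B i (\<Phi> x 1)) (\<Phi> y 1) + (- ?r) * tf (\<Phi> x 1) (\<Phi> y 1)"
      using z_adjoint[OF B i t] Xi_Xi[OF t(2)] r by simp
    also have "\<dots> = form (vact Y (hecke_eps b c l i) x) y"
      unfolding form_tf Phi_eps[OF xy(1) i] by (intro tf_comb(1)[symmetric] z_mem[OF B] t)
    finally show "form (vact Y (hecke_eps b c l i) x) y = form x (vact Y ?w (vact Y (hecke_eps b c l i) (vact Y ?w y)))" .. }
qed

end

text \<open>Supplies the functionals needed by \<open>tf_gram\<close>; it depends on
  \<open>hV\<close> alone and not on the form on \<open>X\<close>.\<close>

lemma V_gram: "\<exists>(n::nat) m. \<forall>a b. gram a b = (\<Sum>c\<in>{..<n}. m c a * cnj (m c b))"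
proof -
  have sel: "vecs V_rep = (UNIV :: (complex^'m) set)" "vzero V_rep = (0 :: complex^'m)" "vadd V_rep = ((+) :: complex^'m \<Rightarrow> _)"
    "vscale V_rep = ((*s) :: complex \<Rightarrow> complex^'m \<Rightarrow> _)" by (simp_all add: V_rep_def)
  have "cspace (V_rep :: (complex^'m^'m, complex^'m) rep)"
    by unfold_locales (simp_all add: sel vec_eq_iff algebra_simps)
  moreover have "hV v v \<in> \<real> \<and> 0 \<le> Re (hV v v)" for v
  proof (cases "v = 0")
    case True
    have "hV 0 0 = 0" using hV_scale(1)[OF V, of 0 0 0] by simp
    then show ?thesis using True by simp
  next
    case False
    then show ?thesis using V unfolding is_V_form_def positive_definite_def by (auto simp: sel less_imp_le)
  qed
  ultimately interpret V: psd_space V_rep hV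
    using hV by (intro psd_space.intro psd_space_axioms.intro) auto
  obtain n m where "\<forall>x\<in>rep_span V_rep (range (\<lambda>a. axis a 1)). \<forall>y\<in>rep_span V_rep (range (\<lambda>a. axis a 1)).
      hV x y = (\<Sum>i<(n::nat). m i x * cnj (m i y))"
    using V.gram_decomposition[of "range (\<lambda>a. axis a 1)"] by (auto simp: sel)
  then have "gram a b = (\<Sum>i<n. m i (axis a 1) * cnj (m i (axis b 1)))" for a b
    using rep_span_superset[of "range (\<lambda>a. axis a 1)" V_rep] by blast
  then show ?thesis by (intro exI[of _ n] exI[of _ "\<lambda>i a. m i (axis a 1)"] allI)
qed

end

text \<open>A positive form \<open>f\<close> on the quotient of \<open>X\<close> by the radical of \<open>h\<close> induces a positive semidefinite
  form on the Hecke module whose null vectors are in the radical of the form induced by \<open>h\<close>.  So the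
  quotient by that radical is a quotient of a unitary module.\<close>

lemma hecke_quotient_unitary:
  fixes e :: "nat \<Rightarrow> 'm::finite" and \<Phi> :: "fa set set \<Rightarrow> complex \<Rightarrow> 'm tens"
  assumes h: "functor_forms s e k \<nu> h hV" and f: "functor_forms s e k \<nu> f hV"
    and B: "is_lie_basis s e B" and iso: "hecke_iso nm s e B (ps_space s e k \<nu>) \<mu> c l \<nu>' \<Phi>" and c: "cnj c = c"
    and pos: "\<And>x. x \<in> ps_space s e k \<nu> \<Longrightarrow> f x x \<in> \<real> \<and> 0 \<le> Re (f x x)"
    and null: "\<And>x y. \<lbrakk>x \<in> ps_space s e k \<nu>; f x x = 0; y \<in> ps_space s e k \<nu>\<rbrakk> \<Longrightarrow> h x y = 0"
  shows "unitary (hecke_alg (braid_const nm) c l) (hecke_star (braid_const nm) c l)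
    (hecke_langlands_quotient (braid_const nm) c l \<nu>' \<Phi> h hV)"
proof -
  interpret h: functor_forms s e k \<nu> l h hV by fact
  interpret f: functor_forms s e k \<nu> l f hV by fact
  let ?b = "braid_const nm"
  let ?Y = "induced_module ?b c l \<nu>'"
  let ?F = "\<lambda>x y. F_form l h hV (\<Phi> x) (\<Phi> y)" and ?P = "\<lambda>x y. F_form l f hV (\<Phi> x) (\<Phi> y)"
  let ?R = "form_radical ?Y ?F"
  have b: "cnj ?b = ?b" by (cases nm) auto
  have F: "hermitian_form ?Y ?F" "invariant_form (hecke_alg ?b c l) (hecke_star ?b c l) ?Y ?F"
    using h.form_hermitian[OF B iso c] h.form_invariant[OF B iso c] by (simp_all add: h.form_def[OF B iso c, abs_def])
  have P: "hermitian_form ?Y ?P" "invariant_form (hecke_alg ?b c l) (hecke_star ?b c l) ?Y ?P"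
    using f.form_hermitian[OF B iso c] f.form_invariant[OF B iso c] by (simp_all add: f.form_def[OF B iso c, abs_def])
  obtain n m where "\<forall>a b. hV (axis a 1) (axis b 1) = (\<Sum>c\<in>{..<n::nat}. m c a * cnj (m c b))"
    using h.V_gram by (elim exE)
  then have gram: "hV (axis a 1) (axis b 1) = (\<Sum>c\<in>{..<n::nat}. m c a * cnj (m c b))" for a b
    by blast
  let ?S = "PiE {..<l} (\<lambda>_. {..<n})"
  have T: "\<Phi> x 1 \<in> tensors (ps_space s e k \<nu>) l" if "x \<in> vecs ?Y" for x
    by (rule h.Phi_T[OF B iso c that])
  \<comment> \<open>Both forms are evaluated on the same contractions, so one that is null for
    \<open>f\<close> can be handed to \<open>null\<close>.\<close>
  have Pg: "?P x y = (\<Sum>C\<in>?S. f (h.contract m C (\<Phi> x 1)) (h.contract m C (\<Phi> y 1)))"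
    and Fg: "?F x y = (\<Sum>C\<in>?S. h (h.contract m C (\<Phi> x 1)) (h.contract m C (\<Phi> y 1)))"
    if "x \<in> vecs ?Y" "y \<in> vecs ?Y" for x y
    unfolding F_form_def
    by (rule f.tf_gram[OF finite_lessThan gram T[OF that(1)] T[OF that(2)]])
      (rule h.tf_gram[OF finite_lessThan gram T[OF that(1)] T[OF that(2)]])
  have fpos: "0 \<le> Re (f (h.contract m C (\<Phi> x 1)) (h.contract m C (\<Phi> x 1)))"
    "f (h.contract m C (\<Phi> x 1)) (h.contract m C (\<Phi> x 1)) \<in> \<real>" if "x \<in> vecs ?Y" for x C
    using pos[OF h.contract_mem[OF T[OF that]]] by auto
  interpret Y: psd_space ?Y ?P
  proof (intro psd_space.intro psd_space_axioms.intro cspace_Y P(1))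
    fix x assume x: "x \<in> vecs ?Y"
    show "?P x x \<in> \<real> \<and> 0 \<le> Re (?P x x)"
      unfolding Pg[OF x x] using fpos[OF x] by (auto intro!: sum_nonneg)
  qed
  have R: "csubspace ?Y ?R" by (rule Y.csubspace_form_radical[OF F(1)])
  have star: "hecke_star ?b c l h \<in> hecke_alg ?b c l" if h: "h \<in> hecke_alg ?b c l" for h
    using h by (auto simp: hecke_alg_def star_elt[OF b c] intro!: imageI fa_carrier_mult fa_word_Grp w_longest_W fa_bullet_carrier)
  have mem: "vact ?Y h x \<in> vecs ?Y" if h: "h \<in> hecke_alg ?b c l" "x \<in> vecs ?Y" for h x
    using h by (auto simp: hecke_alg_def intro: vact_ind_mem)
  have "unitary (hecke_alg ?b c l) (hecke_star ?b c l) (quotient_rep ?Y ?R)"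
  proof (rule Y.unitary_quotient[OF P(2) R])
    fix x assume x: "x \<in> vecs ?Y" "?P x x = 0"
    have fin: "finite ?S" by (intro finite_PiE) auto
    have "(\<Sum>C\<in>?S. Re (f (h.contract m C (\<Phi> x 1)) (h.contract m C (\<Phi> x 1)))) = 0"
      using x(2) unfolding Pg[OF x(1) x(1)] by (simp only: Re_sum[symmetric] zero_complex.simps)
    then have "Re (f (h.contract m C (\<Phi> x 1)) (h.contract m C (\<Phi> x 1))) = 0" if "C \<in> ?S" for C
      using that sum_nonneg_eq_0_iff[OF fin, of "\<lambda>C. Re (f (h.contract m C (\<Phi> x 1)) (h.contract m C (\<Phi> x 1)))"] fpos(1)[OF x(1)]
      by blast
    then have "f (h.contract m C (\<Phi> x 1)) (h.contract m C (\<Phi> x 1)) = 0" if "C \<in> ?S" for C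
      using that fpos(2)[OF x(1), of C] by (simp add: complex_is_Real_iff complex_eq_iff)
    then have "?F x y = 0" if "y \<in> vecs ?Y" for y
      unfolding Fg[OF x(1) that]
      by (intro sum.neutral ballI null h.contract_mem[OF T[OF x(1)]] h.contract_mem[OF T[OF that]] \<open>\<And>C. C \<in> ?S \<Longrightarrow> f _ _ = 0\<close>)
    then show "x \<in> ?R" using x by (simp add: form_radical_def)
  next
    fix a x y assume a: "a \<in> hecke_alg ?b c l" "x \<in> vecs ?Y" "y \<in> vecs ?Y"
    then obtain u where u: "u \<in> fa_carrier l" "a = hecke_elt ?b c l u" by (auto simp: hecke_alg_def)
    show "vact ?Y a (vadd ?Y x y) = vadd ?Y (vact ?Y a x) (vact ?Y a y)"
      using vact_ind_comb[OF u(1) a(2,3), of 1 1] a mem by (simp add: u(2) Y.scale_one)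
  next
    fix a x assume a: "a \<in> hecke_alg ?b c l" "x \<in> ?R"
    then have x: "x \<in> vecs ?Y" "\<And>y. y \<in> vecs ?Y \<Longrightarrow> ?F x y = 0" by (auto simp: form_radical_def)
    have "?F (vact ?Y a x) y = 0" if "y \<in> vecs ?Y" for y
    proof -
      have "?F (vact ?Y a x) y = ?F x (vact ?Y (hecke_star ?b c l a) y)"
        using F(2) a(1) x(1) that unfolding invariant_form_def by blast
      then show ?thesis using x(2)[OF mem[OF star[OF a(1)] that]] by simp
    qed
    then show "vact ?Y a x \<in> ?R" using mem[OF a(1) x(1)] by (simp add: form_radical_def)
  next
    fix x assume x: "x \<in> vecs ?Y"
    let ?G = "(\<lambda>w. ind_vec ?b c l \<nu>' (word [Grp w])) ` W_grp l"
    show "\<exists>r\<in>?R. \<forall>r'\<in>?R. ?P (vadd ?Y x (vscale ?Y (- 1) r)) r' = 0"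
    proof (rule Y.projection[OF _ _ R _ x])
      show "finite ?G" by (intro finite_imageI finite_W_grp)
      show "?G \<subseteq> vecs ?Y" by (auto intro: ind_vec_mem fa_word_Grp)
      show "?R \<subseteq> rep_span ?Y ?G" using ind_vec_W_span[of ?b c l \<nu>'] by (auto simp: form_radical_def)
    qed
  qed (use mem star in auto)
  then show ?thesis by (simp add: hecke_langlands_quotient_def langlands_quotient_def)
qed

theorem theorem9p29:
  fixes nm :: normalization and s :: setting and e :: "nat \<Rightarrow> 'm::finite"
    and B :: "(complex^'m^'m) set" and k :: nat and \<nu> :: "nat \<Rightarrow> complex"
    and hV :: "complex^'m \<Rightarrow> complex^'m \<Rightarrow> complex"
    and hX :: "(real^'m^'m \<Rightarrow> complex) \<Rightarrow> (real^'m^'m \<Rightarrow> complex) \<Rightarrow> complex"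
  defines "d \<equiv> real_rank s" and "b \<equiv> braid_const nm"
    and "X \<equiv> principal_series s e k \<nu>"
  assumes "valid_setting s"
    and "bij_betw e {1..mat_size s} UNIV"
    and "k \<le> d"
    and "is_lie_basis s e B"
    and "is_V_form s e hV"
    and "hermitian_form X hX"
    and "invariant_form (g_cpx s e) g_star X hX"
    and "(\<exists>\<Phi>. hecke_iso nm s e B (vecs X) (mu_up s e) (c_up nm s) k \<nu> \<Phi> \<and>
            \<not> unitary (hecke_alg b (c_up nm s) k) (hecke_star b (c_up nm s) k)
                (hecke_langlands_quotient b (c_up nm s) k \<nu> \<Phi> hX hV))
       \<or> (\<exists>\<Phi>. hecke_iso nm s e B (vecs X) (mu_low s e) (c_low nm s) (d - k) (\<lambda>i. \<nu> (k + i)) \<Phi> \<and>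
            \<not> unitary (hecke_alg b (c_low nm s) (d - k)) (hecke_star b (c_low nm s) (d - k))
                (hecke_langlands_quotient b (c_low nm s) (d - k) (\<lambda>i. \<nu> (k + i)) \<Phi> hX hV))"
  shows "\<not> unitary (g_cpx s e) g_star (langlands_quotient X hX)"
proof
  interpret group_setting s e by unfold_locales (rule assms(5))
  interpret X: cspace X unfolding X_def by (rule cspace_principal_series)
  let ?R = "form_radical X hX"
  interpret R: csubspace X ?R by (rule X.csubspace_form_radical) fact
  let ?q = "coset X ?R"
  have X_sel: "vecs X = ps_space s e k \<nu>" "vact X = lie_act s e" by (simp_all add: X_def)
  have comb: "vadd X (vscale X a x) (vscale X a' y) = (\<lambda>g. a * x g + a' * y g)" for a a' x y
    by (simp add: X_def plus_fun_def)
  have star: "g_star Z \<in> g_cpx s e" if "Z \<in> g_cpx s e" for Z using g_star_lie that by (simp add: lie_g_cpx)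
  have act: "lie_act s e Z x \<in> vecs X" if "Z \<in> g_cpx s e" "x \<in> vecs X" for Z x
    using lie_act_ps[OF _ _ assms(4)] that by (simp add: X_sel lie_g_cpx)
  have act_q: "vact R.Q Z (?q x) = ?q (lie_act s e Z x)" if Z: "Z \<in> g_cpx s e" and x: "x \<in> vecs X" for Z x
    unfolding X_sel(2)[symmetric]
  proof (rule R.vact_quotient[OF x])
    fix x y assume "x \<in> vecs X" "y \<in> vecs X"
    then show "vact X Z (vadd X x y) = vadd X (vact X Z x) (vact X Z y)"
      using lie_act_comb[OF ps_spaceD(2) ps_spaceD(2), of x k \<nu> y k \<nu> Z 1 1] Z
      by (simp add: X_sel X_def lie_g_cpx plus_fun_def)
  next
    fix x assume "x \<in> vecs X"
    then show "vact X Z x \<in> vecs X" using act Z by (simp add: X_sel)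
  next
    fix x assume x: "x \<in> ?R"
    then have "hX (vact X Z x) y = 0" if "y \<in> vecs X" for y
      using assms(10) Z that act[OF star[OF Z] that] unfolding invariant_form_def form_radical_def by (simp add: X_sel)
    then show "vact X Z x \<in> ?R" using act[OF Z] x by (simp add: form_radical_def X_sel)
  qed
  assume "unitary (g_cpx s e) g_star (langlands_quotient X hX)"
  then obtain f where f: "hermitian_form R.Q f" "invariant_form (g_cpx s e) g_star R.Q f" "positive_definite R.Q f"
    unfolding unitary_def langlands_quotient_def by blast
  \<comment> \<open>The pull-back to \<open>X\<close>. It is semidefinite, and its null vectors are
    exactly those of \<open>?R\<close>, by \<open>f'_zero\<close> and \<open>f'_pos\<close>.\<close>
  define f' where "f' x y = f (?q x) (?q y)" for x y
  have q: "?q x \<in> vecs R.Q" if "x \<in> vecs X" for x using that by (simp add: R.vecs_quotient)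
  have f'_comb: "f' (vadd X (vscale X a x) (vscale X a' y)) z = a * f' x z + a' * f' y z"
    "f' z (vadd X (vscale X a x) (vscale X a' y)) = cnj a * f' z x + cnj a' * f' z y"
    if m: "x \<in> vecs X" "y \<in> vecs X" "z \<in> vecs X" for a a' x y z
  proof -
    have "?q (vadd X (vscale X a x) (vscale X a' y)) = vadd R.Q (vscale R.Q a (?q x)) (vscale R.Q a' (?q y))"
      using m by (simp add: R.vadd_quotient R.vscale_quotient X.scale_mem)
    then show "f' (vadd X (vscale X a x) (vscale X a' y)) z = a * f' x z + a' * f' y z"
      "f' z (vadd X (vscale X a x) (vscale X a' y)) = cnj a * f' z x + cnj a' * f' z y"
      using f(1) q m unfolding hermitian_form_def f'_def by simp_all
  qed
  have f'_herm: "hermitian_form X f'" unfolding hermitian_form_def by (simp add: f'_comb)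
  have f'_inv: "f' (lie_act s e Z x) y = f' x (lie_act s e (g_star Z) y)"
    if "Z \<in> g_cpx s e" "x \<in> vecs X" "y \<in> vecs X" for Z x y
    using f(2) that q star act_q unfolding invariant_form_def f'_def by metis
  have f'_zero: "f' x x = 0" if "x \<in> ?R" for x
  proof -
    have "?q x = ?q (vzero X)" using that R.sub_mem R.coset_eq_zero_iff R.coset_zero by metis
    then have "f' x x = f' (vzero X) (vzero X)" by (simp add: f'_def)
    also have "\<dots> = 0"
      using f'_comb(1)[OF X.zero_mem X.zero_mem X.zero_mem, of 0 0]
      by (simp add: X.scale_vzero X.add_zero X.zero_mem)
    finally show ?thesis .
  qed
  have f'_pos: "f' x x \<in> \<real> \<and> 0 < Re (f' x x)" if "x \<in> vecs X" "x \<notin> ?R" for x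
    using f(3) q[OF that(1)] that R.coset_eq_zero_iff[OF that(1)]
    unfolding positive_definite_def f'_def R.vzero_quotient R.coset_zero by blast
  have ff: "functor_forms s e k \<nu> h hV"
    if "hermitian_form X h" "\<And>Z x y. \<lbrakk>Z \<in> g_cpx s e; x \<in> vecs X; y \<in> vecs X\<rbrakk> \<Longrightarrow> h (lie_act s e Z x) y = h x (lie_act s e (g_star Z) y)"
    for h
  proof unfold_locales
    show "fun_subspace (ps_space s e k \<nu>)" by (rule fun_subspace_ps)
    show "sesquilinear_on (ps_space s e k \<nu>) h" using that(1) unfolding X_def by (rule sesquilinear_principal_series)
    show "hermitian_form V_rep hV" using assms(8) by (simp add: is_V_form_def)
  qed (use that(2) assms in \<open>auto simp: X_sel\<close>)
  have hX: "functor_forms s e k \<nu> hX hV"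
    using assms(10) by (intro ff assms(9)) (auto simp: invariant_form_def X_sel)
  have fX: "functor_forms s e k \<nu> f' hV"
    by (intro ff f'_herm f'_inv)
  have real: "cnj (c_up nm s) = c_up nm s" "cnj (c_low nm s) = c_low nm s"
    by (cases s; cases nm; simp add: c_orth_def)+
  have pos: "f' x x \<in> \<real> \<and> 0 \<le> Re (f' x x)" if "x \<in> ps_space s e k \<nu>" for x
    using f'_zero[of x] f'_pos[of x] that by (cases "x \<in> ?R") (auto simp: X_sel less_imp_le)
  have null: "hX x y = 0" if "x \<in> ps_space s e k \<nu>" "f' x x = 0" "y \<in> ps_space s e k \<nu>" for x y
  proof -
    have "x \<in> ?R" using f'_pos[of x] that by (auto simp: X_sel)
    then show ?thesis using that by (auto simp: form_radical_def X_sel)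
  qed
  \<comment> \<open>The parameter \<open>\<nu>'\<close> of the Hecke module is independent of
    \<open>\<nu>\<close> in \<open>hecke_quotient_unitary\<close>, so the shifted parameter of the
    second alternative is an instance too.\<close>
  show False
    using assms(11) hecke_quotient_unitary[OF hX fX assms(7) _ real(1) pos null]
      hecke_quotient_unitary[OF hX fX assms(7) _ real(2) pos null]
    unfolding b_def X_sel by blast
qed

end
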